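(* Let $(u_j)_j$ be a bounded sequence in $\mathcal{D}^{1,2}_{cyl}(\mathbb{R}^3)$ such that each $u_j$ is the $z$-symmetrical rearrangement of itself. Then $(u_j)_j$ possesses a converging subsequence in $L^p+L^q(\mathbb{R}^3)$, for all $1<p<6<q$.
   Context: Functions are real-valued. $\mathcal{D}^{1,2}(\mathbb{R}^3)$ is the completion of $C_0^\infty(\mathbb{R}^3)$ with respect to the norm $\|u\|=\left(\int_{\mathbb{R}^3}|\nabla u|^2\,dx\right)^{1/2}$, and $$\mathcal{D}^{1,2}_{cyl}(\mathbb{R}^3)=\{u\in\mathcal{D}^{1,2}(\mathbb{R}^3)\mid u(\cdot,\cdot,z)\text{ is radial (in }\mathbb{R}^2)\text{ for a.e. }z\in\mathbb{R}\},$$ where points of $\mathbb{R}^3$ are written $(x,y,z)$. For a measurable function $u:\mathbb{R}^2\times\mathbb{R}\to\mathbb{R}$, the $z$-symmetrical rearrangement of $u$ in $(x,y)$ is the Schwarz symmetrical (symmetric decreasing) rearrangement $\tilde u_{x,y}:\mathbb{R}\to\mathbb{R}$ of the one-variable function $z\mapsto u(x,y,z)$; the $z$-symmetrical rearrangement of $u$ is the function $\tilde u(x,y,z)=\tilde u_{x,y}(z)$. For a set $\Omega$, $L^p+L^q(\Omega)$ is the Banach space of functions $v:\Omega\to\mathbb{R}$ of the form $v=v_1+v_2$ with $v_1\in L^p(\Omega)$, $v_2\in L^q(\Omega)$, with norm $\|v\|_{L^p+L^q}=\inf\{\|v_1\|_{L^p}+\|v_2\|_{L^q}\mid v_1\in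 L^p(\Omega),\,v_2\in L^q(\Omega),\,v_1+v_2=v\}$. *)

theory Defs
  imports "HOL-Analysis.Analysis"
begin

text \<open>
  Elements of the function spaces are Borel measurable functions, not classes modulo null sets;
  conditions on them are therefore phrased almost everywhere wherever this matters.
\<close>

definition Lp :: "'a measure \<Rightarrow> real \<Rightarrow> ('a \<Rightarrow> real) set" where
  "Lp M p = {f \<in> borel_measurable M. integrable M (\<lambda>x. \<bar>f x\<bar> powr p)}"

definition Lp_norm :: "'a measure \<Rightarrow> real \<Rightarrow> ('a \<Rightarrow> real) \<Rightarrow> real" where
  "Lp_norm M p f = (\<integral>x. \<bar>f x\<bar> powr p \<partial>M) powr (1 / p)"

definition Lp_plus_Lq :: "'a measure \<Rightarrow> real \<Rightarrow> real \<Rightarrow> ('a \<Rightarrow> real) set" where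
  "Lp_plus_Lq M p q = {v. \<exists>v1 \<in> Lp M p. \<exists>v2 \<in> Lp M q. v = (\<lambda>x. v1 x + v2 x)}"

definition Lp_plus_Lq_norm :: "'a measure \<Rightarrow> real \<Rightarrow> real \<Rightarrow> ('a \<Rightarrow> real) \<Rightarrow> real" where
  "Lp_plus_Lq_norm M p q v =
     Inf {Lp_norm M p v1 + Lp_norm M q v2 | v1 v2.
            v1 \<in> Lp M p \<and> v2 \<in> Lp M q \<and> (\<lambda>x. v1 x + v2 x) = v}"


fun C_k :: "nat \<Rightarrow> ('a::euclidean_space \<Rightarrow> real) \<Rightarrow> bool" where
  "C_k 0 f \<longleftrightarrow> continuous_on UNIV f"
| "C_k (Suc k) f \<longleftrightarrow> (\<forall>x. f differentiable (at x)) \<and>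
     (\<forall>b \<in> Basis. C_k k (\<lambda>x. frechet_derivative f (at x) b))"

definition Cc_infinity :: "('a::euclidean_space \<Rightarrow> real) set" where
  "Cc_infinity = {f. (\<forall>k. C_k k f) \<and> compact (closure {x. f x \<noteq> 0})}"

definition grad :: "('a::euclidean_space \<Rightarrow> real) \<Rightarrow> 'a \<Rightarrow> 'a" where
  "grad f x = (\<Sum>b\<in>Basis. frechet_derivative f (at x) b *\<^sub>R b)"

definition grad_norm :: "('a::euclidean_space \<Rightarrow> real) \<Rightarrow> real" where
  "grad_norm f = sqrt (\<integral>x. (norm (grad f x))\<^sup>2 \<partial>lborel)"


text \<open>Points of three-space are literally triples; the product norm is the Euclidean one.\<close>

type_synonym R3 = "real \<times> real \<times> real"

text \<open>
  By the Sobolev inequality a sequence of test functions that is Cauchy for \<open>grad_norm\<close> converges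
  in \<open>L\<^sup>6\<close>, and non-equivalent Cauchy sequences have different limits. The completion
  is realised as the space of these limits.
\<close>

definition D12_approx :: "(nat \<Rightarrow> R3 \<Rightarrow> real) \<Rightarrow> (R3 \<Rightarrow> real) \<Rightarrow> bool" where
  "D12_approx \<phi> u \<longleftrightarrow>
     (\<forall>n. \<phi> n \<in> Cc_infinity) \<and>
     (\<forall>e>0. \<exists>N. \<forall>m\<ge>N. \<forall>n\<ge>N. grad_norm (\<lambda>x. \<phi> m x - \<phi> n x) < e) \<and>
     u \<in> Lp lborel 6 \<and>
     (\<lambda>n. Lp_norm lborel 6 (\<lambda>x. \<phi> n x - u x)) \<longlonglongrightarrow> 0"

definition D12 :: "(R3 \<Rightarrow> real) set" where
  "D12 = {u. \<exists>\<phi>. D12_approx \<phi> u}"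

text \<open>
  The norm of the completion: the limit of the norms along an approximating sequence, which exists
  and does not depend on the sequence, so that the choice is immaterial.
\<close>

definition D12_norm :: "(R3 \<Rightarrow> real) \<Rightarrow> real" where
  "D12_norm u = (SOME l. \<exists>\<phi>. D12_approx \<phi> u \<and> (\<lambda>n. grad_norm (\<phi> n)) \<longlonglongrightarrow> l)"

definition radial_ae :: "(real \<times> real \<Rightarrow> real) \<Rightarrow> bool" where
  "radial_ae f \<longleftrightarrow> (\<exists>g :: real \<Rightarrow> real. AE w in lborel. f w = g (norm w))"

definition D12_cyl :: "(R3 \<Rightarrow> real) set" where
  "D12_cyl = {u \<in> D12. AE z in lborel. radial_ae (\<lambda>(x, y). u (x, y, z))}"


text \<open>The open interval centred at the origin with the same measure as \<open>A\<close> (all of the line if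
  that measure is infinite).\<close>

definition sym_interval :: "real set \<Rightarrow> real set" where
  "sym_interval A = {z. ennreal (2 * \<bar>z\<bar>) < emeasure lborel A}"

text \<open>
  Layer-cake definition. As usual, functions of varying sign are rearranged through their absolute
  value. For functions in \<open>D12\<close> almost all sections in \<open>z\<close> are in \<open>L\<^sup>6\<close>, and then the
  integral is finite except possibly at \<open>z = 0\<close>, so \<open>enn2real\<close> matters only on a null set.
\<close>

definition schwarz_rearrangement :: "(real \<Rightarrow> real) \<Rightarrow> real \<Rightarrow> real" where
  "schwarz_rearrangement f z =
     enn2real (\<integral>\<^sup>+ t\<in>{0..}. indicator (sym_interval {w. \<bar>f w\<bar> > t}) z \<partial>lborel)"

definition z_rearrangement :: "(R3 \<Rightarrow> real) \<Rightarrow> R3 \<Rightarrow> real" where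
  "z_rearrangement u = (\<lambda>(x, y, z). schwarz_rearrangement (\<lambda>w. u (x, y, w)) z)"

end

theory Submission
  imports Defs "HOL-Complex_Analysis.Great_Picard"
begin

text \<open>
  A function that is radial in \<open>(x, y)\<close> lives on a half plane with coordinates \<open>(r, z)\<close> and measure
  \<open>r dr dz\<close>. There the radial estimate \<open>\<integral> g(r,z)\<^sup>4 dz \<le> M / r\<close> together with the one-dimensional
  bound on \<open>sup\<^sub>z g(r,z)\<^sup>4\<close> yields a Sobolev inequality that controls \<open>M\<close> and the \<open>L\<^sup>6\<close> norm by
  the gradient. Monotonicity in \<open>|z|\<close> then gives the pointwise decay \<open>u(r,z) \<le> C (r |z|) ^ (-1/4)\<close>.

  The primitives \<open>r \<mapsto> \<integral>\<^sub>a\<^sup>b u(r,z) dz\<close> are locally uniformly Hoelder continuous, hence converge along a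
  subsequence for all rational \<open>a\<close>, \<open>b\<close>; as the functions decrease in \<open>|z|\<close>, this forces convergence
  for almost every \<open>(r,z)\<close>. Where \<open>r\<close> is bounded, the decay confines the level sets to a region of
  finite measure; where \<open>r > R\<close>, the level sets have height \<open>O(1/R)\<close> in \<open>z\<close>, so the bound on
  \<open>\<partial>\<^sub>z u\<close> makes them small, uniformly along the sequence. Convergence in measure together with
  boundedness in \<open>L\<^sup>6\<close> is convergence in \<open>L\<^sup>p + L\<^sup>q\<close>.
\<close>

subsection \<open>Product measures and polar coordinates\<close>

text \<open>Elements of \<open>D12\<close> are only L6 limits of test functions, and these are
  neither radial nor monotone. Estimates that differentiate are therefore proved for one test
  function on one half plane and kept in forms that survive an L6 limit (integrals over slices,
  measures of level sets); monotonicity is used on the limit only. The fourth power is singled out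
  because Cauchy-Schwarz splits its derivative 4 g^3 dg into the L6 norm and the energy K: with N
  the integral of g^6, the root M of 16 N K bounds the integral of each partial derivative. The
  estimate N^2 \<le> M^3 then closes on itself and gives N \<le> 16^3 K^3. Scaling, which preserves
  both the energy and the L6 norm, does no harm because p < 6 < q: large values on a set of small
  measure are small in the p-norm, and small values are small in the q-norm. Decay in r|z| does not
  settle the region far from the axis, since r|z| < c, r > R has infinite measure for r dr dz; the
  z-derivative supplies the missing smallness.\<close>

lemma borel_measurable_fst [measurable]: "fst \<in> borel_measurable borel"
  by (intro borel_measurable_continuous_onI continuous_intros)

lemma borel_measurable_snd [measurable]: "snd \<in> borel_measurable borel"
  by (intro borel_measurable_continuous_onI continuous_intros)

lemma nn_integral_lborel_pair:
  fixes f :: "'a::euclidean_space \<times> 'b::euclidean_space \<Rightarrow> ennreal"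
  assumes "f \<in> borel_measurable borel"
  shows "(\<integral>\<^sup>+w. f w \<partial>lborel) = (\<integral>\<^sup>+x. \<integral>\<^sup>+y. f (x, y) \<partial>lborel \<partial>lborel)"
  using lborel.nn_integral_fst[of f lborel] assms
  by (simp add: lborel_prod)

lemma nn_integral_lborel_swap:
  fixes f :: "'a::euclidean_space \<Rightarrow> 'b::euclidean_space \<Rightarrow> ennreal"
  assumes "(\<lambda>(x, y). f x y) \<in> borel_measurable borel"
  shows "(\<integral>\<^sup>+x. \<integral>\<^sup>+y. f x y \<partial>lborel \<partial>lborel) = (\<integral>\<^sup>+y. \<integral>\<^sup>+x. f x y \<partial>lborel \<partial>lborel)"
  using lborel_pair.Fubini[of "\<lambda>(x, y). f x y"] assms
  by (simp add: lborel_prod)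

lemma AE_lborel_pairD:
  assumes "AE w in (lborel :: ('a::euclidean_space \<times> 'b::euclidean_space) measure). P w"
  shows "AE x in lborel. AE y in lborel. P (x, y)"
  using lborel_pair.AE_pair[of P] assms unfolding lborel_prod .

lemma AE_lborel_pair_iff:
  assumes [measurable]: "Measurable.pred borel (P :: 'a::euclidean_space \<times> 'b::euclidean_space \<Rightarrow> bool)"
  shows "(AE w in lborel. P w) \<longleftrightarrow> (AE x in lborel. AE y in lborel. P (x, y))"
proof -
  have "{x \<in> space (lborel \<Otimes>\<^sub>M lborel). P (fst x, snd x)} \<in> sets (lborel \<Otimes>\<^sub>M lborel)"
    unfolding lborel_prod by simp
  from lborel_pair.AE_pair_iff[of "\<lambda>x y. P (x, y)", OF this] show ?thesis
    unfolding lborel_prod by simp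
qed

lemma AE_lborel_swap:
  assumes "Measurable.pred borel (\<lambda>(x::'a::euclidean_space, y::'b::euclidean_space). P x y)"
  shows "(AE x in lborel. AE y in lborel. P x y) \<longleftrightarrow> (AE y in lborel. AE x in lborel. P x y)"
proof (rule lborel_pair.AE_commute)
  show "{w \<in> space (lborel \<Otimes>\<^sub>M lborel). P (fst w) (snd w)} \<in> sets (lborel \<Otimes>\<^sub>M lborel)"
    unfolding lborel_prod using assms by (simp add: split_beta')
qed

text \<open>As \<open>ennreal\<close> maps negative reals to 0, the density vanishes for r \<le> 0:
  the measure is carried by the open half plane r > 0 although its space is the whole plane, on
  which slices of test functions are smooth.\<close>

definition cyl :: "(real \<times> real) measure" where
  "cyl = density lborel (\<lambda>w. ennreal (fst w))"

lemma sets_cyl [measurable_cong, simp]: "sets cyl = sets borel"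
  by (simp add: cyl_def)

lemma space_cyl [simp]: "space cyl = UNIV"
  by (simp add: cyl_def)

lemma nn_integral_cyl:
  assumes [measurable]: "f \<in> borel_measurable borel"
  shows "(\<integral>\<^sup>+w. f w \<partial>cyl) = (\<integral>\<^sup>+r. ennreal r * (\<integral>\<^sup>+z. f (r, z) \<partial>lborel) \<partial>lborel)"
proof -
  have "(\<integral>\<^sup>+w. f w \<partial>cyl) = (\<integral>\<^sup>+w. ennreal (fst w) * f w \<partial>lborel)"
    unfolding cyl_def by (rule nn_integral_density) auto
  also have "\<dots> = (\<integral>\<^sup>+r. ennreal r * (\<integral>\<^sup>+z. f (r, z) \<partial>lborel) \<partial>lborel)"
    by (subst nn_integral_lborel_pair) (auto intro!: nn_integral_cong simp: nn_integral_cmult)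
  finally show ?thesis .
qed

lemma AE_cyl_iff:
  assumes [measurable]: "Measurable.pred borel P"
  shows "(AE w in cyl. P w) \<longleftrightarrow> (AE r in lborel. 0 < r \<longrightarrow> (AE z in lborel. P (r, z)))"
proof -
  have "(AE w in cyl. P w) \<longleftrightarrow> (AE w in lborel. 0 < fst w \<longrightarrow> P w)"
    unfolding cyl_def by (subst AE_density) (auto simp: split_beta')
  also have "\<dots> \<longleftrightarrow> (AE r in lborel. AE z in lborel. 0 < r \<longrightarrow> P (r, z))"
    by (subst AE_lborel_pair_iff) auto
  also have "\<dots> \<longleftrightarrow> (AE r in lborel. 0 < r \<longrightarrow> (AE z in lborel. P (r, z)))"
    by (intro AE_cong) auto
  finally show ?thesis .
qed

text \<open>Only one direction of \<open>AE_cyl_iff\<close>, but for arbitrary predicates. It serves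
  identities involving \<open>z_rearrangement u\<close>, whose measurability is never
  established.\<close>

lemma AE_cylD:
  assumes "AE w in cyl. P w"
  shows "AE r in lborel. 0 < r \<longrightarrow> (AE z in lborel. P (r, z))"
proof -
  have "AE w in lborel. 0 < fst w \<longrightarrow> P w"
    using assms unfolding cyl_def by (subst (asm) AE_density) (auto simp: split_beta')
  from AE_lborel_pairD[OF this] show ?thesis by eventually_elim auto
qed

text \<open>
  Half planes bounded by the axis are parametrised by their slope \<open>t = tan \<theta>\<close> instead of the angle:
  then \<open>slope_cos t = cos \<theta>\<close> and \<open>d\<theta> = (slope_cos t)\<^sup>2 dt\<close>, and polar coordinates need only
  Fubini's theorem and affine substitutions on the line.
\<close>

definition slope_cos :: "real \<Rightarrow> real" where "slope_cos t = 1 / sqrt (1 + t\<^sup>2)"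

lemma slope_cos_pos [simp]: "0 < slope_cos t"
  by (simp add: slope_cos_def add_pos_nonneg)

lemma slope_cos_simps [simp]: "slope_cos t \<noteq> 0" "\<bar>slope_cos t\<bar> = slope_cos t"
  using slope_cos_pos[of t] by linarith+

lemma slope_cos_sq: "(slope_cos t)\<^sup>2 + (t * slope_cos t)\<^sup>2 = 1"
proof -
  have "1 + t\<^sup>2 > 0" by (simp add: add_pos_nonneg)
  then show ?thesis by (simp add: slope_cos_def power_divide power_mult_distrib add_divide_distrib[symmetric])
qed

lemma slope_cos_measurable [measurable]: "slope_cos \<in> borel_measurable borel"
  unfolding slope_cos_def by measurable

text \<open>For fixed x > 0 put y = x t, which costs a factor x; after Fubini put x = s cos \<theta>
  for fixed t. The factor x and the Jacobian contribute one \<open>slope_cos t\<close> each, whence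
  the square.\<close>

lemma nn_integral_half_plane:
  fixes k :: "real \<times> real \<Rightarrow> ennreal"
  assumes [measurable]: "k \<in> borel_measurable borel"
  shows "(\<integral>\<^sup>+x. indicator {0<..} x * (\<integral>\<^sup>+y. k (x, y) \<partial>lborel) \<partial>lborel) =
    (\<integral>\<^sup>+t. ennreal ((slope_cos t)\<^sup>2) * (\<integral>\<^sup>+s. ennreal s * k (s * slope_cos t, s * (t * slope_cos t)) \<partial>lborel) \<partial>lborel)"
proof -
  have "(\<integral>\<^sup>+x. indicator {0<..} x * (\<integral>\<^sup>+y. k (x, y) \<partial>lborel) \<partial>lborel)
      = (\<integral>\<^sup>+x. \<integral>\<^sup>+t. ennreal x * k (x, x * t) \<partial>lborel \<partial>lborel)"
  proof (rule nn_integral_cong)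
    fix x :: real
    show "indicator {0<..} x * (\<integral>\<^sup>+y. k (x, y) \<partial>lborel) = (\<integral>\<^sup>+t. ennreal x * k (x, x * t) \<partial>lborel)"
    proof (cases "x > 0")
      case True
      then show ?thesis
        by (subst nn_integral_real_affine[where c = x and t = 0]) (auto simp: nn_integral_cmult)
    qed (simp add: ennreal_neg)
  qed
  also have "\<dots> = (\<integral>\<^sup>+t. \<integral>\<^sup>+x. ennreal x * k (x, x * t) \<partial>lborel \<partial>lborel)"
    by (rule nn_integral_lborel_swap) measurable
  also have "\<dots> = (\<integral>\<^sup>+t. ennreal ((slope_cos t)\<^sup>2) * (\<integral>\<^sup>+s. ennreal s * k (s * slope_cos t, s * (t * slope_cos t)) \<partial>lborel) \<partial>lborel)"
  proof (rule nn_integral_cong)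
    fix t :: real
    have pos: "0 < slope_cos t" by simp
    have "(\<integral>\<^sup>+x. ennreal x * k (x, x * t) \<partial>lborel) =
        ennreal (slope_cos t) * (\<integral>\<^sup>+s. ennreal (slope_cos t * s) * k (slope_cos t * s, slope_cos t * s * t) \<partial>lborel)"
      by (subst nn_integral_real_affine[where c = "slope_cos t" and t = 0]) auto
    also have "\<dots> = ennreal (slope_cos t) * (\<integral>\<^sup>+s. ennreal (slope_cos t) * (ennreal s * k (slope_cos t * s, slope_cos t * s * t)) \<partial>lborel)"
      by (simp add: ennreal_mult'[OF less_imp_le[OF pos]] mult.assoc)
    also have "\<dots> = ennreal (slope_cos t) * (ennreal (slope_cos t) * (\<integral>\<^sup>+s. ennreal s * k (slope_cos t * s, slope_cos t * s * t) \<partial>lborel))"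
      by (subst nn_integral_cmult) auto
    finally show "(\<integral>\<^sup>+x. ennreal x * k (x, x * t) \<partial>lborel) =
        ennreal ((slope_cos t)\<^sup>2) * (\<integral>\<^sup>+s. ennreal s * k (s * slope_cos t, s * (t * slope_cos t)) \<partial>lborel)"
      by (simp add: ennreal_mult'[OF less_imp_le[OF pos]] power2_eq_square mult_ac)
  qed
  finally show ?thesis .
qed

lemma nn_integral_half_space:
  fixes h :: "R3 \<Rightarrow> ennreal"
  assumes [measurable]: "h \<in> borel_measurable borel"
  shows "(\<integral>\<^sup>+w. indicator {0<..} (fst w) * h w \<partial>lborel) =
    (\<integral>\<^sup>+t. ennreal ((slope_cos t)\<^sup>2) *
       (\<integral>\<^sup>+(s, z). h (s * slope_cos t, s * (t * slope_cos t), z) \<partial>cyl) \<partial>lborel)"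
proof -
  define k where "k = (\<lambda>(x, y). \<integral>\<^sup>+z. h (x, y, z) \<partial>lborel)"
  have [measurable]: "k \<in> borel_measurable borel"
    unfolding k_def by measurable
  have "(\<integral>\<^sup>+w. indicator {0<..} (fst w) * h w \<partial>lborel) =
     (\<integral>\<^sup>+x. \<integral>\<^sup>+v. indicator {0<..} x * h (x, v) \<partial>lborel \<partial>lborel)"
    by (subst nn_integral_lborel_pair) auto
  also have "\<dots> = (\<integral>\<^sup>+x. indicator {0<..} x * (\<integral>\<^sup>+y. k (x, y) \<partial>lborel) \<partial>lborel)"
    by (intro nn_integral_cong) (auto simp: nn_integral_lborel_pair nn_integral_cmult k_def)
  also have "\<dots> = (\<integral>\<^sup>+t. ennreal ((slope_cos t)\<^sup>2) * (\<integral>\<^sup>+s. ennreal s * k (s * slope_cos t, s * (t * slope_cos t)) \<partial>lborel) \<partial>lborel)"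
    by (rule nn_integral_half_plane) measurable
  also have "\<dots> = (\<integral>\<^sup>+t. ennreal ((slope_cos t)\<^sup>2) *
       (\<integral>\<^sup>+(s, z). h (s * slope_cos t, s * (t * slope_cos t), z) \<partial>cyl) \<partial>lborel)"
    by (intro nn_integral_cong arg_cong2[where f = "(*)"] refl, subst nn_integral_cyl) (auto simp: k_def)
  finally show ?thesis .
qed

subsection \<open>A Sobolev inequality on the half plane\<close>

lemma ennreal_le_of_power2_le:
  assumes "(x::ennreal)\<^sup>2 \<le> ennreal (m\<^sup>2)" "0 \<le> m"
  shows "x \<le> ennreal m"
proof (cases x)
  case (real y)
  with assms have "y\<^sup>2 \<le> m\<^sup>2"
    by (simp add: ennreal_power)
  with real assms show ?thesis
    using power2_le_imp_le by (auto intro!: ennreal_leI)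
next
  case top
  with assms(1) show ?thesis by (simp add: top_unique)
qed

lemma nn_integral_power2_le:
  fixes f g :: "'a \<Rightarrow> real"
  assumes [measurable]: "f \<in> borel_measurable M" "g \<in> borel_measurable M"
    and le: "(\<integral>\<^sup>+x. ennreal ((f x)\<^sup>2) \<partial>M) \<le> ennreal a" "(\<integral>\<^sup>+x. ennreal ((g x)\<^sup>2) \<partial>M) \<le> ennreal b"
    and pos: "0 \<le> a" "0 \<le> b"
  shows "(\<integral>\<^sup>+x. ennreal \<bar>f x * g x\<bar> \<partial>M)\<^sup>2 \<le> ennreal (a * b)"
proof -
  have "(\<integral>\<^sup>+x. ennreal \<bar>f x * g x\<bar> \<partial>M)\<^sup>2 = (\<integral>\<^sup>+x. ennreal \<bar>f x\<bar> * ennreal \<bar>g x\<bar> \<partial>M)\<^sup>2"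
    by (simp add: abs_mult ennreal_mult)
  also have "\<dots> \<le> (\<integral>\<^sup>+x. (ennreal \<bar>f x\<bar>)\<^sup>2 \<partial>M) * (\<integral>\<^sup>+x. (ennreal \<bar>g x\<bar>)\<^sup>2 \<partial>M)"
    by (rule Cauchy_Schwarz_nn_integral) auto
  also have "\<dots> = (\<integral>\<^sup>+x. ennreal ((f x)\<^sup>2) \<partial>M) * (\<integral>\<^sup>+x. ennreal ((g x)\<^sup>2) \<partial>M)"
    by (simp add: ennreal_power)
  also have "\<dots> \<le> ennreal a * ennreal b"
    by (intro mult_mono le) auto
  finally show ?thesis by (simp add: ennreal_mult pos)
qed

lemma ennreal_diff_le_nn_integral_deriv:
  fixes f f' :: "real \<Rightarrow> real"
  assumes ab: "a \<le> b" and der: "\<And>x. (f has_real_derivative f' x) (at x)"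
    and cont: "continuous_on UNIV f'"
  shows "ennreal \<bar>f b - f a\<bar> \<le> (\<integral>\<^sup>+x. indicator {a..b} x * ennreal \<bar>f' x\<bar> \<partial>lborel)"
proof -
  have "has_bochner_integral lborel (\<lambda>x. f' x * indicator {a..b} x) (f b - f a)"
    using ab der cont by (intro has_bochner_integral_FTC_Icc_real) (auto simp: continuous_on_eq_continuous_at)
  then have i: "integrable lborel (\<lambda>x. f' x * indicator {a..b} x)"
    and e: "f b - f a = (\<integral>x. f' x * indicator {a..b} x \<partial>lborel)"
    by (auto simp: has_bochner_integral_iff)
  have "ennreal (norm (\<integral>x. f' x * indicator {a..b} x \<partial>lborel)) \<le> (\<integral>\<^sup>+x. norm (f' x * indicator {a..b} x) \<partial>lborel)"
    by (rule integral_norm_bound_ennreal[OF i])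
  then show ?thesis
    unfolding e[symmetric] by (simp add: abs_mult ennreal_mult' mult.commute ennreal_indicator)
qed

text \<open>
  \<open>g\<close> plays the role of the restriction of a test function to a half plane bounded by the axis;
  \<open>g1\<close> and \<open>g2\<close> are its partial derivatives.
\<close>

locale half_plane_test =
  fixes g g1 g2 :: "real \<times> real \<Rightarrow> real" and L K :: real
  assumes cont_g: "continuous_on UNIV g" and cont_g1: "continuous_on UNIV g1"
    and cont_g2: "continuous_on UNIV g2"
    and deriv_r: "\<And>r z. ((\<lambda>r. g (r, z)) has_real_derivative g1 (r, z)) (at r)"
    and deriv_z: "\<And>r z. ((\<lambda>z. g (r, z)) has_real_derivative g2 (r, z)) (at z)"
    and supp: "\<And>r z. L \<le> \<bar>r\<bar> \<or> L \<le> \<bar>z\<bar> \<Longrightarrow> g (r, z) = 0"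
    and L_pos: "0 < L" and K_pos: "0 \<le> K"
    and energy: "(\<integral>\<^sup>+w. ennreal ((g1 w)\<^sup>2 + (g2 w)\<^sup>2) \<partial>cyl) \<le> ennreal K"
begin

lemma g_measurable [measurable]: "g \<in> borel_measurable borel"
  and g1_measurable [measurable]: "g1 \<in> borel_measurable borel"
  and g2_measurable [measurable]: "g2 \<in> borel_measurable borel"
  by (intro borel_measurable_continuous_onI cont_g cont_g1 cont_g2)+

lemma cont_slices:
  "continuous_on UNIV (\<lambda>r. g (r, z))" "continuous_on UNIV (\<lambda>r. g1 (r, z))"
  "continuous_on UNIV (\<lambda>z. g (r, z))" "continuous_on UNIV (\<lambda>z. g2 (r, z))"
  by (intro continuous_on_compose2[OF cont_g] continuous_on_compose2[OF cont_g1]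
       continuous_on_compose2[OF cont_g2] continuous_intros subset_UNIV)+

lemma energy_r: "(\<integral>\<^sup>+w. ennreal ((g1 w)\<^sup>2) \<partial>cyl) \<le> ennreal K"
  and energy_z: "(\<integral>\<^sup>+w. ennreal ((g2 w)\<^sup>2) \<partial>cyl) \<le> ennreal K"
  by (rule order_trans[OF nn_integral_mono energy], simp)+

definition "n6 = enn2real (\<integral>\<^sup>+w. ennreal ((g w)^6) \<partial>cyl)"

lemma n6_nonneg: "0 \<le> n6" by (simp add: n6_def)

text \<open>Compact support enters here. Finiteness of this integral is what permits cancelling
  powers of \<open>n6\<close> in the a priori bound for \<open>n6\<close> itself.\<close>

lemma n6: "(\<integral>\<^sup>+w. ennreal ((g w)^6) \<partial>cyl) = ennreal n6"
proof -
  define box where "box = cbox (-L, -L) (L, L)"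
  have "compact ((\<lambda>w. (g w)^6) ` box)"
    unfolding box_def by (intro compact_continuous_image continuous_intros continuous_on_subset[OF cont_g]) auto
  then have "bounded ((\<lambda>w. (g w)^6) ` box)" by (rule compact_imp_bounded)
  then obtain B where B: "\<And>w. w \<in> box \<Longrightarrow> (g w)^6 \<le> B" "B > 0"
    unfolding bounded_pos by auto
  have "(\<integral>\<^sup>+w. ennreal ((g w)^6) \<partial>cyl) = (\<integral>\<^sup>+w. ennreal (fst w) * ennreal ((g w)^6) \<partial>lborel)"
    unfolding cyl_def by (rule nn_integral_density) auto
  also have "\<dots> \<le> (\<integral>\<^sup>+w. ennreal (L * B) * indicator box w \<partial>lborel)"
  proof (rule nn_integral_mono)
    fix w :: "real \<times> real"
    obtain r z where w: "w = (r, z)" by (cases w)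
    show "ennreal (fst w) * ennreal ((g w)^6) \<le> ennreal (L * B) * indicator box w"
    proof (cases "w \<in> box")
      case True
      then have "ennreal (fst w) * ennreal ((g w)^6) \<le> ennreal L * ennreal B"
        using B(1)[of w] by (intro mult_mono ennreal_leI) (auto simp: box_def w cbox_Pair_eq)
      with True show ?thesis using L_pos B(2) by (simp add: ennreal_mult)
    next
      case False
      then have "g w = 0" unfolding w by (intro supp) (auto simp: box_def w cbox_Pair_eq)
      then show ?thesis by simp
    qed
  qed
  also have "\<dots> = ennreal (L * B) * emeasure lborel box"
    by (subst nn_integral_cmult_indicator) (auto simp: box_def)
  also have "\<dots> < \<infinity>"
    using emeasure_lborel_cbox_finite[of "(-L, -L)" "(L, L)"]
    unfolding box_def by (simp add: ennreal_mult_less_top)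
  finally show ?thesis by (simp add: n6_def)
qed

text \<open>The Cauchy-Schwarz bound for the integral of either partial derivative of the fourth
  power of \<open>g\<close>: the square of 4 g^3 integrates to 16 \<open>n6\<close>, and each
  squared derivative to at most \<open>K\<close>.\<close>

definition "M = sqrt (16 * n6 * K)"

lemma M_nonneg: "0 \<le> M" by (simp add: M_def n6_nonneg K_pos)

lemma M_sq: "M\<^sup>2 = 16 * n6 * K" by (simp add: M_def n6_nonneg K_pos)

lemma flux_le:
  assumes [measurable]: "h \<in> borel_measurable borel"
    and h: "(\<integral>\<^sup>+w. ennreal ((h w)\<^sup>2) \<partial>cyl) \<le> ennreal K"
  shows "(\<integral>\<^sup>+w. ennreal \<bar>4 * g w ^ 3 * h w\<bar> \<partial>cyl) \<le> ennreal M"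
proof (rule ennreal_le_of_power2_le)
  have "(\<integral>\<^sup>+w. ennreal ((4 * g w ^ 3)\<^sup>2) \<partial>cyl) = (\<integral>\<^sup>+w. 16 * ennreal (g w ^ 6) \<partial>cyl)"
    by (intro nn_integral_cong) (simp add: power_mult_distrib ennreal_mult flip: power_mult)
  also have "\<dots> = ennreal (16 * n6)"
    by (subst nn_integral_cmult) (auto simp: n6 ennreal_mult n6_nonneg)
  finally have "(\<integral>\<^sup>+w. ennreal \<bar>4 * g w ^ 3 * h w\<bar> \<partial>cyl)\<^sup>2 \<le> ennreal (16 * n6 * K)"
    using h by (intro nn_integral_power2_le) (auto simp: n6_nonneg K_pos)
  then show "(\<integral>\<^sup>+w. ennreal \<bar>4 * g w ^ 3 * h w\<bar> \<partial>cyl)\<^sup>2 \<le> ennreal (M\<^sup>2)" by (simp add: M_sq)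
qed (rule M_nonneg)

section \<open>Fourth powers along lines, and the closed estimate for the L6 norm\<close>

lemma pow4_le_r:
  "ennreal (g (r, z) ^ 4) \<le> (\<integral>\<^sup>+\<rho>. indicator {r..} \<rho> * ennreal \<bar>4 * g (\<rho>, z) ^ 3 * g1 (\<rho>, z)\<bar> \<partial>lborel)"
proof -
  define b where "b = max r L"
  have "ennreal \<bar>g (b, z) ^ 4 - g (r, z) ^ 4\<bar>
      \<le> (\<integral>\<^sup>+\<rho>. indicator {r..b} \<rho> * ennreal \<bar>4 * g (\<rho>, z) ^ 3 * g1 (\<rho>, z)\<bar> \<partial>lborel)"
    by (rule ennreal_diff_le_nn_integral_deriv)
      (auto intro!: DERIV_power[OF deriv_r, THEN DERIV_cong] continuous_intros cont_slices simp: b_def)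
  also have "\<dots> \<le> (\<integral>\<^sup>+\<rho>. indicator {r..} \<rho> * ennreal \<bar>4 * g (\<rho>, z) ^ 3 * g1 (\<rho>, z)\<bar> \<partial>lborel)"
    by (intro nn_integral_mono) (auto split: split_indicator)
  finally show ?thesis using supp[of b z] L_pos by (simp add: b_def max_def split: if_splits)
qed

lemma pow4_le_z:
  "ennreal (g (r, z) ^ 4) \<le> (\<integral>\<^sup>+y. ennreal \<bar>4 * g (r, y) ^ 3 * g2 (r, y)\<bar> \<partial>lborel)"
proof -
  define b where "b = max z L"
  have "ennreal \<bar>g (r, b) ^ 4 - g (r, z) ^ 4\<bar>
      \<le> (\<integral>\<^sup>+y. indicator {z..b} y * ennreal \<bar>4 * g (r, y) ^ 3 * g2 (r, y)\<bar> \<partial>lborel)"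
    by (rule ennreal_diff_le_nn_integral_deriv)
      (auto intro!: DERIV_power[OF deriv_z, THEN DERIV_cong] continuous_intros cont_slices simp: b_def)
  also have "\<dots> \<le> (\<integral>\<^sup>+y. ennreal \<bar>4 * g (r, y) ^ 3 * g2 (r, y)\<bar> \<partial>lborel)"
    by (intro nn_integral_mono) (auto split: split_indicator)
  finally show ?thesis using supp[of r b] L_pos by (simp add: b_def max_def split: if_splits)
qed

text \<open>\<open>D\<close> and \<open>E\<close> integrate the two partial derivatives of the
  fourth power of \<open>g\<close> along the line at radius r. \<open>D\<close> governs how
  \<open>G\<close> decays in r, while \<open>E r\<close> bounds the supremum of that power on the
  line.\<close>

definition "G r = (\<integral>\<^sup>+z. ennreal (g (r, z) ^ 4) \<partial>lborel)"
definition "D r = (\<integral>\<^sup>+z. ennreal \<bar>4 * g (r, z) ^ 3 * g1 (r, z)\<bar> \<partial>lborel)"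
definition "E r = (\<integral>\<^sup>+z. ennreal \<bar>4 * g (r, z) ^ 3 * g2 (r, z)\<bar> \<partial>lborel)"

lemma GDE_measurable [measurable]:
  "G \<in> borel_measurable borel" "D \<in> borel_measurable borel" "E \<in> borel_measurable borel"
  unfolding G_def[abs_def] D_def[abs_def] E_def[abs_def] by measurable

lemma D_flux: "(\<integral>\<^sup>+r. ennreal r * D r \<partial>lborel) \<le> ennreal M"
  using flux_le[OF g1_measurable energy_r] unfolding D_def by (subst (asm) nn_integral_cyl) auto

lemma E_flux: "(\<integral>\<^sup>+r. ennreal r * E r \<partial>lborel) \<le> ennreal M"
  using flux_le[OF g2_measurable energy_z] unfolding E_def by (subst (asm) nn_integral_cyl) auto

lemma G_le: "G r \<le> (\<integral>\<^sup>+\<rho>. indicator {r..} \<rho> * D \<rho> \<partial>lborel)"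
proof -
  have "G r \<le> (\<integral>\<^sup>+z. \<integral>\<^sup>+\<rho>. indicator {r..} \<rho> * ennreal \<bar>4 * g (\<rho>, z) ^ 3 * g1 (\<rho>, z)\<bar> \<partial>lborel \<partial>lborel)"
    unfolding G_def by (intro nn_integral_mono pow4_le_r)
  also have "\<dots> = (\<integral>\<^sup>+\<rho>. \<integral>\<^sup>+z. indicator {r..} \<rho> * ennreal \<bar>4 * g (\<rho>, z) ^ 3 * g1 (\<rho>, z)\<bar> \<partial>lborel \<partial>lborel)"
    by (rule nn_integral_lborel_swap) measurable
  also have "\<dots> = (\<integral>\<^sup>+\<rho>. indicator {r..} \<rho> * D \<rho> \<partial>lborel)"
    unfolding D_def by (intro nn_integral_cong nn_integral_cmult) auto
  finally show ?thesis .
qed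

text \<open>In \<open>G_le\<close> only radii \<rho> \<ge> r contribute, so the weight r may be
  replaced by \<rho>, which is the density in \<open>D_flux\<close>.\<close>

lemma weighted_G_le: "ennreal r * G r \<le> ennreal M"
proof -
  have "ennreal r * G r \<le> ennreal r * (\<integral>\<^sup>+\<rho>. indicator {r..} \<rho> * D \<rho> \<partial>lborel)"
    by (intro mult_left_mono G_le) auto
  also have "\<dots> = (\<integral>\<^sup>+\<rho>. ennreal r * (indicator {r..} \<rho> * D \<rho>) \<partial>lborel)"
    by (rule nn_integral_cmult[symmetric]) auto
  also have "\<dots> \<le> (\<integral>\<^sup>+\<rho>. ennreal \<rho> * D \<rho> \<partial>lborel)"
    by (intro nn_integral_mono) (auto split: split_indicator intro!: mult_right_mono ennreal_leI)
  also note D_flux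
  finally show ?thesis .
qed

text \<open>A Hardy-type inequality with exponent one: after Fubini each \<rho> is counted over 0 <
  r \<le> \<rho>, and the length of this interval restores the weight \<rho> of
  \<open>D_flux\<close>.\<close>

lemma integral_G_le: "(\<integral>\<^sup>+r. indicator {0<..} r * G r \<partial>lborel) \<le> ennreal M"
proof -
  have "(\<integral>\<^sup>+r. indicator {0<..} r * G r \<partial>lborel)
     \<le> (\<integral>\<^sup>+r. indicator {0<..} r * (\<integral>\<^sup>+\<rho>. indicator {r..} \<rho> * D \<rho> \<partial>lborel) \<partial>lborel)"
    by (intro nn_integral_mono mult_left_mono G_le) auto
  also have "\<dots> = (\<integral>\<^sup>+r. \<integral>\<^sup>+\<rho>. indicator {(r, \<rho>). 0 < r \<and> r \<le> \<rho>} (r, \<rho>) * D \<rho> \<partial>lborel \<partial>lborel)"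
    by (intro nn_integral_cong, subst nn_integral_cmult[symmetric])
      (auto intro!: nn_integral_cong split: split_indicator)
  also have "\<dots> = (\<integral>\<^sup>+\<rho>. \<integral>\<^sup>+r. indicator {(r, \<rho>). 0 < r \<and> r \<le> \<rho>} (r, \<rho>) * D \<rho> \<partial>lborel \<partial>lborel)"
    by (rule nn_integral_lborel_swap) measurable
  also have "\<dots> = (\<integral>\<^sup>+\<rho>. ennreal \<rho> * D \<rho> \<partial>lborel)"
  proof (rule nn_integral_cong)
    fix \<rho> :: real
    have "(\<integral>\<^sup>+r. indicator {(r, \<rho>). 0 < r \<and> r \<le> \<rho>} (r, \<rho>) * D \<rho> \<partial>lborel)
       = (\<integral>\<^sup>+r. D \<rho> * indicator {0<..\<rho>} r \<partial>lborel)"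
      by (intro nn_integral_cong) (auto split: split_indicator)
    also have "\<dots> = ennreal \<rho> * D \<rho>"
      using emeasure_lborel_Ioc[of 0 \<rho>]
      by (subst nn_integral_cmult_indicator)
        (cases "0 \<le> \<rho>"; simp add: mult.commute[of "D \<rho>"] ennreal_neg)+
    finally show "(\<integral>\<^sup>+r. indicator {(r, \<rho>). 0 < r \<and> r \<le> \<rho>} (r, \<rho>) * D \<rho> \<partial>lborel) = ennreal \<rho> * D \<rho>" .
  qed
  also note D_flux
  finally show ?thesis .
qed

text \<open>Interpolation between the supremum bound for r \<open>G\<close> and the integral bound
  for \<open>G\<close>, by grouping r \<open>G\<close>^2 as (r \<open>G\<close>)
  \<open>G\<close>.\<close>

lemma integral_G_sq_le: "(\<integral>\<^sup>+r. ennreal r * (G r)\<^sup>2 \<partial>lborel) \<le> ennreal (M\<^sup>2)"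
proof -
  have "(\<integral>\<^sup>+r. ennreal r * (G r)\<^sup>2 \<partial>lborel) \<le> (\<integral>\<^sup>+r. ennreal M * (indicator {0<..} r * G r) \<partial>lborel)"
  proof (rule nn_integral_mono)
    fix r :: real
    have "ennreal r * (G r)\<^sup>2 = (ennreal r * G r) * G r" by (simp add: power2_eq_square mult.assoc)
    also have "\<dots> \<le> ennreal M * G r" by (intro mult_right_mono weighted_G_le) auto
    finally show "ennreal r * (G r)\<^sup>2 \<le> ennreal M * (indicator {0<..} r * G r)"
      by (cases "0 < r") (auto simp: ennreal_neg)
  qed
  also have "\<dots> = ennreal M * (\<integral>\<^sup>+r. indicator {0<..} r * G r \<partial>lborel)"
    by (rule nn_integral_cmult) auto
  also have "\<dots> \<le> ennreal M * ennreal M" by (intro mult_left_mono integral_G_le) auto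
  finally show ?thesis by (simp add: power2_eq_square ennreal_mult M_nonneg)
qed

text \<open>Lets \<open>E r\<close> be handled through a real square root in the Cauchy-Schwarz step
  that follows.\<close>

lemma E_finite: "E r < \<infinity>"
proof -
  have "compact ((\<lambda>z. \<bar>4 * g (r, z) ^ 3 * g2 (r, z)\<bar>) ` {-L..L})"
    by (intro compact_continuous_image continuous_intros continuous_on_subset[OF cont_slices(3)]
      continuous_on_subset[OF cont_slices(4)]) auto
  then have "bounded ((\<lambda>z. \<bar>4 * g (r, z) ^ 3 * g2 (r, z)\<bar>) ` {-L..L})" by (rule compact_imp_bounded)
  then obtain B where B': "\<forall>x\<in>(\<lambda>z. \<bar>4 * g (r, z) ^ 3 * g2 (r, z)\<bar>) ` {-L..L}. norm x \<le> B" and "B > 0"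
    unfolding bounded_pos by blast
  have B: "\<bar>4 * g (r, z) ^ 3 * g2 (r, z)\<bar> \<le> B" if "z \<in> {-L..L}" for z
    using bspec[OF B' imageI[OF that]] by simp
  have "E r \<le> (\<integral>\<^sup>+z. ennreal B * indicator {-L..L} z \<partial>lborel)"
    unfolding E_def
  proof (rule nn_integral_mono)
    fix z :: real
    show "ennreal \<bar>4 * g (r, z) ^ 3 * g2 (r, z)\<bar> \<le> ennreal B * indicator {-L..L} z"
    proof (cases "z \<in> {-L..L}")
      case True
      then show ?thesis using B[of z] by (simp add: ennreal_leI)
    next
      case False
      then have "g (r, z) = 0" by (intro supp) auto
      then show ?thesis by simp
    qed
  qed
  also have "\<dots> < \<infinity>" using L_pos by (subst nn_integral_cmult_indicator) (auto simp: ennreal_mult_less_top)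
  finally show ?thesis .
qed

text \<open>Write g^6 as g^4 g^2 and bound g^2 on the line at radius r by the root of
  \<open>E r\<close>. Cauchy-Schwarz for the measure r dr, called \<open>W\<close> below, then
  separates the integral of r \<open>G\<close>^2, at most M^2, from the integral of r
  \<open>E\<close>, at most M.\<close>

lemma n6_sq_le: "n6\<^sup>2 \<le> M ^ 3"
proof -
  define s where "s r = sqrt (enn2real (E r))" for r
  have [measurable]: "s \<in> borel_measurable borel" unfolding s_def[abs_def] by measurable
  have s_sq: "(ennreal (s r))\<^sup>2 = E r" for r
    using E_finite[of r] by (simp add: s_def ennreal_power)
  have g_sq: "ennreal ((g (r, z))\<^sup>2) \<le> ennreal (s r)" for r z
  proof (rule ennreal_leI)
    have "ennreal (g (r, z) ^ 4) \<le> E r" unfolding E_def by (rule pow4_le_z)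
    then have "g (r, z) ^ 4 \<le> enn2real (E r)"
      using E_finite[of r] enn2real_mono[of "ennreal (g (r, z) ^ 4)" "E r"] by simp
    then show "(g (r, z))\<^sup>2 \<le> s r" unfolding s_def by (intro real_le_rsqrt) simp
  qed
  define W where "W = density lborel (\<lambda>r::real. ennreal r)"
  have setsW [measurable_cong, simp]: "sets W = sets borel" by (simp add: W_def)
  have intW: "integral\<^sup>N W f = (\<integral>\<^sup>+r. ennreal r * f r \<partial>lborel)" if "f \<in> borel_measurable borel" for f
    unfolding W_def using that by (subst nn_integral_density) auto
  have "ennreal n6 = (\<integral>\<^sup>+r. ennreal r * (\<integral>\<^sup>+z. ennreal (g (r, z) ^ 6) \<partial>lborel) \<partial>lborel)"
    unfolding n6[symmetric] by (rule nn_integral_cyl) auto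
  also have "\<dots> \<le> (\<integral>\<^sup>+r. ennreal r * (\<integral>\<^sup>+z. ennreal (g (r, z) ^ 4) * ennreal (s r) \<partial>lborel) \<partial>lborel)"
  proof (intro nn_integral_mono mult_left_mono)
    fix r z
    have "ennreal (g (r, z) ^ 6) = ennreal (g (r, z) ^ 4) * ennreal ((g (r, z))\<^sup>2)"
      by (simp flip: ennreal_mult power_add)
    also have "\<dots> \<le> ennreal (g (r, z) ^ 4) * ennreal (s r)" by (intro mult_left_mono g_sq) auto
    finally show "ennreal (g (r, z) ^ 6) \<le> ennreal (g (r, z) ^ 4) * ennreal (s r)" .
  qed auto
  also have "\<dots> = (\<integral>\<^sup>+r. G r * ennreal (s r) \<partial>W)"
    by (subst intW) (auto simp: G_def nn_integral_multc)
  finally have "(ennreal n6)\<^sup>2 \<le> (\<integral>\<^sup>+r. G r * ennreal (s r) \<partial>W)\<^sup>2" by (rule power_mono) auto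
  also have "\<dots> \<le> (\<integral>\<^sup>+r. (G r)\<^sup>2 \<partial>W) * (\<integral>\<^sup>+r. (ennreal (s r))\<^sup>2 \<partial>W)"
    by (rule Cauchy_Schwarz_nn_integral) auto
  also have "\<dots> \<le> ennreal (M\<^sup>2) * ennreal M"
    using integral_G_sq_le E_flux by (intro mult_mono) (auto simp: intW s_sq)
  finally have "ennreal (n6\<^sup>2) \<le> ennreal (M ^ 3)"
    by (simp add: ennreal_power n6_nonneg power3_eq_cube power2_eq_square M_nonneg flip: ennreal_mult)
  then show ?thesis by (simp add: M_nonneg)
qed

text \<open>Inserting \<open>M_sq\<close> into the sixth power of M leaves \<open>n6\<close>^4 \<le>
  (16 \<open>n6\<close> K)^3, from which \<open>n6\<close>^3 cancels; 4096 is 16^3. The 256 in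
  \<open>M_le\<close> is then the root of 16 * 4096.\<close>

lemma n6_le: "n6 \<le> 4096 * K ^ 3"
proof (cases "n6 = 0")
  case False
  then have pos: "0 < n6" using n6_nonneg by simp
  have "n6 ^ 4 = (n6\<^sup>2)\<^sup>2" by simp
  also have "\<dots> \<le> (M ^ 3)\<^sup>2" by (intro power_mono n6_sq_le) auto
  also have "\<dots> = (M\<^sup>2) ^ 3" by (simp flip: power_mult)
  also have "\<dots> = n6 ^ 3 * (4096 * K ^ 3)" unfolding M_sq by (simp add: power_mult_distrib)
  finally have "n6 ^ 3 * n6 \<le> n6 ^ 3 * (4096 * K ^ 3)" by (simp add: power_Suc2 flip: power_Suc2)
  then show ?thesis using pos by simp
qed (simp add: K_pos)

lemma M_le: "M \<le> 256 * K\<^sup>2"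
proof (rule power2_le_imp_le)
  have "M\<^sup>2 \<le> 16 * (4096 * K ^ 3) * K"
    unfolding M_sq by (intro mult_right_mono mult_left_mono n6_le K_pos) auto
  then show "M\<^sup>2 \<le> (256 * K\<^sup>2)\<^sup>2" by (simp add: power_mult_distrib power3_eq_cube power2_eq_square)
qed simp

section \<open>Consequences that depend on the energy alone\<close>

lemma L6_bound: "(\<integral>\<^sup>+w. ennreal ((g w)^6) \<partial>cyl) \<le> ennreal (4096 * K ^ 3)"
  unfolding n6 by (intro ennreal_leI n6_le)

lemma slice_L4_bound: "ennreal r * (\<integral>\<^sup>+z. ennreal (g (r, z) ^ 4) \<partial>lborel) \<le> ennreal (256 * K\<^sup>2)"
  using weighted_G_le[of r] ennreal_leI[OF M_le] unfolding G_def by (rule order_trans)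

text \<open>The increment is the integral of \<open>g1\<close> over the rectangle \<open>B\<close>.
  Cauchy-Schwarz for plane Lebesgue measure produces the area of \<open>B\<close>, and since r \<le>
  \<rho> on \<open>B\<close> the prefactor r is absorbed by the cylindrical density.\<close>

lemma slice_Hoelder:
  assumes "0 < r" "r \<le> r'" "a \<le> b"
  shows "ennreal r * (\<integral>\<^sup>+z. indicator {a..b} z * ennreal \<bar>g (r', z) - g (r, z)\<bar> \<partial>lborel)\<^sup>2
     \<le> ennreal ((b - a) * (r' - r) * K)"
proof -
  define B where "B = {r..r'} \<times> {a..b}"
  have [measurable]: "B \<in> sets borel" unfolding B_def by (intro borel_closed closed_Times) auto
  have B_eq: "indicator B (x, y) = (indicator {r..r'} x * indicator {a..b} y :: ennreal)" for x y
    by (auto simp: B_def split: split_indicator)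
  have emB: "emeasure lborel B = ennreal ((b - a) * (r' - r))"
    unfolding B_def using assms by (simp add: lborel.emeasure_pair_measure_Times ennreal_mult[symmetric] mult.commute flip: lborel_prod)
  have "(\<integral>\<^sup>+z. indicator {a..b} z * ennreal \<bar>g (r', z) - g (r, z)\<bar> \<partial>lborel)
     \<le> (\<integral>\<^sup>+z. indicator {a..b} z * (\<integral>\<^sup>+\<rho>. indicator {r..r'} \<rho> * ennreal \<bar>g1 (\<rho>, z)\<bar> \<partial>lborel) \<partial>lborel)"
    by (intro nn_integral_mono mult_left_mono ennreal_diff_le_nn_integral_deriv)
      (auto intro!: assms deriv_r cont_slices)
  also have "\<dots> = (\<integral>\<^sup>+z. \<integral>\<^sup>+\<rho>. indicator B (\<rho>, z) * ennreal \<bar>g1 (\<rho>, z)\<bar> \<partial>lborel \<partial>lborel)"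
    by (intro nn_integral_cong, subst nn_integral_cmult[symmetric]) (auto simp: B_eq mult_ac)
  also have "\<dots> = (\<integral>\<^sup>+\<rho>. \<integral>\<^sup>+z. indicator B (\<rho>, z) * ennreal \<bar>g1 (\<rho>, z)\<bar> \<partial>lborel \<partial>lborel)"
    by (rule nn_integral_lborel_swap) measurable
  \<comment> \<open>The indicator is written twice so that Cauchy-Schwarz leaves one copy to measure
    \<open>B\<close> and the other to localise \<open>g1\<close>.\<close>
  also have "\<dots> = (\<integral>\<^sup>+w. indicator B w * (indicator B w * ennreal \<bar>g1 w\<bar>) \<partial>lborel)"
    by (subst nn_integral_lborel_pair) (auto intro!: nn_integral_cong split: split_indicator)
  finally have "(\<integral>\<^sup>+z. indicator {a..b} z * ennreal \<bar>g (r', z) - g (r, z)\<bar> \<partial>lborel)\<^sup>2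
     \<le> (\<integral>\<^sup>+w. indicator B w * (indicator B w * ennreal \<bar>g1 w\<bar>) \<partial>lborel)\<^sup>2"
    by (rule power_mono) auto
  also have "\<dots> \<le> (\<integral>\<^sup>+w. (indicator B w)\<^sup>2 \<partial>lborel) * (\<integral>\<^sup>+w. (indicator B w * ennreal \<bar>g1 w\<bar>)\<^sup>2 \<partial>lborel)"
    by (rule Cauchy_Schwarz_nn_integral) auto
  also have "(\<integral>\<^sup>+w. (indicator B w)\<^sup>2 \<partial>lborel) = (\<integral>\<^sup>+w. indicator B w \<partial>lborel)"
    by (intro nn_integral_cong) (auto split: split_indicator)
  also have "\<dots> = ennreal ((b - a) * (r' - r))" by (simp add: emB)
  finally have "ennreal r * (\<integral>\<^sup>+z. indicator {a..b} z * ennreal \<bar>g (r', z) - g (r, z)\<bar> \<partial>lborel)\<^sup>2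
     \<le> ennreal r * (ennreal ((b - a) * (r' - r)) * (\<integral>\<^sup>+w. (indicator B w * ennreal \<bar>g1 w\<bar>)\<^sup>2 \<partial>lborel))"
    by (rule mult_left_mono) auto
  also have "\<dots> = ennreal ((b - a) * (r' - r)) * (\<integral>\<^sup>+w. ennreal r * (indicator B w * ennreal \<bar>g1 w\<bar>)\<^sup>2 \<partial>lborel)"
    by (subst nn_integral_cmult) (auto simp: mult_ac)
  also have "\<dots> \<le> ennreal ((b - a) * (r' - r)) * (\<integral>\<^sup>+w. ennreal (fst w) * ennreal ((g1 w)\<^sup>2) \<partial>lborel)"
    by (intro mult_left_mono nn_integral_mono)
      (auto simp: B_def ennreal_power split: split_indicator intro!: mult_right_mono ennreal_leI)
  also have "(\<integral>\<^sup>+w. ennreal (fst w) * ennreal ((g1 w)\<^sup>2) \<partial>lborel) = (\<integral>\<^sup>+w. ennreal ((g1 w)\<^sup>2) \<partial>cyl)"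
    unfolding cyl_def by (rule nn_integral_density[symmetric]) auto
  also have "ennreal ((b - a) * (r' - r)) * \<dots> \<le> ennreal ((b - a) * (r' - r)) * ennreal K"
    by (intro mult_left_mono energy_r) auto
  finally show ?thesis using assms K_pos by (simp add: ennreal_mult)
qed

text \<open>Pointwise, the squared increment is at most h times the integral of \<open>g2\<close>^2
  over an interval of length h; integrating over z and using translation invariance yields a second
  factor h. In \<open>profile_tail\<close> this converts a drop in the z direction into smallness of
  a level set.\<close>

lemma translation_z:
  assumes "0 < h"
  shows "(\<integral>\<^sup>+(r, z). ennreal ((g (r, z + h) - g (r, z))\<^sup>2) \<partial>cyl) \<le> ennreal (h\<^sup>2 * K)"
proof -
  have pt: "ennreal ((g (r, z + h) - g (r, z))\<^sup>2)
      \<le> ennreal h * (\<integral>\<^sup>+s. indicator {0..h} s * ennreal ((g2 (r, z + s))\<^sup>2) \<partial>lborel)" for r z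
  proof -
    have "ennreal \<bar>g (r, z + h) - g (r, z + 0)\<bar> \<le> (\<integral>\<^sup>+s. indicator {0..h} s * ennreal \<bar>g2 (r, z + s)\<bar> \<partial>lborel)"
    proof (rule ennreal_diff_le_nn_integral_deriv)
      show "((\<lambda>s. g (r, z + s)) has_real_derivative g2 (r, z + s)) (at s)" for s
        using DERIV_shift[of "\<lambda>y. g (r, y)" "g2 (r, z + s)" s z] deriv_z[of r "z + s"]
        by (simp add: add.commute)
      show "continuous_on UNIV (\<lambda>s. g2 (r, z + s))"
        by (intro continuous_on_compose2[OF cont_slices(4)] continuous_intros) auto
    qed (use assms in auto)
    also have "\<dots> = (\<integral>\<^sup>+s. indicator {0..h} s * (indicator {0..h} s * ennreal \<bar>g2 (r, z + s)\<bar>) \<partial>lborel)"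
      by (intro nn_integral_cong) (auto split: split_indicator)
    finally have "(ennreal \<bar>g (r, z + h) - g (r, z)\<bar>)\<^sup>2 \<le>
       (\<integral>\<^sup>+s. indicator {0..h} s * (indicator {0..h} s * ennreal \<bar>g2 (r, z + s)\<bar>) \<partial>lborel)\<^sup>2"
      by (intro power_mono) auto
    also have "\<dots> \<le> (\<integral>\<^sup>+s. (indicator {0..h} s)\<^sup>2 \<partial>lborel) * (\<integral>\<^sup>+s. (indicator {0..h} s * ennreal \<bar>g2 (r, z + s)\<bar>)\<^sup>2 \<partial>lborel)"
      by (rule Cauchy_Schwarz_nn_integral) auto
    also have "(\<integral>\<^sup>+s. (indicator {0..h} s)\<^sup>2 \<partial>lborel) = (\<integral>\<^sup>+s. indicator {0..h} s \<partial>lborel)"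
      by (intro nn_integral_cong) (auto split: split_indicator)
    also have "\<dots> = ennreal h" using assms by simp
    also have "(\<integral>\<^sup>+s. (indicator {0..h} s * ennreal \<bar>g2 (r, z + s)\<bar>)\<^sup>2 \<partial>lborel) =
        (\<integral>\<^sup>+s. indicator {0..h} s * ennreal ((g2 (r, z + s))\<^sup>2) \<partial>lborel)"
      by (intro nn_integral_cong) (auto simp: ennreal_power split: split_indicator)
    finally show ?thesis by (simp add: ennreal_power)
  qed
  have "(\<integral>\<^sup>+(r, z). ennreal ((g (r, z + h) - g (r, z))\<^sup>2) \<partial>cyl)
     \<le> (\<integral>\<^sup>+(r, z). ennreal h * (\<integral>\<^sup>+s. indicator {0..h} s * ennreal ((g2 (r, z + s))\<^sup>2) \<partial>lborel) \<partial>cyl)"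
    by (intro nn_integral_mono) (auto simp: pt)
  also have "\<dots> = ennreal h * (\<integral>\<^sup>+(r, z). (\<integral>\<^sup>+s. indicator {0..h} s * ennreal ((g2 (r, z + s))\<^sup>2) \<partial>lborel) \<partial>cyl)"
    by (simp add: split_beta' nn_integral_cmult)
  also have "\<dots> = ennreal h * (\<integral>\<^sup>+r. ennreal r * (\<integral>\<^sup>+z. \<integral>\<^sup>+s. indicator {0..h} s * ennreal ((g2 (r, z + s))\<^sup>2) \<partial>lborel \<partial>lborel) \<partial>lborel)"
    by (subst nn_integral_cyl) auto
  also have "\<dots> = ennreal h * (\<integral>\<^sup>+r. ennreal r * (ennreal h * (\<integral>\<^sup>+z. ennreal ((g2 (r, z))\<^sup>2) \<partial>lborel)) \<partial>lborel)"
  proof (intro arg_cong2[where f = "(*)"] refl nn_integral_cong)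
    fix r :: real
    have "(\<integral>\<^sup>+z. \<integral>\<^sup>+s. indicator {0..h} s * ennreal ((g2 (r, z + s))\<^sup>2) \<partial>lborel \<partial>lborel)
        = (\<integral>\<^sup>+s. \<integral>\<^sup>+z. indicator {0..h} s * ennreal ((g2 (r, z + s))\<^sup>2) \<partial>lborel \<partial>lborel)"
      by (rule nn_integral_lborel_swap) measurable
    also have "\<dots> = (\<integral>\<^sup>+s. (\<integral>\<^sup>+z. ennreal ((g2 (r, z))\<^sup>2) \<partial>lborel) * indicator {0..h} s \<partial>lborel)"
    proof (rule nn_integral_cong)
      fix s :: real
      have "(\<integral>\<^sup>+z. ennreal ((g2 (r, z))\<^sup>2) \<partial>lborel) = (\<integral>\<^sup>+z. ennreal ((g2 (r, z + s))\<^sup>2) \<partial>lborel)"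
        by (subst nn_integral_real_affine[where c = 1 and t = s]) (auto simp: add.commute)
      then show "(\<integral>\<^sup>+z. indicator {0..h} s * ennreal ((g2 (r, z + s))\<^sup>2) \<partial>lborel)
          = (\<integral>\<^sup>+z. ennreal ((g2 (r, z))\<^sup>2) \<partial>lborel) * indicator {0..h} s"
        by (simp add: nn_integral_cmult mult.commute)
    qed
    also have "\<dots> = ennreal h * (\<integral>\<^sup>+z. ennreal ((g2 (r, z))\<^sup>2) \<partial>lborel)"
      using assms by (subst nn_integral_cmult_indicator) (auto simp: mult.commute)
    finally show "(\<integral>\<^sup>+z. \<integral>\<^sup>+s. indicator {0..h} s * ennreal ((g2 (r, z + s))\<^sup>2) \<partial>lborel \<partial>lborel)
        = ennreal h * (\<integral>\<^sup>+z. ennreal ((g2 (r, z))\<^sup>2) \<partial>lborel)" .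
  qed
  also have "\<dots> = ennreal h * (ennreal h * (\<integral>\<^sup>+w. ennreal ((g2 w)\<^sup>2) \<partial>cyl))"
  proof -
    have "(\<integral>\<^sup>+r. ennreal r * (ennreal h * (\<integral>\<^sup>+z. ennreal ((g2 (r, z))\<^sup>2) \<partial>lborel)) \<partial>lborel)
        = (\<integral>\<^sup>+r. ennreal h * (ennreal r * (\<integral>\<^sup>+z. ennreal ((g2 (r, z))\<^sup>2) \<partial>lborel)) \<partial>lborel)"
      by (rule nn_integral_cong) (rule mult.left_commute)
    also have "\<dots> = ennreal h * (\<integral>\<^sup>+w. ennreal ((g2 w)\<^sup>2) \<partial>cyl)"
      by (subst nn_integral_cyl, measurable, rule nn_integral_cmult) measurable
    finally show ?thesis by (rule arg_cong)
  qed
  also have "\<dots> \<le> ennreal h * (ennreal h * ennreal K)"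
    by (intro mult_left_mono energy_z) auto
  finally show ?thesis using assms K_pos by (simp add: ennreal_mult power2_eq_square mult.assoc)
qed

end

subsection \<open>Profiles of cylindrically symmetric functions\<close>

lemma abs_le_add_power_div:
  fixes x l :: real
  assumes "0 < l"
  shows "\<bar>x\<bar> \<le> l + \<bar>x\<bar> ^ Suc n / l ^ n"
proof (cases "\<bar>x\<bar> \<le> l")
  case False
  then have "\<bar>x\<bar> * l ^ n \<le> \<bar>x\<bar> * \<bar>x\<bar> ^ n"
    using assms by (intro mult_left_mono power_mono) auto
  then have "\<bar>x\<bar> \<le> \<bar>x\<bar> ^ Suc n / l ^ n"
    using assms by (simp add: pos_le_divide_eq)
  then show ?thesis using assms by linarith
qed (use assms in \<open>simp add: add_increasing2\<close>)

text \<open>A substitute for Hoelder's inequality with a free level l. It is applied to fourth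
  powers (n = 3), which the slice bound controls, and to sixth powers (n = 5), in which the
  approximation takes place; a small l makes the first summand small.\<close>

lemma nn_integral_interval_le:
  fixes f :: "real \<Rightarrow> real"
  assumes [measurable]: "f \<in> borel_measurable borel" and "0 < l" "a \<le> b"
  shows "(\<integral>\<^sup>+z. indicator {a..b} z * ennreal \<bar>f z\<bar> \<partial>lborel)
    \<le> ennreal (l * (b - a)) + ennreal (1 / l ^ n) * (\<integral>\<^sup>+z. ennreal (\<bar>f z\<bar> ^ Suc n) \<partial>lborel)"
proof -
  have "(\<integral>\<^sup>+z. indicator {a..b} z * ennreal \<bar>f z\<bar> \<partial>lborel)
     \<le> (\<integral>\<^sup>+z. ennreal l * indicator {a..b} z + ennreal (1 / l ^ n) * ennreal (\<bar>f z\<bar> ^ Suc n) \<partial>lborel)"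
  proof (rule nn_integral_mono)
    fix z
    have "ennreal \<bar>f z\<bar> \<le> ennreal (l + 1 / l ^ n * \<bar>f z\<bar> ^ Suc n)"
      using abs_le_add_power_div[OF \<open>0 < l\<close>, of "f z" n] by (intro ennreal_leI) simp
    also have "\<dots> = ennreal l + ennreal (1 / l ^ n) * ennreal (\<bar>f z\<bar> ^ Suc n)"
      using \<open>0 < l\<close> by (subst ennreal_mult[symmetric]) auto
    finally show "indicator {a..b} z * ennreal \<bar>f z\<bar> \<le>
        ennreal l * indicator {a..b} z + ennreal (1 / l ^ n) * ennreal (\<bar>f z\<bar> ^ Suc n)"
      by (auto split: split_indicator)
  qed
  also have "\<dots> = ennreal (l * (b - a)) + ennreal (1 / l ^ n) * (\<integral>\<^sup>+z. ennreal (\<bar>f z\<bar> ^ Suc n) \<partial>lborel)"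
    using assms by (subst nn_integral_add) (auto simp: nn_integral_cmult nn_integral_cmult_indicator ennreal_mult)
  finally show ?thesis .
qed

lemma power6_add_le: "(x + y) ^ 6 \<le> 64 * (x ^ 6 + y ^ 6)" for x y :: real
proof -
  have "\<bar>x + y\<bar> \<le> 2 * max \<bar>x\<bar> \<bar>y\<bar>" by linarith
  then have "\<bar>x + y\<bar> ^ 6 \<le> (2 * max \<bar>x\<bar> \<bar>y\<bar>) ^ 6" by (intro power_mono) auto
  also have "\<dots> \<le> 64 * (x ^ 6 + y ^ 6)"
    by (auto simp: max_def power_mult_distrib)
  finally show ?thesis by simp
qed

text \<open>The L6 closure of half plane test functions with the common energy bound K, so that
  derivatives are only ever taken of smooth functions. The approximants carry no
  monotonicity.\<close>

definition profile :: "real \<Rightarrow> (real \<times> real \<Rightarrow> real) \<Rightarrow> bool" where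
  "profile K \<gamma> \<longleftrightarrow> \<gamma> \<in> borel_measurable borel \<and>
     (\<forall>e>0. \<exists>g g1 g2 L. half_plane_test g g1 g2 L K \<and>
        (\<integral>\<^sup>+w. ennreal ((g w - \<gamma> w) ^ 6) \<partial>cyl) \<le> ennreal e)"

lemma profile_measurable: "profile K \<gamma> \<Longrightarrow> \<gamma> \<in> borel_measurable borel"
  by (simp add: profile_def)

text \<open>A single approximant at error e = 1 gives the bound: 64 is the constant of
  \<open>power6_add_le\<close>, and the summand 1 is that error.\<close>

lemma profile_L6:
  assumes "profile K \<gamma>"
  shows "(\<integral>\<^sup>+w. ennreal ((\<gamma> w) ^ 6) \<partial>cyl) \<le> ennreal (64 * (4096 * K ^ 3 + 1))"
proof -
  note [measurable] = profile_measurable[OF assms]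
  obtain g g1 g2 L where "half_plane_test g g1 g2 L K"
    and le: "(\<integral>\<^sup>+w. ennreal ((g w - \<gamma> w) ^ 6) \<partial>cyl) \<le> ennreal 1"
    using assms unfolding profile_def by (metis zero_less_one)
  interpret half_plane_test g g1 g2 L K by fact
  have "(\<integral>\<^sup>+w. ennreal ((\<gamma> w) ^ 6) \<partial>cyl)
      \<le> (\<integral>\<^sup>+w. ennreal 64 * (ennreal ((g w) ^ 6) + ennreal ((g w - \<gamma> w) ^ 6)) \<partial>cyl)"
  proof (rule nn_integral_mono)
    fix w
    have "ennreal ((\<gamma> w) ^ 6) \<le> ennreal (64 * ((g w) ^ 6 + (g w - \<gamma> w) ^ 6))"
      using power6_add_le[of "g w" "\<gamma> w - g w"] power_minus_even[of 6 "g w - \<gamma> w"]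
      by (intro ennreal_leI) simp
    then show "ennreal ((\<gamma> w) ^ 6) \<le> ennreal 64 * (ennreal ((g w) ^ 6) + ennreal ((g w - \<gamma> w) ^ 6))"
      by (subst (asm) ennreal_mult) auto
  qed
  also have "\<dots> = ennreal 64 * ((\<integral>\<^sup>+w. ennreal ((g w) ^ 6) \<partial>cyl) + (\<integral>\<^sup>+w. ennreal ((g w - \<gamma> w) ^ 6) \<partial>cyl))"
    by (simp add: nn_integral_cmult nn_integral_add)
  also have "\<dots> \<le> ennreal 64 * (ennreal (4096 * K ^ 3) + ennreal 1)"
    by (intro mult_left_mono add_mono L6_bound le) auto
  also have "\<dots> = ennreal (64 * (4096 * K ^ 3 + 1))"
    using K_pos by (subst ennreal_mult) auto
  finally show ?thesis .
qed

lemma ennreal_le_of_tendsto_0: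
  fixes X Y :: ennreal
  assumes "\<And>n. X \<le> Y + e n" "e \<longlonglongrightarrow> 0"
  shows "X \<le> Y"
proof (rule LIMSEQ_le_const)
  have "(\<lambda>n. Y + e n) \<longlonglongrightarrow> Y + 0" by (intro tendsto_add tendsto_const assms(2))
  then show "(\<lambda>n. Y + e n) \<longlonglongrightarrow> Y" by simp
qed (use assms(1) in auto)

text \<open>\<open>S\<close> collects the radii at which the approximants converge to \<gamma> in L6
  of the slice. Convergence in L1 of every bounded interval follows, and under it the slice bound
  and the Hoelder estimate pass to the limit. The latter compares two slices, so both radii must lie
  in \<open>S\<close>.\<close>

lemma profile_regular_slices:
  assumes "profile K \<gamma>"
  obtains S where "AE r in lborel. 0 < r \<longrightarrow> r \<in> S" "S \<subseteq> {0<..}"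
    and "\<And>r a b l. r \<in> S \<Longrightarrow> a \<le> b \<Longrightarrow> 0 < l \<Longrightarrow>
      (\<integral>\<^sup>+z. indicator {a..b} z * ennreal \<bar>\<gamma> (r, z)\<bar> \<partial>lborel) \<le> ennreal (l * (b - a) + 256 * K\<^sup>2 / (r * l ^ 3))"
    and "\<And>r r' a b. r \<in> S \<Longrightarrow> r' \<in> S \<Longrightarrow> r \<le> r' \<Longrightarrow> a \<le> b \<Longrightarrow>
      (\<integral>\<^sup>+z. indicator {a..b} z * ennreal \<bar>\<gamma> (r', z) - \<gamma> (r, z)\<bar> \<partial>lborel)
        \<le> ennreal (sqrt ((b - a) * (r' - r) * K / r))"
proof -
  note [measurable] = profile_measurable[OF assms]
  \<comment> \<open>Summable errors make the series of slice errors finite for almost every r > 0,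
    hence the slice errors tend to 0 along the whole sequence.\<close>
  have "\<forall>n. \<exists>g. (\<exists>g1 g2 L. half_plane_test g g1 g2 L K) \<and>
        (\<integral>\<^sup>+w. ennreal ((g w - \<gamma> w) ^ 6) \<partial>cyl) \<le> ennreal ((1/2) ^ n)"
    using assms unfolding profile_def by (metis zero_less_power half_gt_zero zero_less_one)
  then obtain g where test: "\<And>n. \<exists>g1 g2 L. half_plane_test (g n) g1 g2 L K"
    and le: "\<And>n. (\<integral>\<^sup>+w. ennreal ((g n w - \<gamma> w) ^ 6) \<partial>cyl) \<le> ennreal ((1/2) ^ n)"
    by metis
  have K_pos: "0 \<le> K" using test[of 0] by (auto simp: half_plane_test_def)
  have [measurable]: "g n \<in> borel_measurable borel" for n
    using test[of n] half_plane_test.g_measurable by blast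
  define I where "I n r = (\<integral>\<^sup>+z. ennreal ((g n (r, z) - \<gamma> (r, z)) ^ 6) \<partial>lborel)" for n r
  have [measurable]: "I n \<in> borel_measurable borel" for n unfolding I_def[abs_def] by measurable
  define S where "S = {r. 0 < r \<and> (\<lambda>n. I n r) \<longlonglongrightarrow> 0}"
  have "(\<integral>\<^sup>+r. (\<Sum>n. ennreal r * I n r) \<partial>lborel) = (\<Sum>n. \<integral>\<^sup>+r. ennreal r * I n r \<partial>lborel)"
    by (rule nn_integral_suminf) measurable
  also have "\<dots> \<le> (\<Sum>n. ennreal ((1/2) ^ n))"
  proof (rule suminf_le)
    show "(\<integral>\<^sup>+r. ennreal r * I n r \<partial>lborel) \<le> ennreal ((1/2) ^ n)" for n
      using le[of n] unfolding I_def by (subst (asm) nn_integral_cyl) auto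
  qed auto
  also have "\<dots> < \<infinity>"
    by (subst suminf_ennreal2) auto
  finally have "(\<integral>\<^sup>+r. (\<Sum>n. ennreal r * I n r) \<partial>lborel) \<noteq> \<infinity>" by simp
  then have "AE r in lborel. (\<Sum>n. ennreal r * I n r) \<noteq> \<infinity>"
    by (intro nn_integral_PInf_AE) auto
  then have S1: "AE r in lborel. 0 < r \<longrightarrow> r \<in> S"
  proof eventually_elim
    case (elim r)
    show ?case
    proof
      assume "0 < r"
      have fin: "ennreal r * I n r \<noteq> \<infinity>" for n
      proof
        assume "ennreal r * I n r = \<infinity>"
        moreover have "ennreal r * I n r \<le> (\<Sum>n. ennreal r * I n r)"
          using sum_le_suminf[of "\<lambda>n. ennreal r * I n r" "{n}"] by simp
        ultimately show False using elim by (simp add: top_unique)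
      qed
      then have fin': "I n r \<noteq> \<infinity>" for n
        using \<open>0 < r\<close> by (metis ennreal_mult_eq_top_iff ennreal_eq_0_iff infinity_ennreal_def not_le)
      have eq: "ennreal r * I n r = ennreal (r * enn2real (I n r))" for n
        using \<open>0 < r\<close> fin'[of n] by (simp add: ennreal_mult' less_top)
      have "summable (\<lambda>n. r * enn2real (I n r))"
        using elim \<open>0 < r\<close> by (intro summable_suminf_not_top) (auto simp: eq)
      then have "(\<lambda>n. r * enn2real (I n r)) \<longlonglongrightarrow> 0" by (rule summable_LIMSEQ_zero)
      then have "(\<lambda>n. (1 / r) * (r * enn2real (I n r))) \<longlonglongrightarrow> 0" by (rule tendsto_mult_right_zero)
      then have "(\<lambda>n. ennreal (enn2real (I n r))) \<longlonglongrightarrow> ennreal 0"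
        using \<open>0 < r\<close> by (intro tendsto_ennrealI) simp
      then show "r \<in> S" using \<open>0 < r\<close> fin' by (simp add: S_def less_top)
    qed
  qed
  have J: "(\<lambda>n. \<integral>\<^sup>+z. indicator {a..b} z * ennreal \<bar>g n (r, z) - \<gamma> (r, z)\<bar> \<partial>lborel) \<longlonglongrightarrow> 0"
    if "r \<in> S" "a \<le> b" for r a b :: real
  proof (rule order_tendstoI)
    fix u :: ennreal assume "0 < u"
    \<comment> \<open>The minimum with 1 covers \<open>u = \<infinity>\<close>; in every case c is a
      positive real with \<open>ennreal c < u\<close>.\<close>
    define c where "c = enn2real (min u 1) / 2"
    have fin: "min u 1 < top" by (simp add: min_less_iff_disj)
    then have c: "0 < c" using \<open>0 < u\<close> by (simp add: c_def enn2real_positive_iff)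
    then have "ennreal c < ennreal (enn2real (min u 1))" by (intro ennreal_lessI) (auto simp: c_def)
    also have "\<dots> \<le> u" using fin by simp
    finally have cu: "ennreal c < u" .
    \<comment> \<open>Makes l (b - a) at most c / 2; the summand 1 covers a = b.\<close>
    define l where "l = c / (2 * (b - a + 1))"
    have l: "0 < l" using c that by (simp add: l_def)
    have "l * (b - a) \<le> c / 2" using c that by (simp add: l_def field_simps)
    then have lb: "ennreal (l * (b - a)) \<le> ennreal (c / 2)" by (rule ennreal_leI)
    have "(\<lambda>n. ennreal (1 / l ^ 5) * I n r) \<longlonglongrightarrow> ennreal (1 / l ^ 5) * 0"
      using that unfolding S_def by (intro ennreal_tendsto_cmult) auto
    then have "\<forall>\<^sub>F n in sequentially. ennreal (1 / l ^ 5) * I n r < ennreal (c / 2)"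
      using c by (intro order_tendstoD(2)) auto
    then show "\<forall>\<^sub>F n in sequentially. (\<integral>\<^sup>+z. indicator {a..b} z * ennreal \<bar>g n (r, z) - \<gamma> (r, z)\<bar> \<partial>lborel) < u"
    proof eventually_elim
      case (elim n)
      have "(\<integral>\<^sup>+z. indicator {a..b} z * ennreal \<bar>g n (r, z) - \<gamma> (r, z)\<bar> \<partial>lborel)
         \<le> ennreal (l * (b - a)) + ennreal (1 / l ^ 5) * I n r"
        using nn_integral_interval_le[of "\<lambda>z. g n (r, z) - \<gamma> (r, z)" l a b 5] that l
        by (simp add: I_def)
      also have "\<dots> \<le> ennreal (c / 2) + ennreal (c / 2)"
        by (intro add_mono lb less_imp_le elim)
      also have "\<dots> = ennreal c" using c by (subst ennreal_plus[symmetric]) auto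
      finally show ?case using cu by simp
    qed
  qed auto
  show thesis
  proof (rule that[OF S1])
    show "S \<subseteq> {0<..}" by (auto simp: S_def)
  next
    fix r a b l :: real assume A: "r \<in> S" "a \<le> b" "0 < l"
    then have "0 < r" by (simp add: S_def)
    show "(\<integral>\<^sup>+z. indicator {a..b} z * ennreal \<bar>\<gamma> (r, z)\<bar> \<partial>lborel) \<le> ennreal (l * (b - a) + 256 * K\<^sup>2 / (r * l ^ 3))"
    proof (rule ennreal_le_of_tendsto_0[OF _ J[OF A(1,2)]])
      fix n
      obtain g1 g2 L where "half_plane_test (g n) g1 g2 L K" using test by blast
      then interpret half_plane_test "g n" g1 g2 L K .
      have "ennreal r * (\<integral>\<^sup>+z. ennreal (g n (r, z) ^ 4) \<partial>lborel) \<le> ennreal (256 * K\<^sup>2)"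
        by (rule slice_L4_bound)
      then have "ennreal (1 / (r * l ^ 3)) * (ennreal r * (\<integral>\<^sup>+z. ennreal (g n (r, z) ^ 4) \<partial>lborel))
          \<le> ennreal (1 / (r * l ^ 3)) * ennreal (256 * K\<^sup>2)"
        by (rule mult_left_mono) auto
      then have L4: "ennreal (1 / l ^ 3) * (\<integral>\<^sup>+z. ennreal (g n (r, z) ^ 4) \<partial>lborel) \<le> ennreal (256 * K\<^sup>2 / (r * l ^ 3))"
        using \<open>0 < r\<close> \<open>0 < l\<close> by (simp add: mult.assoc[symmetric] ennreal_mult[symmetric])
      have "(\<integral>\<^sup>+z. indicator {a..b} z * ennreal \<bar>\<gamma> (r, z)\<bar> \<partial>lborel)
         \<le> (\<integral>\<^sup>+z. indicator {a..b} z * ennreal \<bar>g n (r, z)\<bar> + indicator {a..b} z * ennreal \<bar>g n (r, z) - \<gamma> (r, z)\<bar> \<partial>lborel)"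
        by (intro nn_integral_mono) (auto split: split_indicator simp flip: ennreal_plus intro!: ennreal_leI)
      also have "\<dots> = (\<integral>\<^sup>+z. indicator {a..b} z * ennreal \<bar>g n (r, z)\<bar> \<partial>lborel)
           + (\<integral>\<^sup>+z. indicator {a..b} z * ennreal \<bar>g n (r, z) - \<gamma> (r, z)\<bar> \<partial>lborel)"
        by (rule nn_integral_add) auto
      also have "(\<integral>\<^sup>+z. indicator {a..b} z * ennreal \<bar>g n (r, z)\<bar> \<partial>lborel)
         \<le> ennreal (l * (b - a)) + ennreal (1 / l ^ 3) * (\<integral>\<^sup>+z. ennreal (g n (r, z) ^ 4) \<partial>lborel)"
        using nn_integral_interval_le[of "\<lambda>z. g n (r, z)" l a b 3] A by simp
      also have "\<dots> \<le> ennreal (l * (b - a)) + ennreal (256 * K\<^sup>2 / (r * l ^ 3))"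
        by (intro add_left_mono L4)
      also have "\<dots> = ennreal (l * (b - a) + 256 * K\<^sup>2 / (r * l ^ 3))"
        using A \<open>0 < r\<close> by (intro ennreal_plus[symmetric]) auto
      finally show "(\<integral>\<^sup>+z. indicator {a..b} z * ennreal \<bar>\<gamma> (r, z)\<bar> \<partial>lborel)
         \<le> ennreal (l * (b - a) + 256 * K\<^sup>2 / (r * l ^ 3)) + (\<integral>\<^sup>+z. indicator {a..b} z * ennreal \<bar>g n (r, z) - \<gamma> (r, z)\<bar> \<partial>lborel)"
        by (simp add: add_right_mono)
    qed
  next
    fix r r' a b :: real assume A: "r \<in> S" "r' \<in> S" "r \<le> r'" "a \<le> b"
    then have "0 < r" by (simp add: S_def)
    define J where "J n \<rho> = (\<integral>\<^sup>+z. indicator {a..b} z * ennreal \<bar>g n (\<rho>, z) - \<gamma> (\<rho>, z)\<bar> \<partial>lborel)" for n \<rho>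
    have "(\<lambda>n. J n r + J n r') \<longlonglongrightarrow> 0 + 0"
      unfolding J_def by (intro tendsto_add J A)
    then have lim: "(\<lambda>n. J n r + J n r') \<longlonglongrightarrow> 0" by simp
    show "(\<integral>\<^sup>+z. indicator {a..b} z * ennreal \<bar>\<gamma> (r', z) - \<gamma> (r, z)\<bar> \<partial>lborel)
        \<le> ennreal (sqrt ((b - a) * (r' - r) * K / r))"
    proof (rule ennreal_le_of_tendsto_0[OF _ lim])
      fix n
      obtain g1 g2 L where "half_plane_test (g n) g1 g2 L K" using test by blast
      then interpret half_plane_test "g n" g1 g2 L K .
      define X where "X = (\<integral>\<^sup>+z. indicator {a..b} z * ennreal \<bar>g n (r', z) - g n (r, z)\<bar> \<partial>lborel)"
      have nonneg: "0 \<le> (b - a) * (r' - r) * K / r" using A \<open>0 < r\<close> K_pos by simp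
      have "ennreal (1 / r) * (ennreal r * X\<^sup>2) \<le> ennreal (1 / r) * ennreal ((b - a) * (r' - r) * K)"
        unfolding X_def by (intro mult_left_mono slice_Hoelder A \<open>0 < r\<close>) auto
      then have "X\<^sup>2 \<le> ennreal ((sqrt ((b - a) * (r' - r) * K / r))\<^sup>2)"
        using \<open>0 < r\<close> nonneg by (simp add: mult.assoc[symmetric] ennreal_mult'[symmetric])
      then have X: "X \<le> ennreal (sqrt ((b - a) * (r' - r) * K / r))"
        by (rule ennreal_le_of_power2_le) (simp add: nonneg)
      have "(\<integral>\<^sup>+z. indicator {a..b} z * ennreal \<bar>\<gamma> (r', z) - \<gamma> (r, z)\<bar> \<partial>lborel)
         \<le> (\<integral>\<^sup>+z. indicator {a..b} z * ennreal \<bar>g n (r', z) - g n (r, z)\<bar> +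
              (indicator {a..b} z * ennreal \<bar>g n (r, z) - \<gamma> (r, z)\<bar> + indicator {a..b} z * ennreal \<bar>g n (r', z) - \<gamma> (r', z)\<bar>) \<partial>lborel)"
        by (intro nn_integral_mono) (auto split: split_indicator simp flip: ennreal_plus intro!: ennreal_leI)
      also have "\<dots> = X + (J n r + J n r')"
        unfolding X_def J_def by (simp add: nn_integral_add)
      also have "\<dots> \<le> ennreal (sqrt ((b - a) * (r' - r) * K / r)) + (J n r + J n r')"
        by (intro add_right_mono X)
      finally show "(\<integral>\<^sup>+z. indicator {a..b} z * ennreal \<bar>\<gamma> (r', z) - \<gamma> (r, z)\<bar> \<partial>lborel)
         \<le> ennreal (sqrt ((b - a) * (r' - r) * K / r)) + (J n r + J n r')" .
    qed
  qed
qed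

text \<open>Monotonicity is required for positive arguments only: at 0 the layer-cake integral may
  be infinite, and \<open>enn2real\<close> then returns 0.\<close>

definition sym_decreasing :: "(real \<Rightarrow> real) \<Rightarrow> bool" where
  "sym_decreasing h \<longleftrightarrow> (\<forall>z. 0 \<le> h z \<and> h (- z) = h z) \<and> (\<forall>x y. 0 < x \<longrightarrow> x \<le> y \<longrightarrow> h y \<le> h x)"

lemma sym_decreasing_abs: "sym_decreasing h \<Longrightarrow> h \<bar>z\<bar> = h z"
  unfolding sym_decreasing_def by (cases "0 \<le> z") auto

text \<open>With y = |z|, monotonicity gives y h(y) \<le> the integral of h over (0, y). Taking l =
  e / 2 bounds this by e y / 2 + 8 M / (r e^3), and the last term is at most e y / 2 exactly when r
  y \<ge> 16 M / e^4.\<close>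

lemma sym_decreasing_decay:
  assumes h: "sym_decreasing h" and ae: "AE z in lborel. f z = h z" and "0 < r" "0 < e" "0 \<le> M"
    and int: "\<And>a b l. a \<le> b \<Longrightarrow> 0 < l \<Longrightarrow>
      (\<integral>\<^sup>+z. indicator {a..b} z * ennreal \<bar>f z\<bar> \<partial>lborel) \<le> ennreal (l * (b - a) + M / (r * l ^ 3))"
    and z: "z \<noteq> 0" "16 * M / e ^ 4 \<le> r * \<bar>z\<bar>"
  shows "h z \<le> e"
proof -
  define y where "y = \<bar>z\<bar>"
  have y: "0 < y" "16 * M / e ^ 4 \<le> r * y" using z by (auto simp: y_def)
  have "ennreal (h y * y) = (\<integral>\<^sup>+x. ennreal (h y) * indicator {0<..y} x \<partial>lborel)"
    using y h by (subst nn_integral_cmult_indicator) (auto simp: sym_decreasing_def ennreal_mult)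
  also have "\<dots> \<le> (\<integral>\<^sup>+x. indicator {0..y} x * ennreal \<bar>f x\<bar> \<partial>lborel)"
    using ae h by (intro nn_integral_mono_AE)
      (auto split: split_indicator simp: sym_decreasing_def intro!: ennreal_leI elim!: eventually_mono)
  also have "\<dots> \<le> ennreal (e / 2 * (y - 0) + M / (r * (e / 2) ^ 3))"
    by (rule int) (use y \<open>0 < e\<close> in auto)
  finally have "h y * y \<le> e / 2 * y + M / (r * (e / 2) ^ 3)"
    using y \<open>0 < e\<close> \<open>0 < r\<close> \<open>0 \<le> M\<close> by (subst (asm) ennreal_le_iff) auto
  also have "M / (r * (e / 2) ^ 3) = (16 * M / e ^ 4) * (e / (2 * r))"
    using \<open>0 < e\<close> \<open>0 < r\<close> by (simp add: field_simps power3_eq_cube power4_eq_xxxx)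
  also have "\<dots> \<le> (r * y) * (e / (2 * r))"
    by (rule mult_right_mono[OF y(2)]) (use \<open>0 < e\<close> \<open>0 < r\<close> in auto)
  also have "e / 2 * y + \<dots> = e * y" using \<open>0 < r\<close> by (simp add: field_simps)
  finally have "h y \<le> e" using y by simp
  then show ?thesis using sym_decreasing_abs[OF h, of z] by (simp add: y_def)
qed

subsection \<open>Compactness of decreasing profiles\<close>

text \<open>Helly's selection argument with averages over rational intervals in place of point
  values, since averages are what depends continuously on r. \<open>I\<close> stays abstract so that
  integrals of the profile itself can be inserted. Convergence fails at most at 0 and at the
  discontinuities, and their mirror images, of a monotone function.\<close>

lemma sym_decreasing_convergent:
  fixes h :: "nat \<Rightarrow> real \<Rightarrow> real" and I :: "nat \<Rightarrow> real \<Rightarrow> real \<Rightarrow> real"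
  assumes h: "\<And>n. sym_decreasing (h n)"
    and I: "\<And>n a b. 0 < a \<Longrightarrow> a < b \<Longrightarrow> (b - a) * h n b \<le> I n a b \<and> I n a b \<le> (b - a) * h n a"
    and conv: "\<And>a b. a \<in> \<rat> \<Longrightarrow> b \<in> \<rat> \<Longrightarrow> 0 < a \<Longrightarrow> a < b \<Longrightarrow> convergent (\<lambda>n. I n a b)"
  shows "countable {z. \<not> convergent (\<lambda>n. h n z)}"
proof -
  define P where "P z = {(a, b). a \<in> \<rat> \<and> b \<in> \<rat> \<and> 0 < a \<and> a < b \<and> b < z}" for z :: real
  define q where "q = (\<lambda>(a, b). lim (\<lambda>n. I n a b) / (b - a))"
  have q_lim: "(\<lambda>n. I n a b / (b - a)) \<longlonglongrightarrow> q (a, b)" if "(a, b) \<in> P z" for a b z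
    using that conv[of a b] unfolding P_def q_def convergent_LIMSEQ_iff
    by (auto intro!: tendsto_divide)
  have h_nonneg: "0 \<le> h n z" for n z using h by (auto simp: sym_decreasing_def)
  have h_mono: "h n y \<le> h n x" if "0 < x" "x \<le> y" for n x y using h that by (auto simp: sym_decreasing_def)
  have lower: "I n a b / (b - a) \<le> h n z" if "0 < z" "z \<le> a" "a < b" for n a b z
  proof -
    have "I n a b \<le> (b - a) * h n a" using I that by auto
    then have "I n a b / (b - a) \<le> h n a" using that by (simp add: divide_le_eq mult.commute)
    then show ?thesis using h_mono[of z a n] that by linarith
  qed
  have upper: "h n z \<le> I n a b / (b - a)" if "0 < a" "a < b" "b \<le> z" for n a b z
  proof -
    have "(b - a) * h n b \<le> I n a b" using I that by auto
    then have "h n b \<le> I n a b / (b - a)" using that by (simp add: le_divide_eq mult.commute)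
    then show ?thesis using h_mono[of b z n] that by linarith
  qed
  have q_nonneg: "0 \<le> q ab" if "ab \<in> P z" for ab z
  proof -
    obtain a b where ab: "ab = (a, b)" by (cases ab)
    have "0 \<le> I n a b / (b - a)" for n
      using upper[of a b b n] h_nonneg[of n b] that by (auto simp: P_def ab)
    then show ?thesis
      using LIMSEQ_le_const[OF q_lim] that unfolding ab by blast
  qed
  \<comment> \<open>Averages over intervals to the left of z dominate \<open>h n z\<close>, so this
    infimum bounds the limit superior. It is decreasing in z and is the limit wherever it is
    continuous.\<close>
  define u where "u z = Inf (q ` P z)" for z
  have bdd: "bdd_below (q ` P z)" for z
    by (rule bdd_belowI2[of _ 0]) (rule q_nonneg)
  have ne: "P y \<inter> {(a, b). z < a} \<noteq> {}" if zy: "0 \<le> z" "z < y" for z y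
  proof -
    obtain b where b: "b \<in> \<rat>" "z < b" "b < y" using Rats_dense_in_real[OF zy(2)] by blast
    obtain a where a: "a \<in> \<rat>" "z < a" "a < b" using Rats_dense_in_real[OF b(2)] by blast
    have "(a, b) \<in> P y \<inter> {(a, b). z < a}" using a b zy by (auto simp: P_def)
    then show ?thesis by blast
  qed
  have "mono_on {0<..} (\<lambda>z. - u z)"
  proof (rule mono_onI)
    fix x y :: real assume "x \<in> {0<..}" "y \<in> {0<..}" "x \<le> y"
    then have "P x \<noteq> {}" using ne[of 0 x] by auto
    have "u y \<le> u x" unfolding u_def
      by (rule cInf_superset_mono) (use \<open>P x \<noteq> {}\<close> bdd \<open>x \<le> y\<close> in \<open>auto simp: P_def\<close>)
    then show "- u x \<le> - u y" by simp
  qed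
  then have C: "countable {z \<in> {0<..}. \<not> isCont (\<lambda>z. - u z) z}" (is "countable ?C")
    by (intro mono_on_ctble_discont_open) auto
  have main: "convergent (\<lambda>n. h n z)" if z0: "0 < z" and ucont: "isCont (\<lambda>z. - u z) z" for z
  proof -
    have cont: "isCont u z" using isCont_minus[OF ucont] by simp
    have "(\<lambda>n. h n z) \<longlonglongrightarrow> u z"
    proof (rule order_tendstoI)
      fix c assume "c < u z"
      have "\<forall>\<^sub>F y in at_right z. c < u y"
        using cont \<open>c < u z\<close> unfolding isCont_def
        by (intro order_tendstoD(1)[of u "u z"]) (auto intro: filterlim_mono[OF _ order_refl at_le])
      then obtain y0 where y0: "z < y0" "\<And>y. z < y \<Longrightarrow> y < y0 \<Longrightarrow> c < u y"
        unfolding eventually_at_right_field by blast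
      define y where "y = (z + y0) / 2"
      have y: "z < y" "c < u y" using y0(1) by (auto simp: y_def intro!: y0(2))
      \<comment> \<open>The interval lies between z and y: being left of y, its limiting average is
        at least \<open>u y > c\<close>; being right of z, its averages are at most
        \<open>h n z\<close>.\<close>
      obtain a b where ab: "(a, b) \<in> P y" "z < a" using ne[of z y] y z0 by fastforce
      have "u y \<le> q (a, b)" unfolding u_def using ab bdd by (intro cInf_lower) auto
      then have "c < q (a, b)" using y by simp
      then have "\<forall>\<^sub>F n in sequentially. c < I n a b / (b - a)"
        using q_lim[OF ab(1)] by (rule order_tendstoD(1)[rotated])
      then show "\<forall>\<^sub>F n in sequentially. c < h n z"
      proof eventually_elim
        case (elim n)
        then show ?case using lower[of z a b n] z0 ab by (auto simp: P_def)
      qed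
    next
      fix c assume "u z < c"
      have "P z \<noteq> {}" using ne[of 0 z] z0 by auto
      then have "\<exists>x\<in>q ` P z. x < c"
        using \<open>u z < c\<close> bdd unfolding u_def by (subst (asm) cInf_less_iff) auto
      then obtain a b where ab: "(a, b) \<in> P z" "q (a, b) < c" by auto
      then have "\<forall>\<^sub>F n in sequentially. I n a b / (b - a) < c"
        using q_lim[OF ab(1)] by (intro order_tendstoD(2))
      then show "\<forall>\<^sub>F n in sequentially. h n z < c"
      proof eventually_elim
        case (elim n)
        then show ?case using upper[of a b z n] ab by (auto simp: P_def)
      qed
    qed
    then show ?thesis by (auto simp: convergent_def)
  qed
  have "{z. \<not> convergent (\<lambda>n. h n z)} \<subseteq> insert 0 (?C \<union> uminus ` ?C)"
  proof
    fix z assume z: "z \<in> {z. \<not> convergent (\<lambda>n. h n z)}"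
    have "(\<lambda>n. h n z) = (\<lambda>n. h n \<bar>z\<bar>)" using sym_decreasing_abs[OF h] by simp
    then have "\<not> convergent (\<lambda>n. h n \<bar>z\<bar>)" using z by simp
    then have C: "\<bar>z\<bar> \<in> ?C" if "z \<noteq> 0" using main[of "\<bar>z\<bar>"] that by auto
    consider "z = 0" | "0 < z" | "z < 0" by linarith
    then show "z \<in> insert 0 (?C \<union> uminus ` ?C)"
    proof cases
      case 3
      then have "z = - \<bar>z\<bar>" by simp
      then have "z \<in> uminus ` ?C" using C 3 by (intro image_eqI[of z _ "\<bar>z\<bar>"]) auto
      then show ?thesis by blast
    qed (use C in auto)
  qed
  moreover have "countable (insert 0 (?C \<union> uminus ` ?C))" using C by auto
  ultimately show ?thesis by (rule countable_subset)
qed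

section \<open>Decay, tails and selection of a subsequence\<close>

definition cyl_decreasing :: "(real \<times> real \<Rightarrow> real) \<Rightarrow> bool" where
  "cyl_decreasing \<gamma> \<longleftrightarrow> (AE r in lborel. 0 < r \<longrightarrow>
     (\<exists>h. sym_decreasing h \<and> (AE z in lborel. \<gamma> (r, z) = h z)))"

lemma profile_K_pos:
  assumes "profile K \<gamma>"
  shows "0 \<le> K"
proof -
  have "\<exists>g g1 g2 L. half_plane_test g g1 g2 L K"
    using assms zero_less_one unfolding profile_def by blast
  then show ?thesis by (auto simp: half_plane_test_def)
qed

lemma profile_decay:
  assumes \<gamma>: "profile K \<gamma>" "cyl_decreasing \<gamma>" and "0 < e"
  shows "AE r in lborel. 0 < r \<longrightarrow> (AE z in lborel. 0 \<le> \<gamma> (r, z) \<and>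
    (16 * (256 * K\<^sup>2) / e ^ 4 \<le> r * \<bar>z\<bar> \<longrightarrow> \<gamma> (r, z) \<le> e))"
proof -
  obtain S where S: "AE r in lborel. 0 < r \<longrightarrow> r \<in> S"
    "\<And>r a b l. r \<in> S \<Longrightarrow> a \<le> b \<Longrightarrow> 0 < l \<Longrightarrow>
      (\<integral>\<^sup>+z. indicator {a..b} z * ennreal \<bar>\<gamma> (r, z)\<bar> \<partial>lborel) \<le> ennreal (l * (b - a) + 256 * K\<^sup>2 / (r * l ^ 3))"
    by (rule profile_regular_slices[OF \<gamma>(1)]) (rule that)
  show ?thesis
    using S(1) \<gamma>(2)[unfolded cyl_decreasing_def]
  proof eventually_elim
    case (elim r)
    show ?case
    proof
      assume "0 < r"
      then obtain h where h: "sym_decreasing h" "AE z in lborel. \<gamma> (r, z) = h z" using elim by blast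
      have "r \<in> S" using elim \<open>0 < r\<close> by blast
      show "AE z in lborel. 0 \<le> \<gamma> (r, z) \<and> (16 * (256 * K\<^sup>2) / e ^ 4 \<le> r * \<bar>z\<bar> \<longrightarrow> \<gamma> (r, z) \<le> e)"
        using h(2) AE_lborel_singleton[of 0]
      proof eventually_elim
        case (elim z)
        have "h z \<le> e" if "16 * (256 * K\<^sup>2) / e ^ 4 \<le> r * \<bar>z\<bar>"
          using h \<open>0 < r\<close> \<open>0 < e\<close> _ S(2)[OF \<open>r \<in> S\<close>] elim(2) that
          by (rule sym_decreasing_decay) auto
        moreover have "0 \<le> h z" using h(1) by (simp add: sym_decreasing_def)
        ultimately show ?case using elim(1) by simp
      qed
    qed
  qed
qed

text \<open>Put h = C / R. For r > R a value above e forces |z| < h, and the shift by 2 h leads to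
  |z + 2 h| > h, where the value is at most e / 2. On the level set \<gamma> thus drops by e / 2
  under this shift, so \<open>translation_z\<close> and Chebyshev's inequality bound its measure; 64
  is 4^2 * 2^2. The summand 1 in \<open>C\<close> keeps it positive when K = 0.\<close>

lemma profile_tail:
  assumes \<gamma>: "profile K \<gamma>" "cyl_decreasing \<gamma>" and "0 < e" "0 < R"
  defines "C \<equiv> 16 * (256 * K\<^sup>2) / (e / 2) ^ 4 + 1"
  shows "emeasure cyl {(r, z). R < r \<and> e < \<gamma> (r, z)} \<le> ennreal (64 * (C / R)\<^sup>2 * K / e\<^sup>2)"
proof -
  note [measurable] = profile_measurable[OF \<gamma>(1)]
  define A where "A = {(r, z). R < r \<and> e < \<gamma> (r, z)}"
  have [measurable]: "A \<in> sets borel" unfolding A_def by measurable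
  have "0 \<le> K" by (rule profile_K_pos[OF \<gamma>(1)])
  have "0 < C" unfolding C_def using \<open>0 < e\<close> by (intro add_nonneg_pos) auto
  define h where "h = C / R"
  have "0 < h" using \<open>0 < C\<close> \<open>0 < R\<close> by (simp add: h_def)
  have meas: "Measurable.pred borel (\<lambda>w. w \<in> A \<longrightarrow> e / 2 \<le> \<gamma> w - \<gamma> (fst w, snd w + 2 * h))"
    by measurable
  have drop: "AE w in cyl. w \<in> A \<longrightarrow> e / 2 \<le> \<gamma> w - \<gamma> (fst w, snd w + 2 * h)"
  proof -
    have "AE r in lborel. 0 < r \<longrightarrow> (AE z in lborel. (r, z) \<in> A \<longrightarrow>
       e / 2 \<le> \<gamma> (r, z) - \<gamma> (fst (r, z), snd (r, z) + 2 * h))"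
      using profile_decay[OF \<gamma> \<open>0 < e\<close>] profile_decay[OF \<gamma>, of "e / 2", OF half_gt_zero[OF \<open>0 < e\<close>]]
    proof eventually_elim
      case (elim r)
      show ?case
      proof
        assume "0 < r"
        define Q where "Q = (\<lambda>z. 0 \<le> \<gamma> (r, z) \<and> (16 * (256 * K\<^sup>2) / (e / 2) ^ 4 \<le> r * \<bar>z\<bar> \<longrightarrow> \<gamma> (r, z) \<le> e / 2))"
        have [measurable]: "Measurable.pred borel Q" unfolding Q_def by measurable
        have Q: "AE z in lborel. Q z" using elim \<open>0 < r\<close> unfolding Q_def by blast
        then have Q': "AE z in lborel. Q (2 * h + 1 * z)" by (intro AE_borel_affine) auto
        show "AE z in lborel. (r, z) \<in> A \<longrightarrow> e / 2 \<le> \<gamma> (r, z) - \<gamma> (fst (r, z), snd (r, z) + 2 * h)"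
          using Q Q'
        proof eventually_elim
          case (elim z)
          show ?case
          proof
            assume A: "(r, z) \<in> A"
            then have rz: "R < r" "e < \<gamma> (r, z)" by (auto simp: A_def)
            have "\<not> C \<le> r * \<bar>z\<bar>" using elim(1) rz \<open>0 < e\<close> unfolding Q_def C_def by linarith
            then have "r * \<bar>z\<bar> < R * h" using \<open>0 < R\<close> by (simp add: h_def)
            also have "\<dots> \<le> r * h" using rz \<open>0 < h\<close> by (intro mult_right_mono) auto
            finally have "\<bar>z\<bar> < h" using \<open>0 < r\<close> by simp
            then have "h \<le> \<bar>2 * h + z\<bar>" by linarith
            then have "R * h \<le> r * \<bar>2 * h + z\<bar>" using rz \<open>0 < R\<close> \<open>0 < h\<close> by (intro mult_mono) auto
            then have "C \<le> r * \<bar>2 * h + z\<bar>" using \<open>0 < R\<close> by (simp add: h_def)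
            then have "\<gamma> (r, 2 * h + z) \<le> e / 2" using elim(2) unfolding Q_def C_def by simp
            then show "e / 2 \<le> \<gamma> (r, z) - \<gamma> (fst (r, z), snd (r, z) + 2 * h)"
              using rz by (simp add: add.commute)
          qed
        qed
      qed
    qed
    then show ?thesis by (rule AE_cyl_iff[OF meas, THEN iffD2])
  qed
  have approx: "emeasure cyl A \<le> ennreal (64 * (C / R)\<^sup>2 * K / e\<^sup>2) + ennreal (2 * (8 / e) ^ 6 * (1 / Suc n))" for n
  proof -
    obtain g g1 g2 L where "half_plane_test g g1 g2 L K"
      and le: "(\<integral>\<^sup>+w. ennreal ((g w - \<gamma> w) ^ 6) \<partial>cyl) \<le> ennreal (1 / Suc n)"
      using \<gamma>(1) unfolding profile_def by (metis of_nat_0_less_iff zero_less_Suc zero_less_divide_1_iff)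
    interpret half_plane_test g g1 g2 L K by fact
    have le': "(\<integral>\<^sup>+(r, z). ennreal ((g (r, z + 2 * h) - \<gamma> (r, z + 2 * h)) ^ 6) \<partial>cyl) \<le> ennreal (1 / Suc n)"
    proof -
      have "(\<integral>\<^sup>+(r, z). ennreal ((g (r, z + 2 * h) - \<gamma> (r, z + 2 * h)) ^ 6) \<partial>cyl)
         = (\<integral>\<^sup>+r. ennreal r * (\<integral>\<^sup>+z. ennreal ((g (r, z + 2 * h) - \<gamma> (r, z + 2 * h)) ^ 6) \<partial>lborel) \<partial>lborel)"
        by (subst nn_integral_cyl) auto
      also have "\<dots> = (\<integral>\<^sup>+r. ennreal r * (\<integral>\<^sup>+z. ennreal ((g (r, z) - \<gamma> (r, z)) ^ 6) \<partial>lborel) \<partial>lborel)"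
      proof (rule nn_integral_cong, rule arg_cong2[where f = "(*)", OF refl])
        fix r :: real
        show "(\<integral>\<^sup>+z. ennreal ((g (r, z + 2 * h) - \<gamma> (r, z + 2 * h)) ^ 6) \<partial>lborel) = (\<integral>\<^sup>+z. ennreal ((g (r, z) - \<gamma> (r, z)) ^ 6) \<partial>lborel)"
          using nn_integral_real_affine[of "\<lambda>z. ennreal ((g (r, z) - \<gamma> (r, z)) ^ 6)" 1 "2 * h"]
          by (simp add: add.commute)
      qed
      also have "\<dots> = (\<integral>\<^sup>+w. ennreal ((g w - \<gamma> w) ^ 6) \<partial>cyl)"
        by (subst nn_integral_cyl) auto
      finally show ?thesis using le by simp
    qed
    define F where "F = (\<lambda>(r, z). ennreal ((4 / e)\<^sup>2) * ennreal ((g (r, z + 2 * h) - g (r, z))\<^sup>2)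
        + (ennreal ((8 / e) ^ 6) * ennreal ((g (r, z) - \<gamma> (r, z)) ^ 6)
        + ennreal ((8 / e) ^ 6) * ennreal ((g (r, z + 2 * h) - \<gamma> (r, z + 2 * h)) ^ 6)))"
    have "emeasure cyl A = (\<integral>\<^sup>+w. indicator A w \<partial>cyl)" by simp
    also have "\<dots> \<le> (\<integral>\<^sup>+w. F w \<partial>cyl)"
    proof (rule nn_integral_mono_AE)
      show "AE w in cyl. indicator A w \<le> F w"
        using drop
      proof eventually_elim
        case (elim w)
        obtain r z where w: "w = (r, z)" by (cases w)
        define x1 x2 x3 where "x1 = g (r, z + 2 * h) - g (r, z)" and "x2 = g (r, z) - \<gamma> (r, z)"
          and "x3 = g (r, z + 2 * h) - \<gamma> (r, z + 2 * h)"
        have "1 \<le> (4 / e)\<^sup>2 * x1\<^sup>2 + ((8 / e) ^ 6 * x2 ^ 6 + (8 / e) ^ 6 * x3 ^ 6)" if "w \<in> A"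
        proof -
          \<comment> \<open>The drop is shared out as e / 4 + e / 8 + e / 8. The increment
            \<open>x1\<close> of the approximant is squared to match \<open>translation_z\<close>;
            the approximation errors \<open>x2\<close>, \<open>x3\<close> are raised to the sixth
            power and vanish as n grows.\<close>
          have "e / 2 \<le> x3 - x2 - x1" using elim that by (simp add: w x1_def x2_def x3_def)
          then have "e / 4 \<le> \<bar>x1\<bar> \<or> e / 8 \<le> \<bar>x2\<bar> \<or> e / 8 \<le> \<bar>x3\<bar>" by linarith
          then have "1 \<le> 4 / e * \<bar>x1\<bar> \<or> 1 \<le> 8 / e * \<bar>x2\<bar> \<or> 1 \<le> 8 / e * \<bar>x3\<bar>"
            using \<open>0 < e\<close> by (simp add: field_simps)
          then have "1 \<le> (4 / e * \<bar>x1\<bar>)\<^sup>2 \<or> 1 \<le> (8 / e * \<bar>x2\<bar>) ^ 6 \<or> 1 \<le> (8 / e * \<bar>x3\<bar>) ^ 6"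
            using one_le_power by blast
          then have or: "1 \<le> (4 / e)\<^sup>2 * x1\<^sup>2 \<or> 1 \<le> (8 / e) ^ 6 * x2 ^ 6 \<or> 1 \<le> (8 / e) ^ 6 * x3 ^ 6"
            unfolding power_mult_distrib by (simp add: power_even_abs)
          have "0 \<le> (4 / e)\<^sup>2 * x1\<^sup>2" "0 \<le> (8 / e) ^ 6 * x2 ^ 6" "0 \<le> (8 / e) ^ 6 * x3 ^ 6"
            by (auto intro!: mult_nonneg_nonneg)
          with or show ?thesis by linarith
        qed
        then have "indicator A w \<le> ennreal ((4 / e)\<^sup>2 * x1\<^sup>2 + ((8 / e) ^ 6 * x2 ^ 6 + (8 / e) ^ 6 * x3 ^ 6))"
          by (auto split: split_indicator simp del: ennreal_plus simp: ennreal_ge_1)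
        also have "\<dots> = ennreal ((4 / e)\<^sup>2) * ennreal (x1\<^sup>2) + (ennreal ((8 / e) ^ 6) * ennreal (x2 ^ 6) + ennreal ((8 / e) ^ 6) * ennreal (x3 ^ 6))"
          by (simp add: ennreal_plus ennreal_mult)
        finally show ?case by (simp add: F_def w x1_def x2_def x3_def)
      qed
    qed
    also have "\<dots> = ennreal ((4 / e)\<^sup>2) * (\<integral>\<^sup>+(r, z). ennreal ((g (r, z + 2 * h) - g (r, z))\<^sup>2) \<partial>cyl)
        + (ennreal ((8 / e) ^ 6) * (\<integral>\<^sup>+w. ennreal ((g w - \<gamma> w) ^ 6) \<partial>cyl)
        + ennreal ((8 / e) ^ 6) * (\<integral>\<^sup>+(r, z). ennreal ((g (r, z + 2 * h) - \<gamma> (r, z + 2 * h)) ^ 6) \<partial>cyl))"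
      unfolding F_def by (simp add: split_beta' nn_integral_add nn_integral_cmult)
    also have "\<dots> \<le> ennreal ((4 / e)\<^sup>2) * ennreal ((2 * h)\<^sup>2 * K)
        + (ennreal ((8 / e) ^ 6) * ennreal (1 / Suc n) + ennreal ((8 / e) ^ 6) * ennreal (1 / Suc n))"
      using \<open>0 < h\<close> by (intro add_mono mult_left_mono translation_z le le') auto
    also have "\<dots> = ennreal ((4 / e)\<^sup>2 * ((2 * h)\<^sup>2 * K) + ((8 / e) ^ 6 * (1 / Suc n) + (8 / e) ^ 6 * (1 / Suc n)))"
    proof -
      have sum: "ennreal (a * b + (c * d + c' * d')) = ennreal a * ennreal b + (ennreal c * ennreal d + ennreal c' * ennreal d')"
        if "0 \<le> a" "0 \<le> b" "0 \<le> c" "0 \<le> d" "0 \<le> c'" "0 \<le> d'" for a b c d c' d'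
        using that by (simp add: ennreal_mult)
      show ?thesis using \<open>0 \<le> K\<close> by (intro sum[symmetric]) auto
    qed
    also have "\<dots> = ennreal (64 * (C / R)\<^sup>2 * K / e\<^sup>2 + 2 * (8 / e) ^ 6 * (1 / Suc n))"
      by (rule arg_cong[where f = ennreal]) (simp add: h_def power_divide power_mult_distrib mult_ac)
    also have "\<dots> = ennreal (64 * (C / R)\<^sup>2 * K / e\<^sup>2) + ennreal (2 * (8 / e) ^ 6 * (1 / Suc n))"
      using \<open>0 \<le> K\<close> by (intro ennreal_plus) auto
    finally show ?thesis .
  qed
  have "(\<lambda>n. 2 * (8 / e) ^ 6 * (1 / Suc n)) \<longlonglongrightarrow> 2 * (8 / e) ^ 6 * 0"
    by (intro tendsto_mult tendsto_const LIMSEQ_Suc[OF lim_1_over_n])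
  then have "(\<lambda>n. ennreal (2 * (8 / e) ^ 6 * (1 / Suc n))) \<longlonglongrightarrow> ennreal 0"
    by (intro tendsto_ennrealI) simp
  then show ?thesis
    using ennreal_le_of_tendsto_0[OF approx] by (simp add: A_def)
qed

text \<open>The subsequence has to be chosen before r is fixed. It is therefore extracted from
  countably many primitives, extended to all regular radii by the Hoelder estimate, and only then
  does \<open>sym_decreasing_convergent\<close> act on each line separately.\<close>

lemma profile_convergent_subsequence:
  fixes \<gamma> :: "nat \<Rightarrow> real \<times> real \<Rightarrow> real"
  assumes \<gamma>: "\<And>j. profile K (\<gamma> j)" "\<And>j. cyl_decreasing (\<gamma> j)"
  obtains k where "strict_mono k" "AE w in cyl. convergent (\<lambda>n. \<gamma> (k n) w)"
proof -
  note [measurable] = profile_measurable[OF \<gamma>(1)]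
  have K_pos: "0 \<le> K" by (rule profile_K_pos[OF \<gamma>(1)])
  define reg where "reg j S \<longleftrightarrow> (AE r in lborel. 0 < r \<longrightarrow> r \<in> S) \<and> S \<subseteq> {0<..} \<and>
    (\<forall>r a b. r \<in> S \<longrightarrow> a \<le> b \<longrightarrow>
      (\<integral>\<^sup>+z. indicator {a..b} z * ennreal \<bar>\<gamma> j (r, z)\<bar> \<partial>lborel) \<le> ennreal ((b - a) + 256 * K\<^sup>2 / r)) \<and>
    (\<forall>r r' a b. r \<in> S \<longrightarrow> r' \<in> S \<longrightarrow> r \<le> r' \<longrightarrow> a \<le> b \<longrightarrow>
      (\<integral>\<^sup>+z. indicator {a..b} z * ennreal \<bar>\<gamma> j (r', z) - \<gamma> j (r, z)\<bar> \<partial>lborel)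
        \<le> ennreal (sqrt ((b - a) * (r' - r) * K / r)))" for j S
  have "\<exists>S. reg j S" for j
  proof (rule profile_regular_slices[OF \<gamma>(1)[of j]])
    fix S assume S: "AE r in lborel. 0 < r \<longrightarrow> r \<in> S" "S \<subseteq> {0<..}"
      and 1: "\<And>r a b l. r \<in> S \<Longrightarrow> a \<le> b \<Longrightarrow> 0 < l \<Longrightarrow>
      (\<integral>\<^sup>+z. indicator {a..b} z * ennreal \<bar>\<gamma> j (r, z)\<bar> \<partial>lborel) \<le> ennreal (l * (b - a) + 256 * K\<^sup>2 / (r * l ^ 3))"
      and 2: "\<And>r r' a b. r \<in> S \<Longrightarrow> r' \<in> S \<Longrightarrow> r \<le> r' \<Longrightarrow> a \<le> b \<Longrightarrow>
      (\<integral>\<^sup>+z. indicator {a..b} z * ennreal \<bar>\<gamma> j (r', z) - \<gamma> j (r, z)\<bar> \<partial>lborel)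
        \<le> ennreal (sqrt ((b - a) * (r' - r) * K / r))"
    have "(\<integral>\<^sup>+z. indicator {a..b} z * ennreal \<bar>\<gamma> j (r, z)\<bar> \<partial>lborel) \<le> ennreal ((b - a) + 256 * K\<^sup>2 / r)"
      if "r \<in> S" "a \<le> b" for r a b
      using 1[of r a b 1] that by simp
    then show "\<exists>S. reg j S" unfolding reg_def using S 2 by blast
  qed
  then obtain S0 where S0: "\<And>j. reg j (S0 j)" by metis
  define T where "T j = {r. \<exists>h. sym_decreasing h \<and> (AE z in lborel. \<gamma> j (r, z) = h z)}" for j
  \<comment> \<open>One set of radii that is good for every index; a countable intersection keeps
    almost all r > 0.\<close>
  define S where "S = (\<Inter>j. S0 j \<inter> T j)"
  have S_pos: "0 < r" if "r \<in> S" for r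
    using that S0[of 0, unfolded reg_def, THEN conjunct2, THEN conjunct1] by (auto simp: S_def)
  have L1: "(\<integral>\<^sup>+z. indicator {a..b} z * ennreal \<bar>\<gamma> j (r, z)\<bar> \<partial>lborel) \<le> ennreal ((b - a) + 256 * K\<^sup>2 / r)"
    if "r \<in> S" "a \<le> b" for r a b j
    using that by (intro S0[of j, unfolded reg_def, THEN conjunct2, THEN conjunct2, THEN conjunct1, rule_format]) (auto simp: S_def)
  have Hoelder: "(\<integral>\<^sup>+z. indicator {a..b} z * ennreal \<bar>\<gamma> j (r', z) - \<gamma> j (r, z)\<bar> \<partial>lborel)
        \<le> ennreal (sqrt ((b - a) * (r' - r) * K / r))"
    if "r \<in> S" "r' \<in> S" "r \<le> r'" "a \<le> b" for r r' a b j
    using that by (intro S0[of j, unfolded reg_def, THEN conjunct2, THEN conjunct2, THEN conjunct2, rule_format]) (auto simp: S_def)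
  have S_AE: "AE r in lborel. 0 < r \<longrightarrow> r \<in> S"
  proof -
    have "AE r in lborel. \<forall>j. 0 < r \<longrightarrow> r \<in> S0 j \<inter> T j"
      unfolding AE_all_countable
    proof
      fix j
      have "AE r in lborel. 0 < r \<longrightarrow> r \<in> S0 j" using S0[of j] by (simp add: reg_def)
      moreover have "AE r in lborel. 0 < r \<longrightarrow> r \<in> T j"
        using \<gamma>(2)[of j] by (simp add: T_def cyl_decreasing_def)
      ultimately show "AE r in lborel. 0 < r \<longrightarrow> r \<in> S0 j \<inter> T j" by eventually_elim auto
    qed
    then show ?thesis by eventually_elim (auto simp: S_def)
  qed
  define w where "w j = (\<lambda>(r, a, b). \<integral>z. indicator {a..b} z * \<gamma> j (r, z) \<partial>lborel)" for j
  have int: "integrable lborel (\<lambda>z. indicator {a..b} z * \<gamma> j (r, z))" if "r \<in> S" "a \<le> b" for r a b j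
  proof (rule integrableI_bounded)
    have "(\<integral>\<^sup>+z. norm (indicator {a..b} z * \<gamma> j (r, z)) \<partial>lborel) = (\<integral>\<^sup>+z. indicator {a..b} z * ennreal \<bar>\<gamma> j (r, z)\<bar> \<partial>lborel)"
      by (intro nn_integral_cong) (auto split: split_indicator)
    also have "\<dots> < \<infinity>" by (rule le_less_trans[OF L1[OF that]]) simp
    finally show "(\<integral>\<^sup>+z. norm (indicator {a..b} z * \<gamma> j (r, z)) \<partial>lborel) < \<infinity>" .
  qed measurable
  have w_bound: "\<bar>w j (r, a, b)\<bar> \<le> (b - a) + 256 * K\<^sup>2 / r" if "r \<in> S" "a \<le> b" for r a b j
  proof -
    have "ennreal \<bar>w j (r, a, b)\<bar> \<le> (\<integral>\<^sup>+z. norm (indicator {a..b} z * \<gamma> j (r, z)) \<partial>lborel)"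
      using integral_norm_bound_ennreal[OF int[OF that, of j]] by (simp add: w_def)
    also have "\<dots> = (\<integral>\<^sup>+z. indicator {a..b} z * ennreal \<bar>\<gamma> j (r, z)\<bar> \<partial>lborel)"
      by (intro nn_integral_cong) (auto split: split_indicator)
    also note L1[OF that]
    finally show ?thesis using that S_pos[OF that(1)] by (subst (asm) ennreal_le_iff) auto
  qed
  have w_Hoelder: "\<bar>w j (r', a, b) - w j (r, a, b)\<bar> \<le> sqrt ((b - a) * (r' - r) * K / r)"
    if "r \<in> S" "r' \<in> S" "r \<le> r'" "a \<le> b" for r r' a b j
  proof -
    have i: "integrable lborel (\<lambda>z. indicator {a..b} z * \<gamma> j (r', z) - indicator {a..b} z * \<gamma> j (r, z))"
      by (intro Bochner_Integration.integrable_diff int that)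
    have "w j (r', a, b) - w j (r, a, b) = (\<integral>z. indicator {a..b} z * \<gamma> j (r', z) - indicator {a..b} z * \<gamma> j (r, z) \<partial>lborel)"
      unfolding w_def by (simp add: int that)
    then have "ennreal \<bar>w j (r', a, b) - w j (r, a, b)\<bar>
        \<le> (\<integral>\<^sup>+z. norm (indicator {a..b} z * \<gamma> j (r', z) - indicator {a..b} z * \<gamma> j (r, z)) \<partial>lborel)"
      using integral_norm_bound_ennreal[OF i] by simp
    also have "\<dots> = (\<integral>\<^sup>+z. indicator {a..b} z * ennreal \<bar>\<gamma> j (r', z) - \<gamma> j (r, z)\<bar> \<partial>lborel)"
      by (intro nn_integral_cong) (auto split: split_indicator)
    also note Hoelder[OF that]
    finally show ?thesis
      using that S_pos[OF that(1)] K_pos by (subst (asm) ennreal_le_iff) auto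
  qed
  \<comment> \<open>The dense set is taken inside \<open>S\<close>, because the Hoelder estimate
    holds only between radii of \<open>S\<close>.\<close>
  obtain D where D: "countable D" "D \<subseteq> S" "S \<subseteq> closure D" by (rule separable)
  define X where "X = {(r, a, b). r \<in> D \<and> a \<in> \<rat> \<and> b \<in> \<rat> \<and> a \<le> (b::real)}"
  have "countable (D \<times> (\<rat> :: real set) \<times> (\<rat> :: real set))" using D(1) countable_rat by blast
  then have "countable X" by (rule countable_subset[rotated]) (auto simp: X_def)
  \<comment> \<open>The bounds on the primitives depend on (r, a, b); division by \<open>B\<close>
    makes them uniform, as the diagonal argument requires. The summand 1 keeps \<open>B\<close>
    positive.\<close>
  define B where "B = (\<lambda>(r, a, b). (b - a) + 256 * K\<^sup>2 / r + 1)"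
  have B: "0 < B x" "\<bar>w j x\<bar> \<le> B x" if "x \<in> X" for x j
  proof -
    obtain r a b where x: "x = (r, a, b)" by (cases x)
    have "r \<in> S" "a \<le> b" using that D by (auto simp: X_def x)
    then show "0 < B x" "\<bar>w j x\<bar> \<le> B x"
      using w_bound[of r a b j] S_pos[of r] by (auto simp: B_def x add_nonneg_pos)
  qed
  have "norm (w n x / B x) \<le> 1" if "x \<in> X" for n x
    using B(1)[OF that] B(2)[OF that, of n] by simp
  then obtain k where k: "strict_mono (k :: nat \<Rightarrow> nat)"
    and lim: "\<And>x. x \<in> X \<Longrightarrow> \<exists>l. (\<lambda>n. w (k n) x / B x) \<longlonglongrightarrow> l"
    using function_convergent_subsequence[OF \<open>countable X\<close>, of "\<lambda>n x. w n x / B x" 1] by blast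
  have convD: "convergent (\<lambda>n. w (k n) x)" if xX: "x \<in> X" for x
  proof -
    obtain l where "(\<lambda>n. w (k n) x / B x) \<longlonglongrightarrow> l" using lim[OF xX] by blast
    then have "(\<lambda>n. B x * (w (k n) x / B x)) \<longlonglongrightarrow> B x * l" by (intro tendsto_mult tendsto_const)
    then show ?thesis using B(1)[OF xX] by (auto simp: convergent_def)
  qed
  have convS: "convergent (\<lambda>n. w (k n) (r, a, b))" if rab: "r \<in> S" "a \<in> \<rat>" "b \<in> \<rat>" "a \<le> b" for r a b
  proof -
    have "0 < r" using S_pos rab by auto
    have "Cauchy (\<lambda>n. w (k n) (r, a, b))"
    proof (rule metric_CauchyI)
      fix e :: real assume "0 < e"
      \<comment> \<open>The first entry keeps the smaller radius above r / 2, the second brings the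
        quantity under the square root below (e / 3)^2. The summand 1 in the denominator covers a =
        b and K = 0.\<close>
      define \<delta> where "\<delta> = min (r / 2) ((e / 3)\<^sup>2 * r / (2 * ((b - a) * K + 1)))"
      have den: "0 < (b - a) * K + 1" using rab K_pos by (intro add_nonneg_pos) auto
      then have "0 < \<delta>" using \<open>0 < r\<close> \<open>0 < e\<close> by (simp add: \<delta>_def)
      moreover have "r \<in> closure D" using D rab by auto
      ultimately obtain d where d: "d \<in> D" "dist d r < \<delta>" using closure_approachable by blast
      have "d \<in> S" using d D by auto
      have near: "\<bar>w j (r, a, b) - w j (d, a, b)\<bar> \<le> e / 3" for j
      proof -
        define lo hi where "lo = min r d" and "hi = max r d"
        have lh: "lo \<in> S" "hi \<in> S" "lo \<le> hi" using rab \<open>d \<in> S\<close> by (auto simp: lo_def hi_def min_def max_def)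
        have "hi - lo \<le> \<delta>" using d(2) by (auto simp: lo_def hi_def dist_real_def)
        have "\<bar>d - r\<bar> < r / 2" using d(2) by (simp add: dist_real_def \<delta>_def)
        then have "r / 2 \<le> lo" using \<open>0 < r\<close> unfolding lo_def by linarith
        have "\<bar>w j (r, a, b) - w j (d, a, b)\<bar> = \<bar>w j (hi, a, b) - w j (lo, a, b)\<bar>"
          by (auto simp: lo_def hi_def min_def max_def)
        also have "\<dots> \<le> sqrt ((b - a) * (hi - lo) * K / lo)" by (rule w_Hoelder[OF lh rab(4)])
        also have "\<dots> \<le> sqrt ((e / 3)\<^sup>2)"
        proof (rule real_sqrt_le_mono)
          have "(b - a) * (hi - lo) * K / lo \<le> (b - a) * \<delta> * K / (r / 2)"
            using \<open>hi - lo \<le> \<delta>\<close> \<open>r / 2 \<le> lo\<close> \<open>0 < r\<close> \<open>0 < \<delta>\<close> K_pos rab lh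
            by (intro frac_le mult_right_mono mult_left_mono) auto
          also have "\<dots> = ((b - a) * K) * \<delta> * (2 / r)" by simp
          also have "\<dots> \<le> ((b - a) * K + 1) * \<delta> * (2 / r)"
            using \<open>0 < r\<close> \<open>0 < \<delta>\<close> by (intro mult_right_mono) auto
          also have "\<dots> \<le> ((b - a) * K + 1) * ((e / 3)\<^sup>2 * r / (2 * ((b - a) * K + 1))) * (2 / r)"
            using \<open>0 < r\<close> den by (intro mult_right_mono mult_left_mono) (auto simp: \<delta>_def)
          also have "\<dots> = (e / 3)\<^sup>2"
          proof -
            have "q * (y * r / (2 * q)) * (2 / r) = y" if "0 < q" for q y :: real
              using that \<open>0 < r\<close> by (simp add: field_simps)
            then show ?thesis using den by blast
          qed
          finally show "(b - a) * (hi - lo) * K / lo \<le> (e / 3)\<^sup>2" .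
        qed
        finally show ?thesis using \<open>0 < e\<close> by simp
      qed
      have "(d, a, b) \<in> X" using d rab by (auto simp: X_def)
      from convergent_Cauchy[OF convD[OF this]] \<open>0 < e\<close>
      obtain N where N: "\<And>m n. N \<le> m \<Longrightarrow> N \<le> n \<Longrightarrow> dist (w (k m) (d, a, b)) (w (k n) (d, a, b)) < e / 3"
        unfolding Cauchy_def by (metis zero_less_divide_iff zero_less_numeral)
      have "dist (w (k m) (r, a, b)) (w (k n) (r, a, b)) < e" if "N \<le> m" "N \<le> n" for m n
        using N[OF that] near[of "k m"] near[of "k n"] unfolding dist_real_def by linarith
      then show "\<exists>M. \<forall>m\<ge>M. \<forall>n\<ge>M. dist (w (k m) (r, a, b)) (w (k n) (r, a, b)) < e" by blast
    qed
    then show ?thesis by (rule Cauchy_convergent)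
  qed
  have "AE w in cyl. convergent (\<lambda>n. \<gamma> (k n) w)"
  proof (rule AE_cyl_iff[THEN iffD2])
    show "AE r in lborel. 0 < r \<longrightarrow> (AE z in lborel. convergent (\<lambda>n. \<gamma> (k n) (r, z)))"
      using S_AE
    proof eventually_elim
      case (elim r)
      show ?case
      proof
        assume "0 < r"
        then have r: "r \<in> S" using elim by blast
        then have "\<forall>n. \<exists>h. sym_decreasing h \<and> (AE z in lborel. \<gamma> (k n) (r, z) = h z)"
          by (auto simp: S_def T_def)
        then obtain h where h: "\<And>n. sym_decreasing (h n)" "\<And>n. AE z in lborel. \<gamma> (k n) (r, z) = h n z"
          by metis
        have sandwich: "(b - a) * h n b \<le> w (k n) (r, a, b) \<and> w (k n) (r, a, b) \<le> (b - a) * h n a"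
          if ab: "0 < a" "a < b" for n a b
        proof -
          have c: "(\<integral>z. indicator {a..b} z * c \<partial>lborel) = (b - a) * c" "integrable lborel (\<lambda>z. indicator {a..b} z * c)" for c :: real
            using ab by auto
          have i: "integrable lborel (\<lambda>z. indicator {a..b} z * \<gamma> (k n) (r, z))" using int[OF r] ab by simp
          have "(\<integral>z. indicator {a..b} z * h n b \<partial>lborel) \<le> (\<integral>z. indicator {a..b} z * \<gamma> (k n) (r, z) \<partial>lborel)"
            using h(2)[of n]
            by (intro integral_mono_AE c i, elim eventually_mono)
              (use h(1)[of n] ab in \<open>auto split: split_indicator simp: sym_decreasing_def\<close>)
          moreover have "(\<integral>z. indicator {a..b} z * \<gamma> (k n) (r, z) \<partial>lborel) \<le> (\<integral>z. indicator {a..b} z * h n a \<partial>lborel)"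
            using h(2)[of n]
            by (intro integral_mono_AE c i, elim eventually_mono)
              (use h(1)[of n] ab in \<open>auto split: split_indicator simp: sym_decreasing_def\<close>)
          ultimately show ?thesis using ab by (simp add: w_def)
        qed
        have "countable {z. \<not> convergent (\<lambda>n. h n z)}"
          by (rule sym_decreasing_convergent[OF h(1) sandwich]) (auto intro: convS r)
        then have "AE z in lborel. z \<notin> {z. \<not> convergent (\<lambda>n. h n z)}"
          by (intro AE_not_in countable_imp_null_set_lborel)
        moreover have "AE z in lborel. \<forall>n. \<gamma> (k n) (r, z) = h n z"
          unfolding AE_all_countable using h(2) by blast
        ultimately show "AE z in lborel. convergent (\<lambda>n. \<gamma> (k n) (r, z))"
          by eventually_elim simp
      qed
    qed
  qed (simp add: Cauchy_convergent_iff[symmetric] pred_def sets_Collect_Cauchy)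
  with k show thesis by (rule that)
qed

text \<open>The slice at radius r has length at most 2 c / r, which the weight r cancels, so every r
  in (0, R] contributes at most 2 c.\<close>

lemma emeasure_cyl_hyperbolic_region:
  assumes "0 < R" "0 < c"
  shows "emeasure cyl {(r, z). r \<le> R \<and> r * \<bar>z\<bar> < c} \<le> ennreal (2 * c * R)"
proof -
  define F where "F = {(r::real, z::real). r \<le> R \<and> r * \<bar>z\<bar> < c}"
  have [measurable]: "F \<in> sets borel" unfolding F_def by measurable
  have "emeasure cyl F = (\<integral>\<^sup>+w. indicator F w \<partial>cyl)" by simp
  also have "\<dots> = (\<integral>\<^sup>+r. ennreal r * (\<integral>\<^sup>+z. indicator F (r, z) \<partial>lborel) \<partial>lborel)"
    by (rule nn_integral_cyl) measurable
  also have "\<dots> \<le> (\<integral>\<^sup>+r. ennreal (2 * c) * indicator {0..R} r \<partial>lborel)"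
  proof (rule nn_integral_mono)
    fix r :: real
    show "ennreal r * (\<integral>\<^sup>+z. indicator F (r, z) \<partial>lborel) \<le> ennreal (2 * c) * indicator {0..R} r"
    proof (cases "0 < r \<and> r \<le> R")
      case True
      have "\<bar>z\<bar> \<le> c / r" if "r * \<bar>z\<bar> < c" for z
        using True that by (simp add: field_simps)
      then have "(\<integral>\<^sup>+z. indicator F (r, z) \<partial>lborel) \<le> (\<integral>\<^sup>+z. indicator {- (c / r)..c / r} z \<partial>lborel)"
        by (intro nn_integral_mono) (auto simp: F_def abs_le_iff minus_le_iff split: split_indicator)
      also have "\<dots> = ennreal (2 * c / r)" using True \<open>0 < c\<close> by simp
      finally have "ennreal r * (\<integral>\<^sup>+z. indicator F (r, z) \<partial>lborel) \<le> ennreal r * ennreal (2 * c / r)"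
        by (rule mult_left_mono) auto
      then show ?thesis using True \<open>0 < c\<close> by (simp flip: ennreal_mult)
    next
      case False
      then show ?thesis by (auto simp: F_def ennreal_neg not_less)
    qed
  qed
  also have "\<dots> = ennreal (2 * c * R)"
    using assms by (subst nn_integral_cmult_indicator) (auto simp: ennreal_mult)
  finally show ?thesis by (simp add: F_def)
qed

text \<open>For r \<le> R and r|z| \<ge> c both functions lie in [0, e], so a difference above e
  occurs either in \<open>F R\<close>, which has finite measure and admits dominated convergence, or
  at r > R, where one of the two exceeds e. The latter sets have measure O(1/R^2) uniformly in n, so
  R is fixed before n tends to infinity.\<close>

lemma profile_converges_in_measure:
  fixes \<gamma> :: "nat \<Rightarrow> real \<times> real \<Rightarrow> real"
  assumes \<gamma>: "\<And>j. profile K (\<gamma> j)" "\<And>j. cyl_decreasing (\<gamma> j)"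
    and [measurable]: "\<nu> \<in> borel_measurable borel"
    and lim: "AE w in cyl. (\<lambda>n. \<gamma> n w) \<longlonglongrightarrow> \<nu> w"
    and "0 < e"
  shows "(\<lambda>n. emeasure cyl {w. e < \<bar>\<gamma> n w - \<nu> w\<bar>}) \<longlonglongrightarrow> 0"
proof -
  note [measurable] = profile_measurable[OF \<gamma>(1)]
  have "0 \<le> K" by (rule profile_K_pos[OF \<gamma>(1)])
  define c where "c = 16 * (256 * K\<^sup>2) / e ^ 4 + 1"
  have "0 < c" unfolding c_def using \<open>0 < e\<close> by (intro add_nonneg_pos) auto
  have bound: "AE w in cyl. 0 \<le> \<gamma> n w \<and> (c \<le> fst w * \<bar>snd w\<bar> \<longrightarrow> \<gamma> n w \<le> e)" for n
  proof -
    have m: "Measurable.pred borel (\<lambda>w. 0 \<le> \<gamma> n w \<and> (c \<le> fst w * \<bar>snd w\<bar> \<longrightarrow> \<gamma> n w \<le> e))" by measurable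
    show ?thesis
      unfolding AE_cyl_iff[OF m]
      using profile_decay[OF \<gamma> \<open>0 < e\<close>, of n]
    proof eventually_elim
      case (elim r)
      show ?case
      proof
        assume "0 < r"
        with elim have "AE z in lborel. 0 \<le> \<gamma> n (r, z) \<and>
          (16 * (256 * K\<^sup>2) / e ^ 4 \<le> r * \<bar>z\<bar> \<longrightarrow> \<gamma> n (r, z) \<le> e)" by blast
        then show "AE z in lborel. 0 \<le> \<gamma> n (r, z) \<and> (c \<le> fst (r, z) * \<bar>snd (r, z)\<bar> \<longrightarrow> \<gamma> n (r, z) \<le> e)"
          by eventually_elim (auto simp: c_def)
      qed
    qed
  qed
  then have bounds: "AE w in cyl. \<forall>n. 0 \<le> \<gamma> n w \<and> (c \<le> fst w * \<bar>snd w\<bar> \<longrightarrow> \<gamma> n w \<le> e)"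
    unfolding AE_all_countable by blast
  have bound\<nu>: "AE w in cyl. 0 \<le> \<nu> w \<and> (c \<le> fst w * \<bar>snd w\<bar> \<longrightarrow> \<nu> w \<le> e)"
    using bounds lim by eventually_elim (auto intro: LIMSEQ_le_const LIMSEQ_le_const2)
  define A where "A n = {w. e < \<bar>\<gamma> n w - \<nu> w\<bar>}" for n
  define F where "F R = {(r::real, z::real). r \<le> R \<and> r * \<bar>z\<bar> < c}" for R
  define T where "T n R = {(r, z). R < r \<and> e < \<gamma> n (r, z)}" for n R
  define T' where "T' R = {(r, z). R < r \<and> e < \<nu> (r, z)}" for R
  have [measurable]: "A n \<in> sets borel" "F R \<in> sets borel" "T n R \<in> sets borel" "T' R \<in> sets borel" for n R
    unfolding A_def F_def T_def T'_def by measurable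
  define Q where "Q = (16 * (256 * K\<^sup>2) / (e / 2) ^ 4 + 1)\<^sup>2 * 64 * K / e\<^sup>2"
  have "0 \<le> Q" using \<open>0 \<le> K\<close> by (simp add: Q_def)
  have tail: "emeasure cyl (T n R) \<le> ennreal (Q / R\<^sup>2)" if "0 < R" for n R
    using profile_tail[OF \<gamma> \<open>0 < e\<close> that, of n] by (simp add: T_def Q_def power_divide mult_ac)
  have tail': "emeasure cyl (T' R) \<le> ennreal (Q / R\<^sup>2)" if "0 < R" for R
  proof -
    have "emeasure cyl (T' R) = (\<integral>\<^sup>+w. indicator (T' R) w \<partial>cyl)" by simp
    \<comment> \<open>Fatou's lemma for indicators: the strict inequality e < \<nu> is inherited by
      \<gamma> n for large n, so the limit satisfies the same tail bound.\<close>
    also have "\<dots> \<le> (\<integral>\<^sup>+w. liminf (\<lambda>n. indicator (T n R) w) \<partial>cyl)"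
    proof (rule nn_integral_mono_AE)
      show "AE w in cyl. indicator (T' R) w \<le> liminf (\<lambda>n. indicator (T n R) w :: ennreal)"
        using lim
      proof eventually_elim
        case (elim w)
        show ?case
        proof (cases "w \<in> T' R")
          case True
          then have "e < \<nu> w" "R < fst w" by (auto simp: T'_def)
          then have "\<forall>\<^sub>F n in sequentially. e < \<gamma> n w" using elim by (intro order_tendstoD(1))
          then have "\<forall>\<^sub>F n in sequentially. (1::ennreal) \<le> indicator (T n R) w"
            by eventually_elim (use \<open>R < fst w\<close> in \<open>auto simp: T_def split: split_indicator\<close>)
          then have "(1::ennreal) \<le> liminf (\<lambda>n. indicator (T n R) w)" by (rule Liminf_bounded)
          then show ?thesis using True by simp
        qed simp
      qed
    qed
    also have "\<dots> \<le> liminf (\<lambda>n. \<integral>\<^sup>+w. indicator (T n R) w \<partial>cyl)" by (rule nn_integral_liminf) measurable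
    also have "\<dots> \<le> liminf (\<lambda>n. ennreal (Q / R\<^sup>2))" by (intro Liminf_mono always_eventually) (simp add: tail that)
    also have "\<dots> = ennreal (Q / R\<^sup>2)" by (simp add: Liminf_const)
    finally show ?thesis .
  qed
  have core: "(\<lambda>n. emeasure cyl (A n \<inter> F R)) \<longlonglongrightarrow> 0" if "0 < R" for R
  proof -
    have "(\<lambda>n. \<integral>\<^sup>+w. indicator (A n \<inter> F R) w \<partial>cyl) \<longlonglongrightarrow> (\<integral>\<^sup>+w. 0 \<partial>cyl)"
    proof (rule nn_integral_dominated_convergence[where w = "indicator (F R)"])
      show "(\<integral>\<^sup>+w. indicator (F R) w \<partial>cyl) < \<infinity>"
        using emeasure_cyl_hyperbolic_region[OF that \<open>0 < c\<close>] by (simp add: F_def le_less_trans)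
      show "AE w in cyl. (\<lambda>n. indicator (A n \<inter> F R) w :: ennreal) \<longlonglongrightarrow> 0"
        using lim
      proof eventually_elim
        case (elim w)
        then have "\<forall>\<^sub>F n in sequentially. dist (\<gamma> n w) (\<nu> w) < e" using \<open>0 < e\<close> by (rule tendstoD)
        then show ?case
          by (intro tendsto_eventually, eventually_elim) (auto simp: A_def dist_real_def split: split_indicator)
      qed
    qed (auto split: split_indicator)
    then show ?thesis by simp
  qed
  have cover: "emeasure cyl (A n) \<le> emeasure cyl (A n \<inter> F R) + ennreal (2 * Q / R\<^sup>2)" if "0 < R" for n R
  proof -
    have "emeasure cyl (A n) \<le> emeasure cyl ((A n \<inter> F R) \<union> (T n R \<union> T' R))"
    proof (rule emeasure_mono_AE)
      show "AE w in cyl. w \<in> A n \<longrightarrow> w \<in> (A n \<inter> F R) \<union> (T n R \<union> T' R)"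
        using bounds bound\<nu>
      proof eventually_elim
        case (elim w)
        obtain r z where w: "w = (r, z)" by (cases w)
        show ?case
        proof
          assume "w \<in> A n"
          then have "e < \<bar>\<gamma> n w - \<nu> w\<bar>" by (simp add: A_def)
          moreover have "0 \<le> \<gamma> n w" "0 \<le> \<nu> w" using elim by auto
          ultimately have or: "e < \<gamma> n w \<or> e < \<nu> w" by linarith
          then have "\<not> c \<le> r * \<bar>z\<bar>" using elim by (auto simp: w not_le[symmetric])
          then show "w \<in> (A n \<inter> F R) \<union> (T n R \<union> T' R)"
            using or \<open>w \<in> A n\<close> by (cases "r \<le> R") (auto simp: w F_def T_def T'_def)
        qed
      qed
    qed measurable
    also have "\<dots> \<le> emeasure cyl (A n \<inter> F R) + (emeasure cyl (T n R) + emeasure cyl (T' R))"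
      by (intro order_trans[OF emeasure_subadditive] add_left_mono emeasure_subadditive) auto
    also have "\<dots> \<le> emeasure cyl (A n \<inter> F R) + (ennreal (Q / R\<^sup>2) + ennreal (Q / R\<^sup>2))"
      by (intro add_left_mono add_mono tail tail' that)
    also have "ennreal (Q / R\<^sup>2) + ennreal (Q / R\<^sup>2) = ennreal (2 * Q / R\<^sup>2)"
      using \<open>0 \<le> Q\<close> by (subst ennreal_plus[symmetric]) auto
    finally show ?thesis .
  qed
  have "(\<lambda>n. emeasure cyl (A n)) \<longlonglongrightarrow> 0"
  proof (rule order_tendstoI)
    fix u :: ennreal assume "0 < u"
    have "(\<lambda>m. ennreal (2 * Q / (real (Suc m))\<^sup>2)) \<longlonglongrightarrow> ennreal 0"
    proof (rule tendsto_ennrealI)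
      have "(\<lambda>m. 2 * Q * (1 / real (Suc m))\<^sup>2) \<longlonglongrightarrow> 2 * Q * 0\<^sup>2"
        by (intro tendsto_mult tendsto_const tendsto_power LIMSEQ_Suc[OF lim_1_over_n])
      then show "(\<lambda>m. 2 * Q / (real (Suc m))\<^sup>2) \<longlonglongrightarrow> 0" by (simp add: power_divide)
    qed
    then have "\<forall>\<^sub>F m in sequentially. ennreal (2 * Q / (real (Suc m))\<^sup>2) < u"
      using \<open>0 < u\<close> by (intro order_tendstoD(2)) auto
    then obtain m where m: "ennreal (2 * Q / (real (Suc m))\<^sup>2) < u" by (auto simp: eventually_sequentially)
    have "(\<lambda>n. emeasure cyl (A n \<inter> F (real (Suc m))) + ennreal (2 * Q / (real (Suc m))\<^sup>2))
        \<longlonglongrightarrow> 0 + ennreal (2 * Q / (real (Suc m))\<^sup>2)"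
      by (intro tendsto_add core tendsto_const) auto
    then have "\<forall>\<^sub>F n in sequentially. emeasure cyl (A n \<inter> F (real (Suc m))) + ennreal (2 * Q / (real (Suc m))\<^sup>2) < u"
      using m by (intro order_tendstoD(2)) auto
    then show "\<forall>\<^sub>F n in sequentially. emeasure cyl (A n) < u"
      by eventually_elim (rule le_less_trans[OF cover], auto)
  qed auto
  then show ?thesis by (simp add: A_def)
qed

lemma profile_compactness:
  fixes \<gamma> :: "nat \<Rightarrow> real \<times> real \<Rightarrow> real"
  assumes \<gamma>: "\<And>j. profile K (\<gamma> j)" "\<And>j. cyl_decreasing (\<gamma> j)"
  obtains k \<nu> where "strict_mono k" "\<nu> \<in> borel_measurable borel"
    "(\<integral>\<^sup>+w. ennreal ((\<nu> w) ^ 6) \<partial>cyl) \<le> ennreal (64 * (4096 * K ^ 3 + 1))"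
    "\<And>e. 0 < e \<Longrightarrow> (\<lambda>n. emeasure cyl {w. e < \<bar>\<gamma> (k n) w - \<nu> w\<bar>}) \<longlonglongrightarrow> 0"
proof -
  note [measurable] = profile_measurable[OF \<gamma>(1)]
  obtain k where k: "strict_mono k" "AE w in cyl. convergent (\<lambda>n. \<gamma> (k n) w)"
    by (rule profile_convergent_subsequence[OF \<gamma>])
  define \<nu> where "\<nu> w = lim (\<lambda>n. \<gamma> (k n) w)" for w
  have m: "\<nu> \<in> borel_measurable borel" unfolding \<nu>_def[abs_def] by measurable
  have lim: "AE w in cyl. (\<lambda>n. \<gamma> (k n) w) \<longlonglongrightarrow> \<nu> w"
    using k(2) unfolding \<nu>_def by eventually_elim (simp add: convergent_LIMSEQ_iff)
  have "(\<integral>\<^sup>+w. ennreal ((\<nu> w) ^ 6) \<partial>cyl) \<le> (\<integral>\<^sup>+w. liminf (\<lambda>n. ennreal ((\<gamma> (k n) w) ^ 6)) \<partial>cyl)"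
  proof (rule nn_integral_mono_AE)
    show "AE w in cyl. ennreal ((\<nu> w) ^ 6) \<le> liminf (\<lambda>n. ennreal ((\<gamma> (k n) w) ^ 6))"
      using lim
    proof eventually_elim
      case (elim w)
      then have "(\<lambda>n. ennreal ((\<gamma> (k n) w) ^ 6)) \<longlonglongrightarrow> ennreal ((\<nu> w) ^ 6)"
        by (intro tendsto_ennrealI tendsto_power)
      from lim_imp_Liminf[OF sequentially_bot this] show ?case by simp
    qed
  qed
  also have "\<dots> \<le> liminf (\<lambda>n. \<integral>\<^sup>+w. ennreal ((\<gamma> (k n) w) ^ 6) \<partial>cyl)" by (rule nn_integral_liminf) measurable
  also have "\<dots> \<le> liminf (\<lambda>n. ennreal (64 * (4096 * K ^ 3 + 1)))"
    by (intro Liminf_mono always_eventually allI profile_L6 \<gamma>)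
  also have "\<dots> = ennreal (64 * (4096 * K ^ 3 + 1))" by (simp add: Liminf_const)
  finally have L6: "(\<integral>\<^sup>+w. ennreal ((\<nu> w) ^ 6) \<partial>cyl) \<le> ennreal (64 * (4096 * K ^ 3 + 1))" .
  show thesis
    by (rule that[OF k(1) m L6], rule profile_converges_in_measure[OF \<gamma> m lim])
qed

subsection \<open>Convergence in \<open>L\<^sup>p + L\<^sup>q\<close>\<close>

lemma Lp_plus_Lq_norm_le:
  assumes "v1 \<in> Lp M p" "v2 \<in> Lp M q" "\<And>x. v x = v1 x + v2 x"
  shows "Lp_plus_Lq_norm M p q v \<le> Lp_norm M p v1 + Lp_norm M q v2"
  unfolding Lp_plus_Lq_norm_def
proof (rule cInf_lower)
  show "Lp_norm M p v1 + Lp_norm M q v2 \<in> {Lp_norm M p v1 + Lp_norm M q v2 | v1 v2.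
            v1 \<in> Lp M p \<and> v2 \<in> Lp M q \<and> (\<lambda>x. v1 x + v2 x) = v}"
    using assms by (intro CollectI exI conjI ext) auto
  show "bdd_below {Lp_norm M p v1 + Lp_norm M q v2 | v1 v2.
            v1 \<in> Lp M p \<and> v2 \<in> Lp M q \<and> (\<lambda>x. v1 x + v2 x) = v}"
    by (rule bdd_belowI[of _ 0]) (auto simp: Lp_norm_def)
qed

text \<open>Membership guarantees a decomposition, so that the infimum is not taken over the empty
  set, where it is unspecified.\<close>

lemma Lp_plus_Lq_norm_nonneg: "0 \<le> Lp_plus_Lq_norm M p q v" if "v \<in> Lp_plus_Lq M p q"
  unfolding Lp_plus_Lq_norm_def
proof (rule cInf_greatest)
  show "{Lp_norm M p v1 + Lp_norm M q v2 | v1 v2.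
            v1 \<in> Lp M p \<and> v2 \<in> Lp M q \<and> (\<lambda>x. v1 x + v2 x) = v} \<noteq> {}"
    using that unfolding Lp_plus_Lq_def by auto
qed (auto simp: Lp_norm_def)

lemma Lp_intro:
  assumes [measurable]: "f \<in> borel_measurable M"
    and le: "(\<integral>\<^sup>+x. ennreal (\<bar>f x\<bar> powr p) \<partial>M) \<le> ennreal B" and "0 \<le> B" "0 < p"
  shows "f \<in> Lp M p" "Lp_norm M p f \<le> B powr (1 / p)"
proof -
  have int: "integrable M (\<lambda>x. \<bar>f x\<bar> powr p)"
    using le by (intro integrableI_bounded) (auto intro: le_less_trans)
  then show "f \<in> Lp M p" by (simp add: Lp_def)
  have "ennreal (\<integral>x. \<bar>f x\<bar> powr p \<partial>M) \<le> ennreal B"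
    using le int by (simp add: nn_integral_eq_integral)
  then have "(\<integral>x. \<bar>f x\<bar> powr p \<partial>M) \<le> B" using \<open>0 \<le> B\<close> by simp
  then show "Lp_norm M p f \<le> B powr (1 / p)"
    unfolding Lp_norm_def using \<open>0 < p\<close> by (intro powr_mono2) auto
qed

lemma powr_le_powr6_small:
  fixes x e q :: real
  assumes "\<bar>x\<bar> \<le> e" "6 < q" "0 < e"
  shows "\<bar>x\<bar> powr q \<le> e powr (q - 6) * x ^ 6"
proof (cases "x = 0")
  case False
  have "\<bar>x\<bar> powr q = \<bar>x\<bar> powr (q - 6) * \<bar>x\<bar> powr 6" using powr_add[of "\<bar>x\<bar>" "q - 6" 6] by simp
  also have "\<dots> \<le> e powr (q - 6) * \<bar>x\<bar> powr 6"
    using assms by (intro mult_right_mono powr_mono2) auto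
  also have "\<bar>x\<bar> powr 6 = x ^ 6" using False by simp
  finally show ?thesis .
qed simp

lemma powr_le_powr6_large:
  fixes x A p :: real
  assumes "1 \<le> A" "0 < p" "p < 6"
  shows "\<bar>x\<bar> powr p \<le> A powr (p - 6) * x ^ 6 + A powr p"
proof (cases "A \<le> \<bar>x\<bar>")
  case True
  then have x: "0 < \<bar>x\<bar>" using assms by linarith
  have "\<bar>x\<bar> powr p = \<bar>x\<bar> powr (p - 6) * \<bar>x\<bar> powr 6" using powr_add[of "\<bar>x\<bar>" "p - 6" 6] by simp
  also have "\<dots> \<le> A powr (p - 6) * \<bar>x\<bar> powr 6"
    using True assms by (intro mult_right_mono powr_mono2') auto
  also have "\<bar>x\<bar> powr 6 = x ^ 6" using x by simp
  finally show ?thesis by (simp add: add_increasing2)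
next
  case False
  then have "\<bar>x\<bar> powr p \<le> A powr p" using assms by (intro powr_mono2) auto
  then show ?thesis by (simp add: add_increasing)
qed

text \<open>The part below the level e goes to Lq, where q > 6 yields the factor e^(q-6). The part
  above e goes to Lp and is compared with a second level A: beyond A the factor A^(p-6) with p < 6
  is gained, below A the p-th power is at most A^p on a set of measure at most m.\<close>

lemma Lp_plus_Lq_split:
  fixes f :: "'a \<Rightarrow> real"
  assumes [measurable]: "f \<in> borel_measurable M"
    and L6: "(\<integral>\<^sup>+x. ennreal ((f x) ^ 6) \<partial>M) \<le> ennreal B"
    and m: "emeasure M {x \<in> space M. e < \<bar>f x\<bar>} \<le> ennreal m"
    and pos: "0 \<le> B" "0 \<le> m" "0 < e" "1 \<le> A" "0 < p" "p < 6" "6 < q"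
  shows "f \<in> Lp_plus_Lq M p q"
    and "Lp_plus_Lq_norm M p q f \<le> (A powr (p - 6) * B + A powr p * m) powr (1 / p) + (e powr (q - 6) * B) powr (1 / q)"
proof -
  define f1 where "f1 x = (if e < \<bar>f x\<bar> then f x else 0)" for x
  define f2 where "f2 x = (if e < \<bar>f x\<bar> then 0 else f x)" for x
  have [measurable]: "f1 \<in> borel_measurable M" "f2 \<in> borel_measurable M"
    unfolding f1_def[abs_def] f2_def[abs_def] by measurable
  have [measurable]: "{x \<in> space M. e < \<bar>f x\<bar>} \<in> sets M" by measurable
  have "(\<integral>\<^sup>+x. ennreal (\<bar>f1 x\<bar> powr p) \<partial>M)
     \<le> (\<integral>\<^sup>+x. ennreal (A powr (p - 6)) * ennreal ((f x) ^ 6) + ennreal (A powr p) * indicator {x \<in> space M. e < \<bar>f x\<bar>} x \<partial>M)"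
  proof (rule nn_integral_mono)
    fix x assume "x \<in> space M"
    show "ennreal (\<bar>f1 x\<bar> powr p) \<le>
      ennreal (A powr (p - 6)) * ennreal ((f x) ^ 6) + ennreal (A powr p) * indicator {x \<in> space M. e < \<bar>f x\<bar>} x"
    proof (cases "e < \<bar>f x\<bar>")
      case True
      have "ennreal (\<bar>f x\<bar> powr p) \<le> ennreal (A powr (p - 6) * f x ^ 6 + A powr p)"
        using powr_le_powr6_large pos by (intro ennreal_leI) auto
      also have "\<dots> = ennreal (A powr (p - 6)) * ennreal ((f x) ^ 6) + ennreal (A powr p)"
        by (simp add: ennreal_mult)
      finally show ?thesis using True \<open>x \<in> space M\<close> by (simp add: f1_def)
    qed (simp add: f1_def)
  qed
  also have "\<dots> = ennreal (A powr (p - 6)) * (\<integral>\<^sup>+x. ennreal ((f x) ^ 6) \<partial>M)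
      + ennreal (A powr p) * emeasure M {x \<in> space M. e < \<bar>f x\<bar>}"
    by (subst nn_integral_add) (auto simp: nn_integral_cmult nn_integral_cmult_indicator)
  also have "\<dots> \<le> ennreal (A powr (p - 6)) * ennreal B + ennreal (A powr p) * ennreal m"
    by (intro add_mono mult_left_mono L6 m) auto
  also have "\<dots> = ennreal (A powr (p - 6) * B + A powr p * m)"
    using pos by (simp add: ennreal_mult)
  finally have 1: "(\<integral>\<^sup>+x. ennreal (\<bar>f1 x\<bar> powr p) \<partial>M) \<le> ennreal (A powr (p - 6) * B + A powr p * m)" .
  have "(\<integral>\<^sup>+x. ennreal (\<bar>f2 x\<bar> powr q) \<partial>M) \<le> (\<integral>\<^sup>+x. ennreal (e powr (q - 6)) * ennreal ((f x) ^ 6) \<partial>M)"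
    using powr_le_powr6_small[of _ e q] pos
    by (intro nn_integral_mono) (auto simp: f2_def ennreal_mult[symmetric] intro!: ennreal_leI)
  also have "\<dots> = ennreal (e powr (q - 6)) * (\<integral>\<^sup>+x. ennreal ((f x) ^ 6) \<partial>M)"
    by (rule nn_integral_cmult) measurable
  also have "\<dots> \<le> ennreal (e powr (q - 6)) * ennreal B" by (intro mult_left_mono L6) auto
  finally have 2: "(\<integral>\<^sup>+x. ennreal (\<bar>f2 x\<bar> powr q) \<partial>M) \<le> ennreal (e powr (q - 6) * B)"
    using pos by (simp add: ennreal_mult)
  have nn: "0 \<le> A powr (p - 6) * B + A powr p * m" "0 \<le> e powr (q - 6) * B" using pos by auto
  have q: "0 < q" using pos by simp
  have f12: "f x = f1 x + f2 x" for x by (simp add: f1_def f2_def)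
  note L1 = Lp_intro[OF _ 1 nn(1) \<open>0 < p\<close>] and L2 = Lp_intro[OF _ 2 nn(2) q]
  show "f \<in> Lp_plus_Lq M p q"
    unfolding Lp_plus_Lq_def using L1(1) L2(1) f12 by force
  have "Lp_plus_Lq_norm M p q f \<le> Lp_norm M p f1 + Lp_norm M q f2"
    by (rule Lp_plus_Lq_norm_le[OF L1(1) L2(1) f12]) measurable
  also have "\<dots> \<le> (A powr (p - 6) * B + A powr p * m) powr (1 / p) + (e powr (q - 6) * B) powr (1 / q)"
    by (intro add_mono L1(2) L2(2)) measurable
  finally show "Lp_plus_Lq_norm M p q f \<le> (A powr (p - 6) * B + A powr p * m) powr (1 / p) + (e powr (q - 6) * B) powr (1 / q)" .
qed

lemma emeasure_level_le_L6:
  fixes f :: "'a \<Rightarrow> real"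
  assumes [measurable]: "f \<in> borel_measurable M"
    and L6: "(\<integral>\<^sup>+x. ennreal ((f x) ^ 6) \<partial>M) \<le> ennreal B" and "0 < t" "0 \<le> B"
  shows "emeasure M {x \<in> space M. t < \<bar>f x\<bar>} \<le> ennreal (B / t ^ 6)"
proof -
  have [measurable]: "{x \<in> space M. t < \<bar>f x\<bar>} \<in> sets M" by measurable
  have "emeasure M {x \<in> space M. t < \<bar>f x\<bar>} = (\<integral>\<^sup>+x. indicator {x \<in> space M. t < \<bar>f x\<bar>} x \<partial>M)" by simp
  also have "\<dots> \<le> (\<integral>\<^sup>+x. ennreal (1 / t ^ 6) * ennreal ((f x) ^ 6) \<partial>M)"
  proof (rule nn_integral_mono)
    fix x
    have "1 \<le> 1 / t ^ 6 * (f x) ^ 6" if "t < \<bar>f x\<bar>"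
    proof -
      have "t ^ 6 \<le> \<bar>f x\<bar> ^ 6" using that \<open>0 < t\<close> by (intro power_mono) auto
      then show ?thesis using \<open>0 < t\<close> by simp
    qed
    then show "indicator {x \<in> space M. t < \<bar>f x\<bar>} x \<le> ennreal (1 / t ^ 6) * ennreal ((f x) ^ 6)"
      using \<open>0 < t\<close> by (auto split: split_indicator simp: ennreal_mult[symmetric] ennreal_ge_1)
  qed
  also have "\<dots> = ennreal (1 / t ^ 6) * (\<integral>\<^sup>+x. ennreal ((f x) ^ 6) \<partial>M)" by (rule nn_integral_cmult) measurable
  also have "\<dots> \<le> ennreal (1 / t ^ 6) * ennreal B" by (intro mult_left_mono L6) auto
  finally show ?thesis using assms by (simp flip: ennreal_mult)
qed

lemma L6_in_Lp_plus_Lq: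
  fixes f :: "'a \<Rightarrow> real"
  assumes "f \<in> borel_measurable M" "(\<integral>\<^sup>+x. ennreal ((f x) ^ 6) \<partial>M) \<le> ennreal B" "0 \<le> B"
    and "0 < p" "p < 6" "6 < q"
  shows "f \<in> Lp_plus_Lq M p q"
  using Lp_plus_Lq_split(1)[OF assms(1,2) emeasure_level_le_L6[OF assms(1,2) zero_less_one assms(3)],
      of 1 p q] assms by simp

lemma Lp_plus_Lq_tendsto_0:
  fixes f :: "nat \<Rightarrow> 'a \<Rightarrow> real"
  assumes f: "\<And>n. f n \<in> borel_measurable M"
    and L6: "\<And>n. (\<integral>\<^sup>+x. ennreal ((f n x) ^ 6) \<partial>M) \<le> ennreal B"
    and meas: "\<And>e. 0 < e \<Longrightarrow> (\<lambda>n. emeasure M {x \<in> space M. e < \<bar>f n x\<bar>}) \<longlonglongrightarrow> 0"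
    and pos: "0 \<le> B" "0 < p" "p < 6" "6 < q"
  shows "(\<lambda>n. Lp_plus_Lq_norm M p q (f n)) \<longlonglongrightarrow> 0"
proof (rule LIMSEQ_I)
  fix d :: real assume "0 < d"
  \<comment> \<open>The budget for the p-th power of the Lp part; one half goes to the values above
    A, the other to the measure term. The order of choice is e, A, m, then n.\<close>
  define a where "a = (d / 4) powr p"
  have "0 < a" using \<open>0 < d\<close> by (simp add: a_def)
  have "((\<lambda>e. e powr (q - 6)) \<longlongrightarrow> 0) (at_right 0)"
  proof (rule tendsto_zero_powrI)
    show "((\<lambda>e::real. q - 6) \<longlongrightarrow> q - 6) (at_right 0)" by (rule tendsto_const)
    show "((\<lambda>e::real. e) \<longlongrightarrow> 0) (at_right 0)" by (rule tendsto_ident_at)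
    show "\<forall>\<^sub>F e in at_right 0. 0 \<le> (e::real)"
      using eventually_at_right_less[of "0::real"] by eventually_elim simp
  qed (use pos in auto)
  then have "((\<lambda>e. e powr (q - 6) * B) \<longlongrightarrow> 0 * B) (at_right 0)" by (intro tendsto_mult tendsto_const)
  then have "\<forall>\<^sub>F e in at_right 0. e powr (q - 6) * B < (d / 4) powr q"
    using \<open>0 < d\<close> by (intro order_tendstoD(2)) auto
  moreover have "\<forall>\<^sub>F e in at_right 0. (0::real) < e" by (simp add: eventually_at_right_less)
  ultimately have "\<forall>\<^sub>F e in at_right (0::real). 0 < e \<and> e powr (q - 6) * B < (d / 4) powr q" by eventually_elim auto
  then obtain e where e: "0 < e" "e powr (q - 6) * B < (d / 4) powr q"
    by (metis (mono_tags, lifting) eventually_happens trivial_limit_at_right_real)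
  have "((\<lambda>A. A powr (p - 6)) \<longlongrightarrow> 0) at_top" using pos by (intro tendsto_neg_powr filterlim_ident) auto
  then have "((\<lambda>A. A powr (p - 6) * B) \<longlongrightarrow> 0 * B) at_top" by (intro tendsto_mult tendsto_const)
  then have "\<forall>\<^sub>F A in at_top. A powr (p - 6) * B < a / 2" using \<open>0 < a\<close> by (intro order_tendstoD(2)) auto
  then have "\<forall>\<^sub>F A in at_top. 1 \<le> A \<and> A powr (p - 6) * B < a / 2"
    using eventually_ge_at_top[of 1] by eventually_elim auto
  then obtain A where A: "1 \<le> A" "A powr (p - 6) * B < a / 2"
    by (metis (mono_tags, lifting) eventually_happens trivial_limit_at_top_linorder)
  define m where "m = a / (2 * A powr p)"
  have "0 < m" using \<open>0 < a\<close> A by (simp add: m_def)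
  have "\<forall>\<^sub>F n in sequentially. emeasure M {x \<in> space M. e < \<bar>f n x\<bar>} < ennreal m"
    using meas[OF e(1)] \<open>0 < m\<close> by (intro order_tendstoD(2)) auto
  then have "\<forall>\<^sub>F n in sequentially. norm (Lp_plus_Lq_norm M p q (f n) - 0) < d"
  proof eventually_elim
    case (elim n)
    note split = Lp_plus_Lq_split[OF f L6 less_imp_le[OF elim] pos(1) less_imp_le[OF \<open>0 < m\<close>] e(1) A(1) pos(2-4)]
    have "A powr (p - 6) * B + A powr p * m \<le> a" using A by (simp add: m_def)
    then have "(A powr (p - 6) * B + A powr p * m) powr (1 / p) \<le> a powr (1 / p)"
      using pos A \<open>0 < m\<close> by (intro powr_mono2) auto
    also have "\<dots> = d / 4" using \<open>0 < d\<close> pos by (simp add: a_def powr_powr)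
    finally have 1: "(A powr (p - 6) * B + A powr p * m) powr (1 / p) \<le> d / 4" .
    have "(e powr (q - 6) * B) powr (1 / q) \<le> ((d / 4) powr q) powr (1 / q)"
      using pos e by (intro powr_mono2) auto
    also have "\<dots> = d / 4" using \<open>0 < d\<close> pos by (simp add: powr_powr)
    finally have "Lp_plus_Lq_norm M p q (f n) \<le> d / 4 + d / 4" using split(2) 1 by linarith
    then show ?case using Lp_plus_Lq_norm_nonneg[OF split(1)] \<open>0 < d\<close> by simp
  qed
  then show "\<exists>N. \<forall>n\<ge>N. norm (Lp_plus_Lq_norm M p q (f n) - 0) < d"
    by (simp add: eventually_sequentially)
qed

text \<open>The point is finiteness of the layer-cake integral for z > 0: on infinite values
  \<open>enn2real\<close> would not be monotone. By Chebyshev's inequality, z can lie in the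
  symmetric interval of level t > 1 only if 2 z < B / t^6, so the levels that contribute are
  bounded.\<close>

lemma sym_decreasing_schwarz_rearrangement:
  fixes f :: "real \<Rightarrow> real"
  assumes [measurable]: "f \<in> borel_measurable borel"
    and fin: "(\<integral>\<^sup>+z. ennreal ((f z) ^ 6) \<partial>lborel) < \<infinity>"
  shows "sym_decreasing (schwarz_rearrangement f)"
proof -
  define B where "B = enn2real (\<integral>\<^sup>+z. ennreal ((f z) ^ 6) \<partial>lborel)"
  have "0 \<le> B" by (simp add: B_def)
  have L6: "(\<integral>\<^sup>+z. ennreal ((f z) ^ 6) \<partial>lborel) \<le> ennreal B" using fin by (simp add: B_def)
  have fin_z: "(\<integral>\<^sup>+ t\<in>{0..}. indicator (sym_interval {w. \<bar>f w\<bar> > t}) z \<partial>lborel) < \<infinity>" if z: "0 < z" for z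
  proof -
    \<comment> \<open>Levels t \<le> 1 are covered by the 1; for t > 1 one has t \<le> t^6 < B / (2
      z).\<close>
    define b where "b = max 1 (B / (2 * z))"
    have "(\<integral>\<^sup>+ t\<in>{0..}. indicator (sym_interval {w. \<bar>f w\<bar> > t}) z \<partial>lborel) \<le> (\<integral>\<^sup>+t. indicator {0..b} t \<partial>lborel)"
    proof (rule nn_integral_mono)
      fix t :: real
      have "t \<le> b" if "z \<in> sym_interval {w. \<bar>f w\<bar> > t}"
      proof (cases "t \<le> 1")
        case False
        have "ennreal (2 * z) < emeasure lborel {w. t < \<bar>f w\<bar>}" using that z by (simp add: sym_interval_def)
        also have "\<dots> \<le> ennreal (B / t ^ 6)"
          using emeasure_level_le_L6[of f lborel B t] L6 False \<open>0 \<le> B\<close> by simp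
        finally have "2 * z < B / t ^ 6" using z by (simp add: ennreal_less_iff)
        then have "t ^ 6 * (2 * z) < B" using False by (simp add: less_divide_eq mult.commute)
        then have "t ^ 6 < B / (2 * z)" using z by (simp add: less_divide_eq)
        moreover have "t \<le> t ^ 6" using False self_le_power[of t 6] by simp
        ultimately show ?thesis by (simp add: b_def)
      qed (simp add: b_def)
      then show "indicator (sym_interval {w. \<bar>f w\<bar> > t}) z * indicator {0..} t \<le> (indicator {0..b} t :: ennreal)"
        by (auto split: split_indicator)
    qed
    also have "\<dots> < \<infinity>" by (simp add: b_def)
    finally show ?thesis .
  qed
  show ?thesis
    unfolding sym_decreasing_def
  proof (intro conjI allI impI)
    show "0 \<le> schwarz_rearrangement f z" for z by (simp add: schwarz_rearrangement_def)
    show "schwarz_rearrangement f (- z) = schwarz_rearrangement f z" for z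
      by (simp add: schwarz_rearrangement_def sym_interval_def indicator_def)
    fix x y :: real assume "0 < x" "x \<le> y"
    have "z2 \<in> sym_interval A \<Longrightarrow> z1 \<in> sym_interval A" if "0 < z1" "z1 \<le> z2" for z1 z2 A
      using that by (auto simp: sym_interval_def intro: le_less_trans[rotated] ennreal_leI)
    then show "schwarz_rearrangement f y \<le> schwarz_rearrangement f x"
      unfolding schwarz_rearrangement_def using fin_z[OF \<open>0 < x\<close>] \<open>0 < x\<close> \<open>x \<le> y\<close>
      by (intro enn2real_mono nn_integral_mono mult_right_mono) (auto split: split_indicator)
  qed
qed

subsection \<open>Transfer between the half plane and space\<close>

text \<open>Makes integrals over \<open>cyl\<close> measurable in the slope on which the integrand
  depends.\<close>

interpretation cyl: sigma_finite_measure cyl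
  unfolding cyl_def by (rule sigma_finite_measure.sigma_finite_iff_density_finite[OF sigma_finite_lborel, THEN iffD2]) auto

lemma nn_integral_reflect_fst:
  fixes k :: "real \<times> 'b::euclidean_space \<Rightarrow> ennreal"
  assumes [measurable]: "k \<in> borel_measurable borel"
  shows "(\<integral>\<^sup>+w. k w \<partial>lborel) = (\<integral>\<^sup>+w. indicator {0<..} (fst w) * (k w + k (- fst w, snd w)) \<partial>lborel)"
proof -
  define k' where "k' x = (\<integral>\<^sup>+y. k (x, y) \<partial>lborel)" for x
  have [measurable]: "k' \<in> borel_measurable borel" unfolding k'_def[abs_def] by measurable
  have "(\<integral>\<^sup>+w. k w \<partial>lborel) = (\<integral>\<^sup>+x. k' x \<partial>lborel)"
    unfolding k'_def by (rule nn_integral_lborel_pair) measurable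
  also have "\<dots> = (\<integral>\<^sup>+x. indicator {0<..} x * k' x + indicator {..<0} x * k' x \<partial>lborel)"
    using AE_lborel_singleton[of "0::real"]
    by (intro nn_integral_cong_AE, elim eventually_mono) (auto split: split_indicator)
  also have "\<dots> = (\<integral>\<^sup>+x. indicator {0<..} x * k' x \<partial>lborel) + (\<integral>\<^sup>+x. indicator {..<0} x * k' x \<partial>lborel)"
    by (rule nn_integral_add) auto
  also have "(\<integral>\<^sup>+x. indicator {..<0} x * k' x \<partial>lborel) = (\<integral>\<^sup>+x. indicator {0<..} x * k' (- x) \<partial>lborel)"
    by (subst nn_integral_real_affine[where c = "-1" and t = 0])
      (auto intro!: nn_integral_cong split: split_indicator)
  also have "(\<integral>\<^sup>+x. indicator {0<..} x * k' x \<partial>lborel) + (\<integral>\<^sup>+x. indicator {0<..} x * k' (- x) \<partial>lborel)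
      = (\<integral>\<^sup>+x. indicator {0<..} x * k' x + indicator {0<..} x * k' (- x) \<partial>lborel)"
    by (rule nn_integral_add[symmetric]) auto
  also have "\<dots> = (\<integral>\<^sup>+w. indicator {0<..} (fst w) * (k w + k (- fst w, snd w)) \<partial>lborel)"
    by (subst nn_integral_lborel_pair)
      (auto intro!: nn_integral_cong simp: k'_def nn_integral_add nn_integral_cmult distrib_left)
  finally show ?thesis .
qed

section \<open>Slope coordinates of space\<close>

definition polar :: "real \<Rightarrow> real \<times> real \<Rightarrow> R3" where
  "polar t w = (fst w * slope_cos t, fst w * (t * slope_cos t), snd w)"

text \<open>For r > 0 a slope reaches only the half planes with x > 0; those with x < 0 are their
  mirror images in the first coordinate.\<close>

definition polar' :: "real \<Rightarrow> real \<times> real \<Rightarrow> R3" where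
  "polar' t w = (- (fst w * slope_cos t), fst w * (t * slope_cos t), snd w)"

lemma polar_measurable [measurable (raw)]:
  assumes [measurable]: "f \<in> borel_measurable M" "g \<in> borel_measurable M"
  shows "(\<lambda>x. polar (f x) (g x)) \<in> borel_measurable M" "(\<lambda>x. polar' (f x) (g x)) \<in> borel_measurable M"
  unfolding polar_def polar'_def by measurable

lemma polar_norm:
  "norm (fst (polar t w), fst (snd (polar t w))) = \<bar>fst w\<bar>" "snd (snd (polar t w)) = snd w"
  "norm (fst (polar' t w), fst (snd (polar' t w))) = \<bar>fst w\<bar>" "snd (snd (polar' t w)) = snd w"
proof -
  have eq: "(r * slope_cos t)\<^sup>2 + (r * (t * slope_cos t))\<^sup>2 = r\<^sup>2" for r
    using slope_cos_sq[of t] by (simp add: power_mult_distrib flip: distrib_left)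
  then have "sqrt ((r * slope_cos t)\<^sup>2 + (r * (t * slope_cos t))\<^sup>2) = \<bar>r\<bar>" for r
    by simp
  then show "norm (fst (polar t w), fst (snd (polar t w))) = \<bar>fst w\<bar>"
    "norm (fst (polar' t w), fst (snd (polar' t w))) = \<bar>fst w\<bar>"
    unfolding polar_def polar'_def norm_Pair by (simp_all only: fst_conv snd_conv real_norm_def power2_abs abs_minus_cancel)
qed (simp_all add: polar_def polar'_def)

lemma nn_integral_half_space_polar:
  fixes h :: "R3 \<Rightarrow> ennreal"
  assumes [measurable]: "h \<in> borel_measurable borel"
  shows "(\<integral>\<^sup>+w. indicator {0<..} (fst w) * h w \<partial>lborel) =
    (\<integral>\<^sup>+t. ennreal ((slope_cos t)\<^sup>2) * (\<integral>\<^sup>+w. h (polar t w) \<partial>cyl) \<partial>lborel)"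
  by (simp add: nn_integral_half_space polar_def split_beta')

lemma nn_integral_polar:
  fixes h :: "R3 \<Rightarrow> ennreal"
  assumes [measurable]: "h \<in> borel_measurable borel"
  shows "(\<integral>\<^sup>+w. h w \<partial>lborel) =
    (\<integral>\<^sup>+t. ennreal ((slope_cos t)\<^sup>2) * (\<integral>\<^sup>+w. h (polar t w) + h (polar' t w) \<partial>cyl) \<partial>lborel)"
  by (subst nn_integral_reflect_fst, measurable, subst nn_integral_half_space_polar, measurable)
    (simp add: polar_def polar'_def)

lemma AE_polar:
  assumes "AE w in lborel. P w"
  shows "AE t in lborel. AE w in cyl. P (polar t w) \<and> P (polar' t w)"
proof -
  obtain N where N: "{w \<in> space lborel. \<not> P w} \<subseteq> N" "emeasure lborel N = 0" "N \<in> sets lborel"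
    using assms by (rule AE_E)
  then have [measurable]: "N \<in> sets borel" by simp
  have "(\<integral>\<^sup>+t. ennreal ((slope_cos t)\<^sup>2) * (\<integral>\<^sup>+w. indicator N (polar t w) + indicator N (polar' t w) \<partial>cyl) \<partial>lborel)
      = (\<integral>\<^sup>+w. indicator N w \<partial>lborel)"
    by (rule nn_integral_polar[symmetric]) measurable
  also have "\<dots> = 0" using N by simp
  finally have "AE t in lborel. ennreal ((slope_cos t)\<^sup>2) * (\<integral>\<^sup>+w. indicator N (polar t w) + indicator N (polar' t w) \<partial>cyl) = 0"
    by (subst (asm) nn_integral_0_iff_AE) measurable
  then show ?thesis
  proof eventually_elim
    case (elim t)
    then have "(\<integral>\<^sup>+w. indicator N (polar t w) + indicator N (polar' t w) \<partial>cyl) = 0"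
      by simp
    then have "AE w in cyl. indicator N (polar t w) + indicator N (polar' t w) = (0 :: ennreal)"
      by (subst (asm) nn_integral_0_iff_AE) measurable
    then show ?case
      by eventually_elim (use N(1) in \<open>auto simp: indicator_def split: if_splits\<close>)
  qed
qed

lemma AE_plane_polar:
  fixes P :: "real \<times> real \<Rightarrow> bool"
  assumes "AE w in lborel. P w"
  shows "AE t in lborel. AE s in lborel. 0 < s \<longrightarrow>
    P (s * slope_cos t, s * (t * slope_cos t)) \<and> P (- (s * slope_cos t), s * (t * slope_cos t))"
proof -
  obtain N where N: "{w \<in> space lborel. \<not> P w} \<subseteq> N" "emeasure lborel N = 0" "N \<in> sets lborel"
    using assms by (rule AE_E)
  then have [measurable]: "N \<in> sets borel" by simp
  define k where "k w = (indicator N w + indicator N (- fst w, snd w) :: ennreal)" for w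
  have [measurable]: "k \<in> borel_measurable borel" unfolding k_def[abs_def] by measurable
  have "(\<integral>\<^sup>+t. ennreal ((slope_cos t)\<^sup>2) * (\<integral>\<^sup>+s. ennreal s * k (s * slope_cos t, s * (t * slope_cos t)) \<partial>lborel) \<partial>lborel)
     = (\<integral>\<^sup>+x. indicator {0<..} x * (\<integral>\<^sup>+y. k (x, y) \<partial>lborel) \<partial>lborel)"
    by (rule nn_integral_half_plane[symmetric]) measurable
  also have "\<dots> = (\<integral>\<^sup>+w. indicator {0<..} (fst w) * k w \<partial>lborel)"
    by (subst nn_integral_lborel_pair) (auto simp: nn_integral_cmult)
  also have "\<dots> = (\<integral>\<^sup>+w. indicator N w \<partial>lborel)"
    unfolding k_def by (rule nn_integral_reflect_fst[symmetric]) measurable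
  also have "\<dots> = 0" using N by simp
  finally have "AE t in lborel. ennreal ((slope_cos t)\<^sup>2) * (\<integral>\<^sup>+s. ennreal s * k (s * slope_cos t, s * (t * slope_cos t)) \<partial>lborel) = 0"
    by (subst (asm) nn_integral_0_iff_AE) measurable
  then show ?thesis
  proof eventually_elim
    case (elim t)
    then have "(\<integral>\<^sup>+s. ennreal s * k (s * slope_cos t, s * (t * slope_cos t)) \<partial>lborel) = 0" by simp
    then have "AE s in lborel. ennreal s * k (s * slope_cos t, s * (t * slope_cos t)) = 0"
      by (subst (asm) nn_integral_0_iff_AE) measurable
    then show ?case
      by eventually_elim (use N(1) in \<open>auto simp: k_def indicator_def split: if_splits\<close>)
  qed
qed

lemma AE_lborel_ex:
  assumes "AE t in (lborel :: real measure). P t"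
  shows "\<exists>t. P t"
proof (rule ccontr)
  assume "\<not> (\<exists>t. P t)"
  then have "AE t in (lborel :: real measure). False" using assms by simp
  then have "ae_filter (lborel :: real measure) = bot" by (simp only: eventually_False)
  then show False by (simp add: ae_filter_eq_bot_iff)
qed

text \<open>The radial function provided by \<open>radial_ae\<close> depends on z without any joint
  measurability, so \<gamma> cannot be assembled from it. Instead u is compared on two half planes:
  for almost all pairs of slopes it agrees on them, and Fubini supplies one slope \<open>t0\<close>
  on which u serves as \<gamma>.\<close>

lemma radial_profile:
  fixes u :: "R3 \<Rightarrow> real"
  assumes [measurable]: "u \<in> borel_measurable borel"
    and rad: "AE z in lborel. radial_ae (\<lambda>(x, y). u (x, y, z))"
  obtains \<gamma> where "\<gamma> \<in> borel_measurable borel"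
    "AE t in lborel. AE w in cyl. u (polar t w) = \<gamma> w \<and> u (polar' t w) = \<gamma> w"
proof -
  define t t' w where "t v = fst (fst v)" and "t' v = fst (snd (fst v))" and "w v = (snd (snd (fst v)), snd v)"
    for v :: "(real \<times> real \<times> real) \<times> real"
  have [measurable]: "t \<in> borel_measurable borel" "t' \<in> borel_measurable borel" "w \<in> borel_measurable borel"
    unfolding t_def[abs_def] t'_def[abs_def] w_def[abs_def]
    by (intro borel_measurable_continuous_onI continuous_intros)+
  \<comment> \<open>Mentions u alone and is therefore jointly measurable, which permits moving the
    quantifier over z behind those over the slopes and the radius.\<close>
  define Q where "Q v \<longleftrightarrow> (0 < fst (w v) \<longrightarrow>
     u (polar (t' v) (w v)) = u (polar (t v) (w v)) \<and> u (polar' (t' v) (w v)) = u (polar (t v) (w v)))" for v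
  have [measurable]: "Measurable.pred borel Q"
    unfolding Q_def[abs_def] by measurable
  have "AE z in lborel. AE v in lborel. Q (v, z)"
    using rad
  proof eventually_elim
    case (elim z)
    then obtain g where g: "AE w in lborel. (case w of (x, y) \<Rightarrow> u (x, y, z)) = g (norm w)"
      unfolding radial_ae_def by blast
    have norm: "norm (s * slope_cos t, s * (t * slope_cos t)) = \<bar>s\<bar>" "norm (- (s * slope_cos t), s * (t * slope_cos t)) = \<bar>s\<bar>" for s t
      using polar_norm(1)[of t "(s, z)"] polar_norm(3)[of t "(s, z)"] by (simp_all add: polar_def polar'_def)
    define R where "R t \<longleftrightarrow> (AE s in lborel. 0 < s \<longrightarrow> u (polar t (s, z)) = g s \<and> u (polar' t (s, z)) = g s)" for t
    have R: "AE t in lborel. R t"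
      using AE_plane_polar[OF g] unfolding R_def polar_def polar'_def
    proof eventually_elim
      case (elim t)
      then show ?case by eventually_elim (auto simp: norm)
    qed
    have "AE t in lborel. AE t' in lborel. AE s in lborel. Q ((t, t', s), z)"
      using R
    proof eventually_elim
      case t: (elim t)
      show ?case using R
      proof eventually_elim
        case (elim t')
        with t show ?case unfolding R_def by eventually_elim (auto simp: Q_def t_def t'_def w_def)
      qed
    qed
    then show ?case
      by (subst AE_lborel_pair_iff, measurable, subst AE_lborel_pair_iff, measurable)
  qed
  then have "AE v in lborel. AE z in lborel. Q (v, z)"
    by (subst AE_lborel_swap) measurable
  then have "AE t in lborel. AE v in lborel. AE z in lborel. Q ((t, v), z)"
    by (rule AE_lborel_pairD)
  then obtain t0 where "AE v in lborel. AE z in lborel. Q ((t0, v), z)" using AE_lborel_ex by blast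
  then have *: "AE t in lborel. AE s in lborel. AE z in lborel. Q ((t0, t, s), z)"
    by (rule AE_lborel_pairD)
  define \<gamma> where "\<gamma> w = u (polar t0 w)" for w
  have [measurable]: "\<gamma> \<in> borel_measurable borel" unfolding \<gamma>_def[abs_def] by measurable
  have "AE t in lborel. AE w in cyl. u (polar t w) = \<gamma> w \<and> u (polar' t w) = \<gamma> w"
    using *
  proof eventually_elim
    case (elim t)
    have m: "Measurable.pred borel (\<lambda>w. u (polar t w) = \<gamma> w \<and> u (polar' t w) = \<gamma> w)" by measurable
    show ?case
      unfolding AE_cyl_iff[OF m] using elim
      by eventually_elim (auto simp: Q_def t_def t'_def w_def \<gamma>_def elim: eventually_mono)
  qed
  then show thesis by (rule that[rotated]) measurable
qed

text \<open>The half plane formula is applied to the unit disc: its area is finite and equals or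
  exceeds the integral in question times the radial factor \<open>J\<close>, which is not
  zero.\<close>

lemma nn_integral_slope_cos_finite: "(\<integral>\<^sup>+t. ennreal ((slope_cos t)\<^sup>2) \<partial>lborel) < \<infinity>"
proof -
  have [measurable]: "cball (0 :: real \<times> real) 1 \<in> sets borel" by (intro borel_closed closed_cball)
  define J where "J = (\<integral>\<^sup>+s. ennreal s * indicator {..1} s \<partial>lborel)"
  have "(\<integral>\<^sup>+s. ennreal (1/2) * indicator {1/2..1::real} s \<partial>lborel) \<le> J"
    unfolding J_def
  proof (rule nn_integral_mono)
    fix s :: real
    show "ennreal (1/2) * indicator {1/2..1} s \<le> ennreal s * indicator {..1} s"
      using ennreal_leI[of "1/2" s] by (auto split: split_indicator)
  qed
  then have "J \<noteq> 0" by (subst (asm) nn_integral_cmult_indicator) (auto simp: ennreal_mult[symmetric])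
  have m: "(\<lambda>w. indicator (cball 0 1) w :: ennreal) \<in> borel_measurable (borel :: (real \<times> real) measure)" by measurable
  have "norm (s * slope_cos t, s * (t * slope_cos t)) = \<bar>s\<bar>" for s t
    using polar_norm(1)[of t "(s, 0)"] by (simp add: polar_def)
  then have eq: "ennreal s * indicator (cball 0 1) (s * slope_cos t, s * (t * slope_cos t)) = ennreal s * indicator {..1} s" for s t
    by (cases "0 \<le> s") (auto split: split_indicator simp: ennreal_neg)
  have "(\<integral>\<^sup>+t. ennreal ((slope_cos t)\<^sup>2) \<partial>lborel) * J
     = (\<integral>\<^sup>+t. ennreal ((slope_cos t)\<^sup>2) * (\<integral>\<^sup>+s. ennreal s * indicator (cball 0 1) (s * slope_cos t, s * (t * slope_cos t)) \<partial>lborel) \<partial>lborel)"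
    unfolding eq J_def[symmetric] by (rule nn_integral_multc[symmetric]) measurable
  also have "\<dots> = (\<integral>\<^sup>+x. indicator {0<..} x * (\<integral>\<^sup>+y. indicator (cball 0 1) (x :: real, y :: real) \<partial>lborel) \<partial>lborel)"
    by (rule nn_integral_half_plane[OF m, symmetric])
  also have "\<dots> \<le> (\<integral>\<^sup>+x. (\<integral>\<^sup>+y. indicator (cball 0 1) (x :: real, y :: real) \<partial>lborel) \<partial>lborel)"
    by (intro nn_integral_mono) (auto split: split_indicator)
  also have "\<dots> = (\<integral>\<^sup>+w. indicator (cball 0 1) (w :: real \<times> real) \<partial>lborel)"
    by (rule nn_integral_lborel_pair[symmetric]) measurable
  also have "\<dots> < \<infinity>" using emeasure_lborel_cball_finite[of "0 :: real \<times> real" 1] by simp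
  finally show ?thesis using \<open>J \<noteq> 0\<close> by (auto simp: ennreal_mult_less_top)
qed

definition cyl_const :: real where
  "cyl_const = 2 * enn2real (\<integral>\<^sup>+t. ennreal ((slope_cos t)\<^sup>2) \<partial>lborel)"

text \<open>The constant is \<open>2 \<pi>\<close>, but only its finiteness matters.\<close>

lemma nn_integral_radial:
  fixes h :: "R3 \<Rightarrow> ennreal" and k :: "real \<times> real \<Rightarrow> ennreal"
  assumes [measurable]: "h \<in> borel_measurable borel" "k \<in> borel_measurable borel"
    and eq: "AE t in lborel. AE w in cyl. h (polar t w) = k w \<and> h (polar' t w) = k w"
  shows "(\<integral>\<^sup>+w. h w \<partial>lborel) = ennreal cyl_const * (\<integral>\<^sup>+w. k w \<partial>cyl)"
proof -
  have "(\<integral>\<^sup>+w. h w \<partial>lborel) = (\<integral>\<^sup>+t. ennreal ((slope_cos t)\<^sup>2) * (\<integral>\<^sup>+w. h (polar t w) + h (polar' t w) \<partial>cyl) \<partial>lborel)"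
    by (rule nn_integral_polar) measurable
  also have "\<dots> = (\<integral>\<^sup>+t. ennreal ((slope_cos t)\<^sup>2) * (\<integral>\<^sup>+w. 2 * k w \<partial>cyl) \<partial>lborel)"
  proof (rule nn_integral_cong_AE)
    show "AE t in lborel. ennreal ((slope_cos t)\<^sup>2) * (\<integral>\<^sup>+w. h (polar t w) + h (polar' t w) \<partial>cyl)
       = ennreal ((slope_cos t)\<^sup>2) * (\<integral>\<^sup>+w. 2 * k w \<partial>cyl)"
      using eq
    proof eventually_elim
      case (elim t)
      then have "AE w in cyl. h (polar t w) + h (polar' t w) = 2 * k w"
        by eventually_elim (simp add: mult_2)
      then have "(\<integral>\<^sup>+w. h (polar t w) + h (polar' t w) \<partial>cyl) = (\<integral>\<^sup>+w. 2 * k w \<partial>cyl)"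
        by (rule nn_integral_cong_AE)
      then show ?case by simp
    qed
  qed
  also have "\<dots> = (\<integral>\<^sup>+t. ennreal ((slope_cos t)\<^sup>2) \<partial>lborel) * (2 * (\<integral>\<^sup>+w. k w \<partial>cyl))"
    by (simp add: nn_integral_multc nn_integral_cmult)
  also have "\<dots> = (2 * (\<integral>\<^sup>+t. ennreal ((slope_cos t)\<^sup>2) \<partial>lborel)) * (\<integral>\<^sup>+w. k w \<partial>cyl)"
    by (simp add: mult_ac)
  also have "2 * (\<integral>\<^sup>+t. ennreal ((slope_cos t)\<^sup>2) \<partial>lborel) = ennreal cyl_const"
    using nn_integral_slope_cos_finite by (simp add: cyl_const_def ennreal_mult)
  finally show ?thesis .
qed

text \<open>Since \<gamma> does not depend on the slope, one slope on which both almost-everywhere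
  identities hold is enough. Finiteness of the L6 integral then puts almost every vertical line of
  that half plane within reach of \<open>sym_decreasing_schwarz_rearrangement\<close>.\<close>

lemma z_symmetric_profile:
  fixes u :: "R3 \<Rightarrow> real"
  assumes [measurable]: "u \<in> borel_measurable borel" "\<gamma> \<in> borel_measurable borel"
    and \<gamma>: "AE t in lborel. AE w in cyl. u (polar t w) = \<gamma> w \<and> u (polar' t w) = \<gamma> w"
    and sym: "AE w in lborel. z_rearrangement u w = u w"
    and fin: "(\<integral>\<^sup>+w. ennreal ((\<gamma> w) ^ 6) \<partial>cyl) < \<infinity>"
  shows "cyl_decreasing \<gamma>"
proof -
  have "AE t in lborel. (AE w in cyl. u (polar t w) = \<gamma> w) \<and> (AE w in cyl. z_rearrangement u (polar t w) = u (polar t w))"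
    using \<gamma> AE_polar[OF sym] by eventually_elim (auto elim: eventually_mono)
  then obtain t where t: "AE w in cyl. u (polar t w) = \<gamma> w" "AE w in cyl. z_rearrangement u (polar t w) = u (polar t w)"
    using AE_lborel_ex by blast
  have "(\<integral>\<^sup>+r. ennreal r * (\<integral>\<^sup>+z. ennreal ((\<gamma> (r, z)) ^ 6) \<partial>lborel) \<partial>lborel) \<noteq> \<infinity>"
    using fin by (subst (asm) nn_integral_cyl) auto
  then have "AE r in lborel. ennreal r * (\<integral>\<^sup>+z. ennreal ((\<gamma> (r, z)) ^ 6) \<partial>lborel) \<noteq> \<infinity>"
    by (intro nn_integral_PInf_AE) measurable
  with AE_cylD[OF t(1)] AE_cylD[OF t(2)] show ?thesis
    unfolding cyl_decreasing_def
  proof eventually_elim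
    case (elim r)
    show ?case
    proof
      assume "0 < r"
      define f where "f z = u (polar t (r, z))" for z
      have [measurable]: "f \<in> borel_measurable borel" unfolding f_def[abs_def] by measurable
      have f\<gamma>: "AE z in lborel. f z = \<gamma> (r, z)" using elim \<open>0 < r\<close> by (simp add: f_def)
      \<comment> \<open>\<open>polar t\<close> maps vertical lines to vertical lines, so on this
        line \<open>z_rearrangement u\<close> is the one-variable rearrangement of f.\<close>
      have fs: "AE z in lborel. schwarz_rearrangement f z = f z"
        using elim \<open>0 < r\<close> by (simp add: f_def[abs_def] polar_def z_rearrangement_def)
      have "(\<integral>\<^sup>+z. ennreal ((f z) ^ 6) \<partial>lborel) = (\<integral>\<^sup>+z. ennreal ((\<gamma> (r, z)) ^ 6) \<partial>lborel)"
        using f\<gamma> by (intro nn_integral_cong_AE) (auto elim: eventually_mono)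
      also have "\<dots> < \<infinity>"
        using elim(3) \<open>0 < r\<close> by (auto simp: less_top ennreal_mult_eq_top_iff)
      finally have "sym_decreasing (schwarz_rearrangement f)"
        by (intro sym_decreasing_schwarz_rearrangement) auto
      moreover have "AE z in lborel. \<gamma> (r, z) = schwarz_rearrangement f z"
        using f\<gamma> fs by eventually_elim simp
      ultimately show "\<exists>h. sym_decreasing h \<and> (AE z in lborel. \<gamma> (r, z) = h z)" by blast
    qed
  qed
qed

subsection \<open>Test functions and the completion\<close>

lemma sum_Basis_R3: "(\<Sum>b\<in>(Basis :: R3 set). f b) = f (1, 0, 0) + f (0, 1, 0) + f (0, 0, 1)"
  by (simp add: Basis_prod_def zero_prod_def add_ac)

lemma norm_grad_sq: "(norm (grad f x))\<^sup>2 = (\<Sum>b\<in>Basis. (frechet_derivative f (at x) b)\<^sup>2)"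
  unfolding power2_norm_eq_inner
  by (subst euclidean_inner) (simp add: grad_def inner_sum_left_Basis power2_eq_square)

lemma integrable_lborel_compact_support:
  fixes f :: "'a::euclidean_space \<Rightarrow> real"
  assumes "continuous_on UNIV f" "compact K" "\<And>x. x \<notin> K \<Longrightarrow> f x = 0"
  shows "integrable lborel f"
proof -
  have "integrable lborel (\<lambda>x. indicator K x *\<^sub>R f x)"
    by (rule borel_integrable_compact[OF assms(2) continuous_on_subset[OF assms(1)]]) simp
  moreover have "(\<lambda>x. indicator K x *\<^sub>R f x) = f"
    using assms(3) by (auto simp: indicator_def fun_eq_iff)
  ultimately show ?thesis by simp
qed

section \<open>Calculus of a fixed test function\<close>

context
  fixes \<phi> :: "'a::euclidean_space \<Rightarrow> real"
  assumes \<phi>: "\<phi> \<in> Cc_infinity"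
begin

lemma Cc_infinity_differentiable: "\<phi> differentiable (at x)"
proof -
  have "C_k (Suc 0) \<phi>" using \<phi> unfolding Cc_infinity_def by blast
  then show ?thesis by simp
qed

lemma Cc_infinity_has_derivative: "(\<phi> has_derivative frechet_derivative \<phi> (at x)) (at x)"
  using Cc_infinity_differentiable by (simp add: frechet_derivative_works)

lemma Cc_infinity_continuous: "continuous_on UNIV \<phi>"
  using Cc_infinity_differentiable
  by (auto simp: continuous_on_eq_continuous_at intro: differentiable_imp_continuous_within)

lemma Cc_infinity_partial_continuous:
  assumes "b \<in> Basis"
  shows "continuous_on UNIV (\<lambda>x. frechet_derivative \<phi> (at x) b)"
proof -
  have "C_k (Suc (Suc 0)) \<phi>" using \<phi> unfolding Cc_infinity_def by blast
  then have "(\<lambda>x. frechet_derivative \<phi> (at x) b) differentiable (at x)" for x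
    using assms by simp
  then show ?thesis
    by (auto simp: continuous_on_eq_continuous_at intro: differentiable_imp_continuous_within)
qed

lemma Cc_infinity_grad_continuous: "continuous_on UNIV (grad \<phi>)"
  unfolding grad_def[abs_def] by (intro continuous_intros Cc_infinity_partial_continuous)

lemma Cc_infinity_compact: "compact (closure {x. \<phi> x \<noteq> 0})"
  using \<phi> by (simp add: Cc_infinity_def)

lemma Cc_infinity_eq_0: "x \<notin> closure {x. \<phi> x \<noteq> 0} \<Longrightarrow> \<phi> x = 0"
  using closure_subset[of "{x. \<phi> x \<noteq> 0}"] by blast

lemma Cc_infinity_grad_eq_0:
  assumes "x \<notin> closure {x. \<phi> x \<noteq> 0}"
  shows "grad \<phi> x = 0"
proof -
  have "(\<phi> has_derivative (\<lambda>_. 0)) (at x)"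
  proof (rule has_derivative_transform_within_open)
    show "((\<lambda>_. 0 :: real) has_derivative (\<lambda>_. 0)) (at x)" by (rule has_derivative_const)
    show "open (- closure {x. \<phi> x \<noteq> 0})" by (intro open_Compl closed_closure)
    show "x \<in> - closure {x. \<phi> x \<noteq> 0}" using assms by simp
    show "0 = \<phi> y" if "y \<in> - closure {x. \<phi> x \<noteq> 0}" for y
      using Cc_infinity_eq_0[of y] that by simp
  qed
  then have "frechet_derivative \<phi> (at x) = (\<lambda>_. 0)" by (rule frechet_derivative_at[symmetric])
  then show ?thesis by (simp add: grad_def)
qed

lemma Cc_infinity_bounded_support: "\<exists>L>0. \<forall>x. L \<le> norm x \<longrightarrow> \<phi> x = 0"
proof -
  have "bounded (closure {x. \<phi> x \<noteq> 0})" using Cc_infinity_compact by (rule compact_imp_bounded)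
  then obtain B where B: "0 < B" "\<forall>x\<in>closure {x. \<phi> x \<noteq> 0}. norm x \<le> B"
    unfolding bounded_pos by blast
  show ?thesis
  proof (intro exI[of _ "B + 1"] conjI allI impI)
    fix x :: 'a assume "B + 1 \<le> norm x"
    then have "x \<notin> closure {x. \<phi> x \<noteq> 0}" using B(2) by force
    then show "\<phi> x = 0" by (rule Cc_infinity_eq_0)
  qed (use B in simp)
qed

lemma Cc_infinity_grad_integrable: "integrable lborel (\<lambda>x. (norm (grad \<phi> x))\<^sup>2)"
proof (rule integrable_lborel_compact_support[OF _ Cc_infinity_compact])
  show "continuous_on UNIV (\<lambda>x. (norm (grad \<phi> x))\<^sup>2)"
    by (intro continuous_intros Cc_infinity_grad_continuous)
  show "(norm (grad \<phi> x))\<^sup>2 = 0" if "x \<notin> closure {x. \<phi> x \<noteq> 0}" for x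
    by (subst Cc_infinity_grad_eq_0[OF that]) simp
qed

lemma grad_norm_sq: "(\<integral>\<^sup>+x. ennreal ((norm (grad \<phi> x))\<^sup>2) \<partial>lborel) = ennreal ((grad_norm \<phi>)\<^sup>2)"
  unfolding grad_norm_def using Cc_infinity_grad_integrable
  by (subst nn_integral_eq_integral) (auto intro!: Bochner_Integration.integral_nonneg)

end

section \<open>Approximating sequences of test functions\<close>

lemma grad_diff:
  assumes "f differentiable (at x)" "g differentiable (at x)"
  shows "grad (\<lambda>x. f x - g x) x = grad f x - grad g x"
proof -
  have "frechet_derivative (\<lambda>x. f x - g x) (at x) = (\<lambda>h. frechet_derivative f (at x) h - frechet_derivative g (at x) h)"
    using assms by (intro frechet_derivative_at[symmetric] has_derivative_diff) (auto simp: frechet_derivative_works)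
  then show ?thesis by (simp add: grad_def scaleR_diff_left sum_subtractf)
qed

text \<open>A Cauchy sequence is bounded; the elementary inequality for (norm (a - b))^2,
  integrated, takes the place of the triangle inequality for \<open>grad_norm\<close>.\<close>

lemma D12_approx_bounded:
  assumes "D12_approx \<phi> u"
  shows "bounded (range (\<lambda>n. grad_norm (\<phi> n)))"
proof -
  have \<phi>: "\<phi> n \<in> Cc_infinity" for n using assms by (simp add: D12_approx_def)
  obtain N where N: "\<And>m n. N \<le> m \<Longrightarrow> N \<le> n \<Longrightarrow> grad_norm (\<lambda>x. \<phi> m x - \<phi> n x) < 1"
    using assms unfolding D12_approx_def by (meson zero_less_one)
  have "(grad_norm (\<phi> n))\<^sup>2 \<le> 2 * (grad_norm (\<phi> N))\<^sup>2 + 2" if "N \<le> n" for n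
  proof -
    have g: "grad (\<lambda>x. \<phi> n x - \<phi> N x) x = grad (\<phi> n) x - grad (\<phi> N) x" for x
      by (intro grad_diff Cc_infinity_differentiable \<phi>)
    have le: "(norm (a - b))\<^sup>2 \<le> 2 * (norm a)\<^sup>2 + 2 * (norm b)\<^sup>2" for a b :: R3
    proof -
      have "(norm (a - b))\<^sup>2 \<le> (norm a + norm b)\<^sup>2" by (intro power_mono norm_triangle_ineq4) auto
      also have "\<dots> \<le> 2 * (norm a)\<^sup>2 + 2 * (norm b)\<^sup>2"
        using zero_le_power2[of "norm a - norm b"] by (simp add: power2_eq_square algebra_simps)
      finally show ?thesis .
    qed
    have "continuous_on UNIV (\<lambda>x. (norm (grad (\<phi> n) x - grad (\<phi> N) x))\<^sup>2)"
      by (intro continuous_intros Cc_infinity_grad_continuous \<phi>)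
    then have m: "(\<lambda>x. (norm (grad (\<phi> n) x - grad (\<phi> N) x))\<^sup>2) \<in> borel_measurable lborel"
      using borel_measurable_continuous_onI by auto
    have int: "integrable lborel (\<lambda>x. (norm (grad (\<phi> n) x - grad (\<phi> N) x))\<^sup>2)"
      by (rule Bochner_Integration.integrable_bound[where f = "\<lambda>x. 2 * (norm (grad (\<phi> n) x))\<^sup>2 + 2 * (norm (grad (\<phi> N) x))\<^sup>2"])
        (use m le in \<open>auto intro!: Cc_infinity_grad_integrable \<phi>\<close>)
    have "0 \<le> (\<integral>x. (norm (grad (\<phi> n) x - grad (\<phi> N) x))\<^sup>2 \<partial>lborel)" by (rule Bochner_Integration.integral_nonneg) simp
    moreover have "sqrt (\<integral>x. (norm (grad (\<phi> n) x - grad (\<phi> N) x))\<^sup>2 \<partial>lborel) < 1"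
      using N[OF that order_refl] unfolding grad_norm_def g .
    ultimately have lt1: "(\<integral>x. (norm (grad (\<phi> n) x - grad (\<phi> N) x))\<^sup>2 \<partial>lborel) < 1" by simp
    have sq: "(grad_norm (\<phi> k))\<^sup>2 = (\<integral>x. (norm (grad (\<phi> k) x))\<^sup>2 \<partial>lborel)" for k
      unfolding grad_norm_def by (intro real_sqrt_pow2 Bochner_Integration.integral_nonneg) simp
    have "(grad_norm (\<phi> n))\<^sup>2 \<le> (\<integral>x. 2 * (norm (grad (\<phi> N) x))\<^sup>2 + 2 * (norm (grad (\<phi> n) x - grad (\<phi> N) x))\<^sup>2 \<partial>lborel)"
      unfolding sq
    proof (rule integral_mono)
      show "(norm (grad (\<phi> n) x))\<^sup>2 \<le> 2 * (norm (grad (\<phi> N) x))\<^sup>2 + 2 * (norm (grad (\<phi> n) x - grad (\<phi> N) x))\<^sup>2" for x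
        using le[of "grad (\<phi> N) x" "grad (\<phi> N) x - grad (\<phi> n) x"] by (simp add: norm_minus_commute)
    qed (auto intro!: Cc_infinity_grad_integrable \<phi> int)
    also have "\<dots> = 2 * (grad_norm (\<phi> N))\<^sup>2 + 2 * (\<integral>x. (norm (grad (\<phi> n) x - grad (\<phi> N) x))\<^sup>2 \<partial>lborel)"
      unfolding sq by (simp add: int Cc_infinity_grad_integrable \<phi>)
    also have "\<dots> \<le> 2 * (grad_norm (\<phi> N))\<^sup>2 + 2" using lt1 by simp
    finally show ?thesis .
  qed
  then have "grad_norm (\<phi> n) \<le> sqrt (2 * (grad_norm (\<phi> N))\<^sup>2 + 2)" if "N \<le> n" for n
    using that by (intro real_le_rsqrt) auto
  moreover have "0 \<le> grad_norm (\<phi> n)" for n by (simp add: grad_norm_def Bochner_Integration.integral_nonneg)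
  ultimately have "\<forall>n\<ge>N. norm (grad_norm (\<phi> n)) \<le> sqrt (2 * (grad_norm (\<phi> N))\<^sup>2 + 2)" by simp
  then have "Bseq (\<lambda>n. grad_norm (\<phi> n))"
    by (intro BfunI[where K = "sqrt (2 * (grad_norm (\<phi> N))\<^sup>2 + 2)"]) (auto simp: eventually_sequentially)
  then show ?thesis by (simp add: Bseq_eq_bounded)
qed

text \<open>Along a subsequence the gradient norms of an approximating sequence converge, so the choice
  in the definition of \<^const>\<open>D12_norm\<close> is not vacuous.\<close>

lemma D12_norm_approx:
  assumes "u \<in> D12"
  obtains \<phi> where "D12_approx \<phi> u" "(\<lambda>n. grad_norm (\<phi> n)) \<longlonglongrightarrow> D12_norm u"
proof -
  obtain \<phi> where \<phi>: "D12_approx \<phi> u" using assms by (auto simp: D12_def)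
  obtain l s where s: "strict_mono (s :: nat \<Rightarrow> nat)" "((\<lambda>n. grad_norm (\<phi> n)) \<circ> s) \<longlonglongrightarrow> l"
    using bounded_imp_convergent_subsequence[OF D12_approx_bounded[OF \<phi>]] by blast
  have "D12_approx (\<phi> \<circ> s) u"
    unfolding D12_approx_def
  proof (intro conjI allI impI)
    fix e :: real assume "0 < e"
    then obtain N where "\<forall>m\<ge>N. \<forall>n\<ge>N. grad_norm (\<lambda>x. \<phi> m x - \<phi> n x) < e"
      using \<phi> unfolding D12_approx_def by blast
    moreover have "N \<le> s n" if "N \<le> n" for n using seq_suble[OF s(1), of n] that by linarith
    ultimately show "\<exists>N. \<forall>m\<ge>N. \<forall>n\<ge>N. grad_norm (\<lambda>x. (\<phi> \<circ> s) m x - (\<phi> \<circ> s) n x) < e"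
      by (intro exI[of _ N]) auto
  next
    have "(\<lambda>n. Lp_norm lborel 6 (\<lambda>x. \<phi> n x - u x)) \<longlonglongrightarrow> 0" using \<phi> by (simp add: D12_approx_def)
    from LIMSEQ_subseq_LIMSEQ[OF this s(1)]
    show "(\<lambda>n. Lp_norm lborel 6 (\<lambda>x. (\<phi> \<circ> s) n x - u x)) \<longlonglongrightarrow> 0" by (simp add: o_def)
  qed (use \<phi> in \<open>auto simp: D12_approx_def\<close>)
  then have "\<exists>l \<phi>. D12_approx \<phi> u \<and> (\<lambda>n. grad_norm (\<phi> n)) \<longlonglongrightarrow> l"
    using s(2) by (auto simp: o_def)
  then have "\<exists>\<phi>. D12_approx \<phi> u \<and> (\<lambda>n. grad_norm (\<phi> n)) \<longlonglongrightarrow> D12_norm u"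
    unfolding D12_norm_def by (rule someI_ex)
  then show thesis using that by blast
qed

lemma D12_measurable: "u \<in> D12 \<Longrightarrow> u \<in> borel_measurable borel"
  by (auto simp: D12_def D12_approx_def Lp_def)

text \<open>The gradient norms of the approximants converge to a number at most C, so eventually
  they lie strictly below |C| + 1. The absolute value makes this bound positive without examining
  the sign of C.\<close>

lemma D12_test_function:
  assumes u: "u \<in> D12" "D12_norm u \<le> C" and "0 < e"
  obtains \<phi> where "\<phi> \<in> Cc_infinity"
    "(\<integral>\<^sup>+x. ennreal ((norm (grad \<phi> x))\<^sup>2) \<partial>lborel) \<le> ennreal ((\<bar>C\<bar> + 1)\<^sup>2)"
    "(\<integral>\<^sup>+x. ennreal ((\<phi> x - u x) ^ 6) \<partial>lborel) \<le> ennreal e"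
proof -
  note [measurable] = D12_measurable[OF u(1)]
  obtain \<phi> where \<phi>: "D12_approx \<phi> u" "(\<lambda>n. grad_norm (\<phi> n)) \<longlonglongrightarrow> D12_norm u"
    by (rule D12_norm_approx[OF u(1)])
  then have Cc: "\<phi> n \<in> Cc_infinity" for n by (simp add: D12_approx_def)
  have [measurable]: "\<phi> n \<in> borel_measurable borel" for n
    by (intro borel_measurable_continuous_onI Cc_infinity_continuous Cc)
  have powr6: "\<bar>x\<bar> powr 6 = x ^ 6" for x :: real by (cases "x = 0") auto
  have u6: "integrable lborel (\<lambda>x. u x ^ 6)"
    using \<phi>(1) by (simp add: D12_approx_def Lp_def powr6)
  have \<phi>6: "integrable lborel (\<lambda>x. \<phi> n x ^ 6)" for n
  proof (rule integrable_lborel_compact_support[OF _ Cc_infinity_compact[OF Cc[of n]]])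
    show "continuous_on UNIV (\<lambda>x. \<phi> n x ^ 6)" by (intro continuous_on_power Cc_infinity_continuous Cc)
    show "\<phi> n x ^ 6 = 0" if "x \<notin> closure {x. \<phi> n x \<noteq> 0}" for x
      by (subst Cc_infinity_eq_0[OF Cc that]) simp
  qed
  have int: "integrable lborel (\<lambda>x. (\<phi> n x - u x) ^ 6)" for n
  proof (rule Bochner_Integration.integrable_bound[where f = "\<lambda>x. 64 * (\<phi> n x ^ 6 + u x ^ 6)"])
    show "AE x in lborel. norm ((\<phi> n x - u x) ^ 6) \<le> norm (64 * (\<phi> n x ^ 6 + u x ^ 6))"
      using power6_add_le[of "\<phi> n _" "- u _"] by (intro AE_I2) (simp add: abs_of_nonneg)
  qed (use u6 \<phi>6 in auto)
  have "\<forall>\<^sub>F n in sequentially. grad_norm (\<phi> n) < \<bar>C\<bar> + 1"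
    using \<phi>(2) u(2) by (intro order_tendstoD(2)) auto
  moreover have "\<forall>\<^sub>F n in sequentially. Lp_norm lborel 6 (\<lambda>x. \<phi> n x - u x) < e powr (1/6)"
    using \<phi>(1) \<open>0 < e\<close> by (intro order_tendstoD(2)[of _ 0]) (auto simp: D12_approx_def)
  ultimately have "\<forall>\<^sub>F n in sequentially. grad_norm (\<phi> n) < \<bar>C\<bar> + 1 \<and> Lp_norm lborel 6 (\<lambda>x. \<phi> n x - u x) < e powr (1/6)"
    by eventually_elim auto
  then obtain n where n: "grad_norm (\<phi> n) < \<bar>C\<bar> + 1" "Lp_norm lborel 6 (\<lambda>x. \<phi> n x - u x) < e powr (1/6)"
    by (auto simp: eventually_sequentially)
  have "(\<integral>x. (\<phi> n x - u x) ^ 6 \<partial>lborel) \<le> e"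
  proof (rule ccontr)
    assume "\<not> (\<integral>x. (\<phi> n x - u x) ^ 6 \<partial>lborel) \<le> e"
    then have "e powr (1/6) \<le> (\<integral>x. (\<phi> n x - u x) ^ 6 \<partial>lborel) powr (1/6)"
      using \<open>0 < e\<close> by (intro powr_mono2) auto
    then show False using n(2) by (simp add: Lp_norm_def powr6)
  qed
  then have "(\<integral>\<^sup>+x. ennreal ((\<phi> n x - u x) ^ 6) \<partial>lborel) \<le> ennreal e"
    using int[of n] by (subst nn_integral_eq_integral) (auto intro: ennreal_leI)
  moreover have "(\<integral>\<^sup>+x. ennreal ((norm (grad (\<phi> n) x))\<^sup>2) \<partial>lborel) \<le> ennreal ((\<bar>C\<bar> + 1)\<^sup>2)"
    unfolding grad_norm_sq[OF Cc] using n(1)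
    by (intro ennreal_leI power_mono) (auto simp: grad_norm_def Bochner_Integration.integral_nonneg)
  ultimately show thesis using that[OF Cc] by blast
qed

text \<open>\<open>g1\<close> is the derivative of \<phi> in the horizontal unit direction (cos
  \<theta>, sin \<theta>, 0) and \<open>g2\<close> the one in the z direction. These directions are
  orthonormal, so the energy density on the half plane is at most the squared gradient in
  space.\<close>

lemma half_plane_test_slice:
  fixes \<phi> :: "R3 \<Rightarrow> real"
  assumes \<phi>: "\<phi> \<in> Cc_infinity" and "0 \<le> K"
    and le: "(\<integral>\<^sup>+w. ennreal ((norm (grad \<phi> (polar t w)))\<^sup>2) \<partial>cyl) \<le> ennreal K"
  shows "\<exists>g1 g2 L. half_plane_test (\<lambda>w. \<phi> (polar t w)) g1 g2 L K"
proof -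
  define p where "p b x = frechet_derivative \<phi> (at x) b" for b x
  define c where "c = slope_cos t"
  define g1 where "g1 w = c * p (1, 0, 0) (polar t w) + t * c * p (0, 1, 0) (polar t w)" for w
  define g2 where "g2 w = p (0, 0, 1) (polar t w)" for w
  have basis: "(1, 0, 0) \<in> (Basis :: R3 set)" "(0, 1, 0) \<in> (Basis :: R3 set)" "(0, 0, 1) \<in> (Basis :: R3 set)"
    by (auto simp: Basis_prod_def zero_prod_def)
  have cont_polar: "continuous_on UNIV (polar t)"
    unfolding polar_def[abs_def] by (intro continuous_intros)
  have cont: "continuous_on UNIV (\<lambda>w. f (polar t w))" if "continuous_on UNIV f" for f :: "R3 \<Rightarrow> real"
    by (rule continuous_on_compose2[OF that cont_polar]) simp
  have cont_p: "continuous_on UNIV (p b)" if "b \<in> Basis" for b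
    unfolding p_def[abs_def] by (rule Cc_infinity_partial_continuous[OF \<phi> that])
  obtain L where L: "0 < L" "\<And>x. L \<le> norm x \<Longrightarrow> \<phi> x = 0"
    using Cc_infinity_bounded_support[OF \<phi>] by blast
  have lin: "linear (frechet_derivative \<phi> (at x))" for x
    using Cc_infinity_has_derivative[OF \<phi>] by (rule has_derivative_linear)
  have "half_plane_test (\<lambda>w. \<phi> (polar t w)) g1 g2 L K"
  proof
    show "continuous_on UNIV (\<lambda>w. \<phi> (polar t w))" by (intro cont Cc_infinity_continuous \<phi>)
    show "continuous_on UNIV g1" "continuous_on UNIV g2"
      unfolding g1_def[abs_def] g2_def[abs_def] by (intro continuous_intros cont cont_p basis)+
    fix r z :: real
    have "((\<lambda>r. polar t (r, z)) has_derivative (\<lambda>h. (h * c, h * (t * c), 0))) (at r)"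
      unfolding polar_def c_def by (auto intro!: derivative_eq_intros)
    from has_derivative_compose[OF this Cc_infinity_has_derivative[OF \<phi>]]
    have "((\<lambda>r. \<phi> (polar t (r, z))) has_derivative
        (\<lambda>h. frechet_derivative \<phi> (at (polar t (r, z))) (h * c, h * (t * c), 0))) (at r)" .
    moreover have "frechet_derivative \<phi> (at x) (h * c, h * (t * c), 0) = (c * p (1, 0, 0) x + t * c * p (0, 1, 0) x) * h" for h x
    proof -
      have "(h * c, h * (t * c), 0) = (h * c) *\<^sub>R (1, 0, 0) + (h * (t * c)) *\<^sub>R (0, 1, 0 :: real)" by simp
      then show ?thesis
        by (simp only: linear_add[OF lin] linear_scale[OF lin] p_def) (simp add: algebra_simps)
    qed
    ultimately show "((\<lambda>r. \<phi> (polar t (r, z))) has_real_derivative g1 (r, z)) (at r)"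
      by (simp add: has_field_derivative_def g1_def)
    have "((\<lambda>z. polar t (r, z)) has_derivative (\<lambda>h. (0, 0, h))) (at z)"
      unfolding polar_def by (auto intro!: derivative_eq_intros)
    from has_derivative_compose[OF this Cc_infinity_has_derivative[OF \<phi>]]
    have "((\<lambda>z. \<phi> (polar t (r, z))) has_derivative
        (\<lambda>h. frechet_derivative \<phi> (at (polar t (r, z))) (0, 0, h))) (at z)" .
    moreover have "frechet_derivative \<phi> (at x) (0, 0, h) = p (0, 0, 1) x * h" for h x
    proof -
      have "(0, 0, h) = h *\<^sub>R (0 :: real, 0 :: real, 1)" by simp
      then show ?thesis by (simp only: linear_scale[OF lin] p_def) simp
    qed
    ultimately show "((\<lambda>z. \<phi> (polar t (r, z))) has_real_derivative g2 (r, z)) (at z)"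
      by (simp add: has_field_derivative_def g2_def)
    have "(r * c)\<^sup>2 + (r * (t * c))\<^sup>2 = r\<^sup>2"
      using slope_cos_sq[of t] by (simp add: c_def power_mult_distrib flip: distrib_left)
    moreover have "norm (polar t (r, z)) = sqrt ((r * c)\<^sup>2 + ((r * (t * c))\<^sup>2 + z\<^sup>2))"
      by (simp add: polar_def norm_Pair c_def)
    ultimately have "norm (polar t (r, z)) = sqrt (r\<^sup>2 + z\<^sup>2)" by (simp add: add.assoc[symmetric])
    moreover have "\<bar>r\<bar> \<le> sqrt (r\<^sup>2 + z\<^sup>2)" "\<bar>z\<bar> \<le> sqrt (r\<^sup>2 + z\<^sup>2)"
      by (simp_all add: real_le_rsqrt)
    ultimately show "\<phi> (polar t (r, z)) = 0" if "L \<le> \<bar>r\<bar> \<or> L \<le> \<bar>z\<bar>"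
      using that by (intro L(2)) linarith
  next
    have "(g1 w)\<^sup>2 + (g2 w)\<^sup>2 \<le> (norm (grad \<phi> (polar t w)))\<^sup>2" for w
    proof -
      define a b where "a = p (1, 0, 0) (polar t w)" and "b = p (0, 1, 0) (polar t w)"
      \<comment> \<open>Cauchy-Schwarz; the discarded square is that of the derivative in the
        angular direction (-t c, c).\<close>
      have "(c * a + t * c * b)\<^sup>2 \<le> (c\<^sup>2 + (t * c)\<^sup>2) * (a\<^sup>2 + b\<^sup>2)"
        using zero_le_power2[of "c * b - t * c * a"] by (simp add: power2_eq_square algebra_simps)
      also have "c\<^sup>2 + (t * c)\<^sup>2 = 1" unfolding c_def by (rule slope_cos_sq)
      finally have "(g1 w)\<^sup>2 \<le> a\<^sup>2 + b\<^sup>2" by (simp add: g1_def a_def b_def)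
      then show ?thesis by (simp add: norm_grad_sq sum_Basis_R3 g2_def p_def a_def b_def)
    qed
    then have "(\<integral>\<^sup>+w. ennreal ((g1 w)\<^sup>2 + (g2 w)\<^sup>2) \<partial>cyl) \<le> (\<integral>\<^sup>+w. ennreal ((norm (grad \<phi> (polar t w)))\<^sup>2) \<partial>cyl)"
      by (intro nn_integral_mono ennreal_leI)
    also note le
    finally show "(\<integral>\<^sup>+w. ennreal ((g1 w)\<^sup>2 + (g2 w)\<^sup>2) \<partial>cyl) \<le> ennreal K" .
  qed (fact L(1) \<open>0 \<le> K\<close>)+
  then show ?thesis by blast
qed

text \<open>
  Averaging over the slope \<open>t\<close> of a half plane, some half plane carries at most a fixed multiple of
  the energy and of the \<open>L\<^sup>6\<close> distance, so no rotational averaging of test functions is needed.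
\<close>

lemma D12_profile:
  fixes u :: "R3 \<Rightarrow> real"
  assumes u: "u \<in> D12" "D12_norm u \<le> C"
    and [measurable]: "\<gamma> \<in> borel_measurable borel"
    and \<gamma>: "AE t in lborel. AE w in cyl. u (polar t w) = \<gamma> w \<and> u (polar' t w) = \<gamma> w"
  shows "profile (8 * (\<bar>C\<bar> + 1)\<^sup>2) \<gamma>"
  unfolding profile_def
proof (intro conjI allI impI)
  fix e :: real assume "0 < e"
  note [measurable] = D12_measurable[OF u(1)]
  define K where "K = (\<bar>C\<bar> + 1)\<^sup>2"
  have "0 < K" by (simp add: K_def zero_less_power)
  obtain \<phi> where \<phi>: "\<phi> \<in> Cc_infinity"
    "(\<integral>\<^sup>+x. ennreal ((norm (grad \<phi> x))\<^sup>2) \<partial>lborel) \<le> ennreal K"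
    "(\<integral>\<^sup>+x. ennreal ((\<phi> x - u x) ^ 6) \<partial>lborel) \<le> ennreal (e / 8)"
    unfolding K_def by (rule D12_test_function[OF u, of "e / 8"]) (use \<open>0 < e\<close> in auto)
  have [measurable]: "\<phi> \<in> borel_measurable borel" "grad \<phi> \<in> borel_measurable borel"
    by (intro borel_measurable_continuous_onI Cc_infinity_continuous Cc_infinity_grad_continuous \<phi>)+
  define A where "A t = (\<integral>\<^sup>+w. ennreal ((norm (grad \<phi> (polar t w)))\<^sup>2) \<partial>cyl)" for t
  define B where "B t = (\<integral>\<^sup>+w. ennreal ((\<phi> (polar t w) - u (polar t w)) ^ 6) \<partial>cyl)" for t
  have [measurable]: "A \<in> borel_measurable borel" "B \<in> borel_measurable borel"
    unfolding A_def[abs_def] B_def[abs_def] by measurable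
  have half: "(\<integral>\<^sup>+t. ennreal ((slope_cos t)\<^sup>2) * (\<integral>\<^sup>+w. h (polar t w) \<partial>cyl) \<partial>lborel) \<le> (\<integral>\<^sup>+x. h x \<partial>lborel)"
    if [measurable]: "h \<in> borel_measurable borel" for h
    unfolding nn_integral_half_space_polar[OF that, symmetric]
    by (intro nn_integral_mono) (auto split: split_indicator)
  have intA: "(\<integral>\<^sup>+t. ennreal ((slope_cos t)\<^sup>2) * A t \<partial>lborel) \<le> ennreal K"
    unfolding A_def by (rule order_trans[OF half \<phi>(2)]) measurable
  have intB: "(\<integral>\<^sup>+t. ennreal ((slope_cos t)\<^sup>2) * B t \<partial>lborel) \<le> ennreal (e / 8)"
    unfolding B_def by (rule order_trans[OF half \<phi>(3)]) measurable
  have "\<exists>t. (AE w in cyl. u (polar t w) = \<gamma> w \<and> u (polar' t w) = \<gamma> w) \<and> A t \<le> ennreal (8 * K) \<and> B t \<le> ennreal e"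
  proof (rule ccontr)
    assume no: "\<nexists>t. (AE w in cyl. u (polar t w) = \<gamma> w \<and> u (polar' t w) = \<gamma> w) \<and> A t \<le> ennreal (8 * K) \<and> B t \<le> ennreal e"
    \<comment> \<open>Slopes in [0, 1] satisfy \<open>(slope_cos t)\<^sup>2\<close> \<ge> 1/2, so
      almost every one of them makes one of the two weighted terms at least 1. The integrals of the
      terms are at most 1/4 each; the constants 8 K and e / 8 are tuned to this
      contradiction.\<close>
    have "1 = (\<integral>\<^sup>+t. indicator {0..1::real} t \<partial>lborel)" by simp
    also have "\<dots> \<le> (\<integral>\<^sup>+t. ennreal (1 / (4 * K)) * (ennreal ((slope_cos t)\<^sup>2) * A t)
        + ennreal (2 / e) * (ennreal ((slope_cos t)\<^sup>2) * B t) \<partial>lborel)"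
    proof (rule nn_integral_mono_AE)
      show "AE t in lborel. indicator {0..1} t \<le> ennreal (1 / (4 * K)) * (ennreal ((slope_cos t)\<^sup>2) * A t)
        + ennreal (2 / e) * (ennreal ((slope_cos t)\<^sup>2) * B t)"
        using \<gamma>
      proof eventually_elim
        case (elim t)
        have or: "ennreal (8 * K) \<le> A t \<or> ennreal e \<le> B t"
        proof (rule ccontr)
          assume "\<not> (ennreal (8 * K) \<le> A t \<or> ennreal e \<le> B t)"
          then have "A t \<le> ennreal (8 * K)" "B t \<le> ennreal e" by auto
          with elim no show False by blast
        qed
        show ?case
        proof (cases "t \<in> {0..1}")
          case True
          then have "t\<^sup>2 \<le> 1" by (simp add: power_le_one)
          then have sc: "1 / 2 \<le> (slope_cos t)\<^sup>2"
            by (simp add: slope_cos_def power_divide add_pos_nonneg divide_simps)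
          have one: "1 \<le> ennreal a * (ennreal ((slope_cos t)\<^sup>2) * X)" if "ennreal (2 / a) \<le> X" "0 < a" for a X
          proof -
            have "1 = ennreal (a * (1 / 2 * (2 / a)))" using \<open>0 < a\<close> by simp
            also have "\<dots> = ennreal a * (ennreal (1 / 2) * ennreal (2 / a))"
              using \<open>0 < a\<close>
              by (intro trans[OF ennreal_mult] arg_cong[where f = "\<lambda>x. ennreal a * x"] ennreal_mult) auto
            also have "\<dots> \<le> ennreal a * (ennreal ((slope_cos t)\<^sup>2) * X)"
              by (intro mult_left_mono mult_mono that ennreal_leI sc) auto
            finally show ?thesis .
          qed
          from or show ?thesis
          proof
            assume "ennreal (8 * K) \<le> A t"
            then have "1 \<le> ennreal (1 / (4 * K)) * (ennreal ((slope_cos t)\<^sup>2) * A t)"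
              using \<open>0 < K\<close> by (intro one) auto
            then show ?thesis using True by (simp add: add_increasing2)
          next
            assume "ennreal e \<le> B t"
            then have "1 \<le> ennreal (2 / e) * (ennreal ((slope_cos t)\<^sup>2) * B t)"
              using \<open>0 < e\<close> by (intro one) auto
            then show ?thesis using True by (simp add: add_increasing)
          qed
        qed simp
      qed
    qed
    also have "\<dots> = ennreal (1 / (4 * K)) * (\<integral>\<^sup>+t. ennreal ((slope_cos t)\<^sup>2) * A t \<partial>lborel)
        + ennreal (2 / e) * (\<integral>\<^sup>+t. ennreal ((slope_cos t)\<^sup>2) * B t \<partial>lborel)"
      by (simp add: nn_integral_add nn_integral_cmult)
    also have "\<dots> \<le> ennreal (1 / (4 * K)) * ennreal K + ennreal (2 / e) * ennreal (e / 8)"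
      by (intro add_mono mult_left_mono intA intB) auto
    also have "\<dots> = ennreal (1 / 4) + ennreal (1 / 4)"
      using \<open>0 < K\<close> \<open>0 < e\<close> by (simp flip: ennreal_mult)
    also have "\<dots> = ennreal (1 / 2)" by (subst ennreal_plus[symmetric]) auto
    finally have "ennreal 1 \<le> ennreal (1 / 2)" by (simp only: ennreal_1)
    then show False by (subst (asm) ennreal_le_iff) auto
  qed
  then obtain t where t: "AE w in cyl. u (polar t w) = \<gamma> w \<and> u (polar' t w) = \<gamma> w"
    "A t \<le> ennreal (8 * K)" "B t \<le> ennreal e" by blast
  obtain g1 g2 L where test: "half_plane_test (\<lambda>w. \<phi> (polar t w)) g1 g2 L (8 * (\<bar>C\<bar> + 1)\<^sup>2)"
    using half_plane_test_slice[OF \<phi>(1), of "8 * K" t] t(2) \<open>0 < K\<close> by (auto simp: A_def K_def)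
  have "(\<integral>\<^sup>+w. ennreal ((\<phi> (polar t w) - \<gamma> w) ^ 6) \<partial>cyl) = B t"
    unfolding B_def using t(1) by (intro nn_integral_cong_AE) (auto elim: eventually_mono)
  then have le: "(\<integral>\<^sup>+w. ennreal ((\<phi> (polar t w) - \<gamma> w) ^ 6) \<partial>cyl) \<le> ennreal e" using t(3) by simp
  show "\<exists>g g1 g2 L. half_plane_test g g1 g2 L (8 * (\<bar>C\<bar> + 1)\<^sup>2) \<and>
      (\<integral>\<^sup>+w. ennreal ((g w - \<gamma> w) ^ 6) \<partial>cyl) \<le> ennreal e"
    by (rule exI, rule exI, rule exI, rule exI, rule conjI, rule test, rule le)
qed measurable

section \<open>Assembly in space\<close>

lemma AE_cyl_pos: "AE w in cyl. 0 < fst w"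
  unfolding cyl_def by (subst AE_density) auto

theorem theorem3p2:
  fixes u :: "nat \<Rightarrow> R3 \<Rightarrow> real" and p q :: real
  assumes "\<And>j. u j \<in> D12_cyl"
    and "\<exists>C. \<forall>j. D12_norm (u j) \<le> C"
    and "\<And>j. AE w in lborel. z_rearrangement (u j) w = u j w"
    and "1 < p" and "p < 6" and "6 < q"
  shows "\<exists>r v. strict_mono (r :: nat \<Rightarrow> nat) \<and>
           (\<forall>j. u (r j) \<in> Lp_plus_Lq lborel p q) \<and>
           v \<in> Lp_plus_Lq lborel p q \<and>
           (\<lambda>j. Lp_plus_Lq_norm lborel p q (\<lambda>w. u (r j) w - v w)) \<longlonglongrightarrow> 0"
proof -
  obtain C where C: "\<And>j. D12_norm (u j) \<le> C" using assms(2) by blast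
  have D12: "u j \<in> D12" and rad: "AE z in lborel. radial_ae (\<lambda>(x, y). u j (x, y, z))" for j
    using assms(1)[of j] by (auto simp: D12_cyl_def)
  note u_meas [measurable] = D12_measurable[OF D12]
  have "\<exists>\<gamma>. \<gamma> \<in> borel_measurable borel \<and>
      (AE t in lborel. AE w in cyl. u j (polar t w) = \<gamma> w \<and> u j (polar' t w) = \<gamma> w)" for j
    by (rule radial_profile[OF u_meas rad[of j]]) (intro exI conjI)
  from choice[OF allI, OF this] obtain \<gamma> where \<gamma>: "\<forall>j. \<gamma> j \<in> borel_measurable borel \<and>
      (AE t in lborel. AE w in cyl. u j (polar t w) = \<gamma> j w \<and> u j (polar' t w) = \<gamma> j w)"
    by (rule exE)
  have \<gamma>_meas [measurable]: "\<gamma> j \<in> borel_measurable borel" for j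
    using \<gamma> by (rule allE[of _ j]) (rule conjunct1)
  have u\<gamma>: "AE t in lborel. AE w in cyl. u j (polar t w) = \<gamma> j w \<and> u j (polar' t w) = \<gamma> j w" for j
    using \<gamma> by (rule allE[of _ j]) (rule conjunct2)
  define K where "K = 8 * (\<bar>C\<bar> + 1)\<^sup>2"
  define B where "B = 64 * (4096 * K ^ 3 + 1)"
  have "0 \<le> B" by (simp add: B_def K_def)
  have "0 \<le> cyl_const" by (simp add: cyl_const_def)
  have prof: "profile K (\<gamma> j)" for j
    unfolding K_def by (rule D12_profile[OF D12 C \<gamma>_meas u\<gamma>])
  have \<gamma>6: "(\<integral>\<^sup>+w. ennreal (\<gamma> j w ^ 6) \<partial>cyl) \<le> ennreal B" for j
    unfolding B_def by (rule profile_L6[OF prof])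
  have dec: "cyl_decreasing (\<gamma> j)" for j
    by (rule z_symmetric_profile[OF u_meas \<gamma>_meas u\<gamma> assms(3)]) (rule le_less_trans[OF \<gamma>6], simp)
  obtain k \<nu> where k: "strict_mono k" and \<nu>_meas [measurable]: "\<nu> \<in> borel_measurable borel"
    and \<nu>6: "(\<integral>\<^sup>+w. ennreal ((\<nu> w) ^ 6) \<partial>cyl) \<le> ennreal B"
    and conv: "\<And>e. 0 < e \<Longrightarrow> (\<lambda>n. emeasure cyl {w. e < \<bar>\<gamma> (k n) w - \<nu> w\<bar>}) \<longlonglongrightarrow> 0"
    by (rule profile_compactness[of K \<gamma>, OF prof dec, folded B_def]) (rule that)
  \<comment> \<open>The limit profile is rotated about the axis and defined at every point, so it
    agrees with \<nu> on every half plane, at all r > 0.\<close>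
  define v where "v x = \<nu> (norm (fst x, fst (snd x)), snd (snd x))" for x :: R3
  have v_meas [measurable]: "v \<in> borel_measurable borel" unfolding v_def[abs_def] by measurable
  have v\<nu>: "AE t in lborel. AE w in cyl. v (polar t w) = \<nu> w \<and> v (polar' t w) = \<nu> w"
  proof (rule AE_I2)
    show "AE w in cyl. v (polar t w) = \<nu> w \<and> v (polar' t w) = \<nu> w" for t
      using AE_cyl_pos by eventually_elim (simp only: v_def polar_norm abs_of_pos prod.collapse)
  qed
  define B' where "B' = cyl_const * B"
  have "0 \<le> B'" using \<open>0 \<le> B\<close> \<open>0 \<le> cyl_const\<close> by (simp add: B'_def)
  have u6: "(\<integral>\<^sup>+x. ennreal (u j x ^ 6) \<partial>lborel) \<le> ennreal B'" for j
  proof -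
    have "(\<integral>\<^sup>+x. ennreal (u j x ^ 6) \<partial>lborel) = ennreal cyl_const * (\<integral>\<^sup>+w. ennreal (\<gamma> j w ^ 6) \<partial>cyl)"
    proof (rule nn_integral_radial)
      show "AE t in lborel. AE w in cyl. ennreal (u j (polar t w) ^ 6) = ennreal (\<gamma> j w ^ 6) \<and>
          ennreal (u j (polar' t w) ^ 6) = ennreal (\<gamma> j w ^ 6)"
        using u\<gamma>[of j]
      proof eventually_elim
        case (elim t)
        then show ?case by eventually_elim simp
      qed
    qed measurable
    also have "\<dots> \<le> ennreal cyl_const * ennreal B" by (intro mult_left_mono \<gamma>6) auto
    finally show ?thesis using \<open>0 \<le> B\<close> \<open>0 \<le> cyl_const\<close> by (simp add: B'_def ennreal_mult)
  qed
  have v6: "(\<integral>\<^sup>+x. ennreal (v x ^ 6) \<partial>lborel) \<le> ennreal B'"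
  proof -
    have "(\<integral>\<^sup>+x. ennreal (v x ^ 6) \<partial>lborel) = ennreal cyl_const * (\<integral>\<^sup>+w. ennreal (\<nu> w ^ 6) \<partial>cyl)"
    proof (rule nn_integral_radial)
      show "AE t in lborel. AE w in cyl. ennreal (v (polar t w) ^ 6) = ennreal (\<nu> w ^ 6) \<and>
          ennreal (v (polar' t w) ^ 6) = ennreal (\<nu> w ^ 6)"
        using v\<nu>
      proof eventually_elim
        case (elim t)
        then show ?case by eventually_elim simp
      qed
    qed measurable
    also have "\<dots> \<le> ennreal cyl_const * ennreal B" by (intro mult_left_mono \<nu>6) auto
    finally show ?thesis using \<open>0 \<le> B\<close> \<open>0 \<le> cyl_const\<close> by (simp add: B'_def ennreal_mult)
  qed
  have diff6: "(\<integral>\<^sup>+x. ennreal ((u (k n) x - v x) ^ 6) \<partial>lborel) \<le> ennreal (64 * (B' + B'))" for n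
  proof -
    have "(\<integral>\<^sup>+x. ennreal ((u (k n) x - v x) ^ 6) \<partial>lborel)
        \<le> (\<integral>\<^sup>+x. ennreal 64 * (ennreal (u (k n) x ^ 6) + ennreal (v x ^ 6)) \<partial>lborel)"
    proof (rule nn_integral_mono)
      fix x
      have "ennreal ((u (k n) x - v x) ^ 6) \<le> ennreal (64 * (u (k n) x ^ 6 + v x ^ 6))"
        using power6_add_le[of "u (k n) x" "- v x"] by (intro ennreal_leI) simp
      then show "ennreal ((u (k n) x - v x) ^ 6) \<le> ennreal 64 * (ennreal (u (k n) x ^ 6) + ennreal (v x ^ 6))"
        by (subst (asm) ennreal_mult) auto
    qed
    also have "\<dots> = ennreal 64 * ((\<integral>\<^sup>+x. ennreal (u (k n) x ^ 6) \<partial>lborel) + (\<integral>\<^sup>+x. ennreal (v x ^ 6) \<partial>lborel))"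
      by (simp add: nn_integral_cmult nn_integral_add)
    also have "\<dots> \<le> ennreal 64 * (ennreal B' + ennreal B')"
      by (intro mult_left_mono add_mono u6 v6) auto
    also have "\<dots> = ennreal (64 * (B' + B'))"
      unfolding ennreal_plus[OF \<open>0 \<le> B'\<close> \<open>0 \<le> B'\<close>, symmetric]
      using \<open>0 \<le> B'\<close> by (intro ennreal_mult[symmetric]) auto
    finally show ?thesis .
  qed
  \<comment> \<open>Level sets of u - v are rotations of level sets of \<gamma> - \<nu> up to null
    sets, so convergence in measure carries over with the finite factor
    \<open>cyl_const\<close>.\<close>
  have meas: "(\<lambda>n. emeasure lborel {x \<in> space lborel. e < \<bar>u (k n) x - v x\<bar>}) \<longlonglongrightarrow> 0" if "0 < e" for e
  proof -
    have "emeasure lborel {x \<in> space lborel. e < \<bar>u (k n) x - v x\<bar>} =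
        ennreal cyl_const * emeasure cyl {w. e < \<bar>\<gamma> (k n) w - \<nu> w\<bar>}" for n
    proof -
      define X where "X = {x \<in> space lborel. e < \<bar>u (k n) x - v x\<bar>}"
      define Y where "Y = {w. e < \<bar>\<gamma> (k n) w - \<nu> w\<bar>}"
      have [measurable]: "X \<in> sets borel" "Y \<in> sets borel" unfolding X_def Y_def by measurable
      have "(\<integral>\<^sup>+x. indicator X x \<partial>lborel) = ennreal cyl_const * (\<integral>\<^sup>+w. indicator Y w \<partial>cyl)"
      proof (rule nn_integral_radial)
        show "AE t in lborel. AE w in cyl. indicator X (polar t w) = (indicator Y w :: ennreal) \<and>
            indicator X (polar' t w) = (indicator Y w :: ennreal)"
          using u\<gamma>[of "k n"] v\<nu>
        proof eventually_elim
          case (elim t)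
          then show ?case by eventually_elim (simp add: X_def Y_def indicator_def)
        qed
      qed measurable
      then show ?thesis by (simp add: X_def Y_def)
    qed
    moreover have "(\<lambda>n. ennreal cyl_const * emeasure cyl {w. e < \<bar>\<gamma> (k n) w - \<nu> w\<bar>}) \<longlonglongrightarrow> ennreal cyl_const * 0"
      by (intro ennreal_tendsto_cmult conv that) simp
    ultimately show ?thesis by simp
  qed
  have pq: "0 < p" "p < 6" "6 < q" using assms by auto
  have "(\<lambda>n. Lp_plus_Lq_norm lborel p q (\<lambda>w. u (k n) w - v w)) \<longlonglongrightarrow> 0"
    using diff6 meas _ pq by (rule Lp_plus_Lq_tendsto_0[rotated]) (use \<open>0 \<le> B'\<close> in auto)
  moreover have "u (k j) \<in> Lp_plus_Lq lborel p q" for j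
    by (rule L6_in_Lp_plus_Lq[OF _ u6 \<open>0 \<le> B'\<close> pq]) simp
  moreover have "v \<in> Lp_plus_Lq lborel p q"
    by (rule L6_in_Lp_plus_Lq[OF _ v6 \<open>0 \<le> B'\<close> pq]) simp
  ultimately show ?thesis using k by blast
qed

end
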